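(* Let $\mathbf{k}$ be a field, $V$ a finite-dimensional $\mathbf{k}$-vector space, and $d\ge 3$ an integer such that the characteristic of $\mathbf{k}$ does not divide $(d-1)d$. (i) Let $f$ be a homogeneous polynomial of degree $d$ on $V$, and let $g'_{\mathrm{sym}}(f)$ denote the codimension in $V\times V$ of the Zariski closure of the set of $\mathbf{k}$-points of $Z^{\mathrm{sym}}_f$. Then $$\mathrm{rk}^S(f)\le 2^{d-3}\cdot g'_{\mathrm{sym}}(f).$$ (ii) Assume in addition that $\mathbf{k}$ is algebraically closed. Then for every collection $\overline f=(f_1,\dots,f_s)$ of homogeneous polynomials of degree $d$ on $V$, $$\mathrm{rk}^S(\overline f)\le 2^{d-3}\cdot (g_{\mathrm{sym}}(\overline f)+s-1).$$
   Context: Schmidt rank of a homogeneous polynomial $f$: $\mathrm{rk}^S(f)$ is the minimal $r\ge 0$ such that $f=\sum_{i=1}^r g_ih_i$ with $g_i,h_i$ homogeneous polynomials on $V$ (over $\mathbf{k}$) of positive degrees. For a collection $\overline f=(f_1,\dots,f_s)$, $s\ge 1$, of forms of the same degree, $\mathrm{rk}^S(\overline f)$ is the minimum of $\mathrm{rk}^S(c_1f_1+\dots+c_sf_s)$ over $(c_1,\dots,c_s)\in\mathbf{k}^s\setminus\{0\}$. $H_f(x)(\cdot,\cdot)$ denotes the Hessian form of $f$ at $x\in V$, the symmetric bilinear form on $V$ given by the second derivatives of $f$ at $x$ (i.e. $H_f(x)(u,v)$ is the component of $f(u+v+x)$ that is of degree $1$ in $u$, degree $1$ in $v$ and degree $d-2$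 in $x$). $$Z^{\mathrm{sym}}_f=\{(v,x)\in V\times V\mid v\in\ker H_f(x)\}$$ is a closed subvariety of $V\times V$. For a collection $\overline f=(f_1,\dots,f_s)$, $Z^{\mathrm{sym}}_{\overline f}\subset V\times V$ is the locus of $(v,x)$ such that the linear map $V\to\mathbf{k}^s$, $v'\mapsto (H_{f_i}(x)(v',v))_{1\le i\le s}$, has rank $<s$, and $g_{\mathrm{sym}}(\overline f)=\mathrm{codim}_{V\times V}Z^{\mathrm{sym}}_{\overline f}$. *)

theory Defs
  imports "HOL-Analysis.Cartesian_Space" "HOL-Library.Poly_Mapping" "HOL-Library.Extended_Nat"
    "HOL-Algebra.Ideal" "HOL-Computational_Algebra.Polynomial"
begin

section \<open>Multivariate polynomials\<close>

text \<open>
  A polynomial in variables of type \<open>'a\<close> is a finitely supported map from monomials to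
  coefficients, a monomial being a finitely supported map from variables to exponents.
  Multiplication is convolution.
\<close>

type_synonym ('a, 'k) mpoly = "('a \<Rightarrow>\<^sub>0 nat) \<Rightarrow>\<^sub>0 'k"

definition mdeg :: "('a \<Rightarrow>\<^sub>0 nat) \<Rightarrow> nat" where
  "mdeg m = (\<Sum>b\<in>Poly_Mapping.keys m. Poly_Mapping.lookup m b)"

definition polys :: "'a set \<Rightarrow> ('a, 'k::field) mpoly set" where
  "polys X = {p. \<forall>m\<in>Poly_Mapping.keys p. Poly_Mapping.keys m \<subseteq> X}"

text \<open>The zero polynomial is a form of every degree.\<close>

definition forms :: "'a set \<Rightarrow> nat \<Rightarrow> ('a, 'k::field) mpoly set" where
  "forms X d = {p \<in> polys X. \<forall>m\<in>Poly_Mapping.keys p. mdeg m = d}"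

definition poly_eval :: "('a \<Rightarrow> 'k) \<Rightarrow> ('a, 'k::field) mpoly \<Rightarrow> 'k" where
  "poly_eval \<phi> p =
     (\<Sum>m\<in>Poly_Mapping.keys p. Poly_Mapping.lookup p m *
        (\<Prod>b\<in>Poly_Mapping.keys m. \<phi> b ^ Poly_Mapping.lookup m b))"

text \<open>
  If \<open>b\<close> does not occur in \<open>m\<close>, the truncated subtraction leaves \<open>m\<close> unchanged, but then the
  coefficient of the summand is \<open>0\<close>.
\<close>

definition partial_deriv :: "'a \<Rightarrow> ('a, 'k::field) mpoly \<Rightarrow> ('a, 'k) mpoly" where
  "partial_deriv b p =
     (\<Sum>m\<in>Poly_Mapping.keys p.
        Poly_Mapping.single (m - Poly_Mapping.single b 1)
          (of_nat (Poly_Mapping.lookup m b) * Poly_Mapping.lookup p m))"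

definition const_poly :: "'k \<Rightarrow> ('a, 'k::field) mpoly" where
  "const_poly c = Poly_Mapping.single 0 c"

definition poly_ring :: "'a set \<Rightarrow> ('a, 'k::field) mpoly ring" where
  "poly_ring X = \<lparr>carrier = polys X, monoid.mult = (*), one = 1, zero = 0, add = (+)\<rparr>"

section \<open>Schmidt rank\<close>

definition schmidt_rank :: "'a set \<Rightarrow> ('a, 'k::field) mpoly \<Rightarrow> enat" where
  "schmidt_rank X f =
     Inf {enat r | r. \<exists>g h. f = (\<Sum>i<r. g i * h i) \<and>
            (\<forall>i<r. (\<exists>a>0. g i \<in> forms X a) \<and> (\<exists>b>0. h i \<in> forms X b))}"

text \<open>A collection of \<open>s\<close> forms is indexed by a finite type with \<open>s\<close> elements, so \<open>s \<ge> 1\<close>.\<close>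

definition schmidt_rank_collection ::
    "'a set \<Rightarrow> ('s::finite \<Rightarrow> ('a, 'k::field) mpoly) \<Rightarrow> enat" where
  "schmidt_rank_collection X fs =
     (INF c\<in>{c :: 'k ^ 's. c \<noteq> 0}. schmidt_rank X (\<Sum>i\<in>UNIV. const_poly (c $ i) * fs i))"

section \<open>Codimension in an affine space\<close>

text \<open>
  Affine space with coordinates \<open>X\<close> is the prime spectrum of \<open>poly_ring X\<close>; the irreducible closed
  subsets correspond to the primes, with inclusions reversed. The codimension of a closed set is
  the least codimension of an irreducible closed subset of it, which for the subset given by
  a prime \<open>P\<close> is the supremum of the lengths of chains of primes ending in \<open>P\<close>.

  The Zariski closure of a set of rational points is formed in the spectrum. Taking dimensions in
  the space of rational points itself would give a different notion over fields that are not
  algebraically closed.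
\<close>

definition prime_height :: "('a, 'm) ring_scheme \<Rightarrow> 'a set \<Rightarrow> enat" where
  "prime_height R P =
     Sup {enat r | r. \<exists>C :: nat \<Rightarrow> 'a set.
            (\<forall>i\<le>r. primeideal (C i) R) \<and> (\<forall>i<r. C i \<subset> C (Suc i)) \<and> C r = P}"

definition vanishing_ideal :: "'a set \<Rightarrow> ('a \<Rightarrow> 'k) set \<Rightarrow> ('a, 'k::field) mpoly set" where
  "vanishing_ideal X S = {p \<in> polys X. \<forall>\<phi>\<in>S. poly_eval \<phi> p = 0}"

definition zariski_closure :: "'a set \<Rightarrow> ('a \<Rightarrow> 'k) set \<Rightarrow> ('a, 'k::field) mpoly set set" where
  "zariski_closure X S = {P. primeideal P (poly_ring X) \<and> vanishing_ideal X S \<subseteq> P}"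

definition codim :: "'a set \<Rightarrow> ('a, 'k::field) mpoly set set \<Rightarrow> enat" where
  "codim X Z = (INF P\<in>Z. prime_height (poly_ring X) P)"

section \<open>The Hessian and the loci of its degeneracy\<close>

text \<open>
  The basis vectors of \<open>V\<close> serve as the variables of the polynomials on \<open>V\<close>: the variable \<open>b\<close>
  stands for the coordinate function dual to \<open>b\<close>. The variables for \<open>V \<times> V\<close> are \<open>Inl b\<close> and
  \<open>Inr b\<close>, for the coordinates of the first and of the second component.
\<close>

definition hessian ::
    "('k::field \<Rightarrow> 'v::ab_group_add \<Rightarrow> 'v) \<Rightarrow> 'v set \<Rightarrow> ('v, 'k) mpoly \<Rightarrow> 'v \<Rightarrow> 'v \<Rightarrow> 'v \<Rightarrow> 'k" where
  "hessian smul B f x u v =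
     (\<Sum>b\<in>B. \<Sum>c\<in>B.
        poly_eval (module.representation smul B x) (partial_deriv b (partial_deriv c f)) *
        module.representation smul B u b * module.representation smul B v c)"

text \<open>The set of rational points of \<open>Z\<^sup>s\<^sup>y\<^sup>m\<close>.\<close>

definition Z_sym ::
    "('k::field \<Rightarrow> 'v::ab_group_add \<Rightarrow> 'v) \<Rightarrow> 'v set \<Rightarrow> ('v, 'k) mpoly \<Rightarrow> ('v \<times> 'v) set" where
  "Z_sym smul B f = {(v, x). \<forall>u. hessian smul B f x v u = 0}"

definition Z_sym_collection ::
    "('k::field \<Rightarrow> 'v::ab_group_add \<Rightarrow> 'v) \<Rightarrow> 'v set \<Rightarrow> ('s::finite \<Rightarrow> ('v, 'k) mpoly) \<Rightarrow> ('v \<times> 'v) set" where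
  "Z_sym_collection smul B fs =
     {(v, x). vec.dim (range (\<lambda>v'. \<chi> i. hessian smul B (fs i) x v' v)) < CARD('s)}"

definition pair_coords ::
    "('k::field \<Rightarrow> 'v::ab_group_add \<Rightarrow> 'v) \<Rightarrow> 'v set \<Rightarrow> 'v \<times> 'v \<Rightarrow> 'v + 'v \<Rightarrow> 'k" where
  "pair_coords smul B p =
     case_sum (module.representation smul B (fst p)) (module.representation smul B (snd p))"

definition codim_closure ::
    "('k::field \<Rightarrow> 'v::ab_group_add \<Rightarrow> 'v) \<Rightarrow> 'v set \<Rightarrow> ('v \<times> 'v) set \<Rightarrow> enat" where
  "codim_closure smul B S =
     codim (B <+> B) (zariski_closure (B <+> B) (pair_coords smul B ` S))"

definition g'_sym ::
    "('k::field \<Rightarrow> 'v::ab_group_add \<Rightarrow> 'v) \<Rightarrow> 'v set \<Rightarrow> ('v, 'k) mpoly \<Rightarrow> enat" where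
  "g'_sym smul B f = codim_closure smul B (Z_sym smul B f)"

text \<open>
  This is the codimension of the variety \<open>Z\<^sup>s\<^sup>y\<^sup>m\<close> when the field is algebraically closed, since a
  closed subvariety is then the closure of its rational points.
\<close>

definition g_sym_collection ::
    "('k::field \<Rightarrow> 'v::ab_group_add \<Rightarrow> 'v) \<Rightarrow> 'v set \<Rightarrow> ('s::finite \<Rightarrow> ('v, 'k) mpoly) \<Rightarrow> enat" where
  "g_sym_collection smul B fs = codim_closure smul B (Z_sym_collection smul B fs)"

end

theory Submission
  imports Defs
begin

text \<open>
  Assume first that \<open>d = 3\<close>. Let \<open>x\<^sub>0\<close> be a general rational point of the projection \<open>Y\<close> of a component
  of \<open>Z\<^sup>s\<^sup>y\<^sup>m\<close> to the second factor, let \<open>T\<close> be the tangent space of \<open>Y\<close> at \<open>x\<^sub>0\<close> and \<open>K\<close> the kernel of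
  \<open>H\<^sub>f(x\<^sub>0)\<close>. The rank of \<open>H\<^sub>f(x)\<close> is constant for \<open>x\<close> in \<open>Y\<close> near \<open>x\<^sub>0\<close>, so the derivative of \<open>H\<^sub>f\<close> in a
  direction \<open>t\<close> in \<open>T\<close> vanishes on \<open>K \<times> K\<close>; that is, \<open>H\<^sub>f(t)(u, w) = 0\<close> for \<open>u\<close>, \<open>w\<close> in \<open>K\<close>. Hence \<open>f\<close>
  vanishes on \<open>T \<inter> K\<close>, and \<open>T\<close> and \<open>K\<close> together are given by as many linear equations as the
  codimension of the component.

  For general \<open>d\<close> the derivative is replaced by arcs of higher order. In the ring of polynomials in
  the coordinates \<open>x\<close>, modulo high order, there are vectors \<open>y = x\<^sub>0 + x + \<dots>\<close> on \<open>Y\<close> and \<open>u = x + \<dots>\<close> in the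
  kernel of \<open>H\<^sub>f(y)\<close>, whose coordinates differ from those of \<open>x\<^sub>0 + x\<close> and of \<open>x\<close> only in as many places
  as the codimension. Let \<open>\<GG>\<close> be the ideal generated by the homogeneous components of degrees
  \<open>1, \<dots>, d - 2\<close> of these differences. If \<open>w\<close> is the linear part of \<open>u\<close>, which lies in the kernel of
  \<open>H\<^sub>f(x\<^sub>0)\<close>, then the component of degree \<open>d\<close> of \<open>H\<^sub>f(y)(u, w) = 0\<close> is congruent to
  \<open>H\<^sub>f(x)(x, x) = d (d - 1) f\<close> modulo \<open>\<GG>\<close>. So \<open>f\<close> lies in an ideal generated by \<open>d - 2\<close> times the
  codimension many forms of degrees between \<open>1\<close> and \<open>d - 2\<close>, and its rank is at most this number,
  where \<open>d - 2 \<le> 2\<^bsup>d-3\<^esup>\<close>. For a collection, a point is degenerate because of some coefficient vector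
  \<open>c\<close>, which can be scaled to have an entry \<open>1\<close>; the other \<open>s - 1\<close> entries are treated as further
  coordinates of the arc, and each of them is one more place where the arc may differ.

  The codimension enters through \<open>ex_independent_height\<close>: a prime of height \<open>h\<close> leaves at least
  \<open>dim - h\<close> variables algebraically independent. By Steinitz exchange (\<open>card_independent_le\<close>) the
  number of coordinates that the arc determines is then at most \<open>h\<close>, or \<open>h + s - 1\<close>, although the arc
  uses its own ordering of the variables. Arcs exist at a smooth point only. Over a field that is not
  perfect, smoothness comes from the density of rational points: \<open>ex_dense_prime\<close> replaces the given
  prime by one in which the rational points are dense, and \<open>ex_separable_relation\<close> finds separable
  relations there, as in MacLane's criterion. The arcs are constructed in \<open>ex_arc\<close> and
  \<open>ex_linear_arc\<close>, and the congruence is carried out in \<open>schmidt_rank_le_generic\<close>.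
\<close>

section \<open>Ring homomorphisms out of polynomial rings\<close>

locale ring_map =
  fixes h :: "'r::comm_ring_1 \<Rightarrow> 's::comm_ring_1"
  assumes map_one: "h 1 = 1"
    and map_add: "h (x + y) = h x + h y"
    and map_mult: "h (x * y) = h x * h y"
begin

lemma map_zero: "h 0 = 0"
  using map_add[of 0 0] by simp

lemma map_uminus: "h (- x) = - h x"
  using map_add[of x "- x"] map_zero by (simp add: eq_neg_iff_add_eq_0 add.commute)

lemma map_diff: "h (x - y) = h x - h y"
  using map_add[of x "- y"] map_uminus by simp

lemma map_sum: "h (sum f A) = (\<Sum>i\<in>A. h (f i))"
  by (induction A rule: infinite_finite_induct) (auto simp: map_zero map_add)

lemma map_prod: "h (prod f A) = (\<Prod>i\<in>A. h (f i))"
  by (induction A rule: infinite_finite_induct) (auto simp: map_one map_mult)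

lemma map_power: "h (x ^ n) = h x ^ n"
  by (induction n) (auto simp: map_one map_mult)

end

definition monom_eval :: "('a \<Rightarrow> 'r::comm_ring_1) \<Rightarrow> ('a \<Rightarrow>\<^sub>0 nat) \<Rightarrow> 'r" where
  "monom_eval \<sigma> m = (\<Prod>b\<in>Poly_Mapping.keys m. \<sigma> b ^ Poly_Mapping.lookup m b)"

definition eval_hom :: "('k::field \<Rightarrow> 'r::comm_ring_1) \<Rightarrow> ('a \<Rightarrow> 'r) \<Rightarrow> ('a, 'k) mpoly \<Rightarrow> 'r" where
  "eval_hom h \<sigma> p =
     (\<Sum>m\<in>Poly_Mapping.keys p. h (Poly_Mapping.lookup p m) * monom_eval \<sigma> m)"

definition Var :: "'a \<Rightarrow> ('a, 'k::field) mpoly" where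
  "Var b = Poly_Mapping.single (Poly_Mapping.single b 1) 1"

lemma poly_eval_eq_eval_hom: "poly_eval \<phi> = eval_hom (\<lambda>c. c) \<phi>"
  by (simp add: fun_eq_iff poly_eval_def eval_hom_def monom_eval_def)

lemma monom_eval_superset:
  assumes "finite A" "Poly_Mapping.keys m \<subseteq> A"
  shows "monom_eval \<sigma> m = (\<Prod>b\<in>A. \<sigma> b ^ Poly_Mapping.lookup m b)"
  unfolding monom_eval_def
  by (rule prod.mono_neutral_left) (use assms in \<open>auto simp: in_keys_iff\<close>)

lemma monom_eval_0 [simp]: "monom_eval \<sigma> 0 = 1"
  by (simp add: monom_eval_def)

lemma monom_eval_add: "monom_eval \<sigma> (m + n) = monom_eval \<sigma> m * monom_eval \<sigma> n"
proof -
  let ?A = "Poly_Mapping.keys m \<union> Poly_Mapping.keys n"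
  have "Poly_Mapping.keys (m + n) \<subseteq> ?A"
    by (rule Poly_Mapping.keys_add)
  then show ?thesis
    by (simp add: monom_eval_superset[of ?A] lookup_add power_add prod.distrib)
qed

lemma monom_eval_single: "monom_eval \<sigma> (Poly_Mapping.single b n) = \<sigma> b ^ n"
  by (cases "n = 0") (simp_all add: monom_eval_def)

lemma poly_mapping_sum_single:
  "p = (\<Sum>m\<in>Poly_Mapping.keys p. Poly_Mapping.single m (Poly_Mapping.lookup p m))"
proof (rule poly_mapping_eqI)
  fix n
  have "Poly_Mapping.lookup (\<Sum>m\<in>Poly_Mapping.keys p. Poly_Mapping.single m (Poly_Mapping.lookup p m)) n
     = (\<Sum>m\<in>Poly_Mapping.keys p. if m = n then Poly_Mapping.lookup p m else 0)"
    by (auto simp: lookup_sum lookup_single when_def intro!: sum.cong)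
  also have "\<dots> = Poly_Mapping.lookup p n"
    by (simp add: sum.delta in_keys_iff)
  finally show "Poly_Mapping.lookup p n = Poly_Mapping.lookup
      (\<Sum>m\<in>Poly_Mapping.keys p. Poly_Mapping.single m (Poly_Mapping.lookup p m)) n"
    by simp
qed

lemma mpoly_induct [case_names monomial add]:
  assumes "\<And>m c. P (Poly_Mapping.single m c)"
    and "\<And>p q. P p \<Longrightarrow> P q \<Longrightarrow> P (p + q)"
  shows "P (p :: ('a, 'k::field) mpoly)"
proof -
  have *: "P (\<Sum>m\<in>A. Poly_Mapping.single m (c m))" if "finite A" for A c
    using that
  proof (induction A)
    case empty
    show ?case
      using assms(1)[of 0 0] by simp
  next
    case (insert x F)
    then show ?case
      using assms by simp
  qed
  show ?thesis
    by (subst poly_mapping_sum_single) (rule *, simp)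
qed

lemma ring_map_id: "ring_map (\<lambda>c. c)"
  by unfold_locales auto

lemma ring_map_comp: "ring_map g \<Longrightarrow> ring_map h \<Longrightarrow> ring_map (\<lambda>x. g (h x))"
  by (simp add: ring_map_def)

lemma ring_map_const: "ring_map (const_poly :: 'k::field \<Rightarrow> ('a, 'k) mpoly)"
  by unfold_locales (auto simp: const_poly_def single_add mult_single)

lemma eval_hom_single:
  assumes "ring_map h"
  shows "eval_hom h \<sigma> (Poly_Mapping.single m c) = h c * monom_eval \<sigma> m"
  using ring_map.map_zero[OF assms] by (cases "c = 0") (auto simp: eval_hom_def)

lemma eval_hom_add:
  assumes "ring_map h"
  shows "eval_hom h \<sigma> (p + q) = eval_hom h \<sigma> p + eval_hom h \<sigma> q"
  unfolding eval_hom_def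
  by (rule setsum_keys_plus_distrib)
     (simp_all add: ring_map.map_zero[OF assms] ring_map.map_add[OF assms] algebra_simps)

lemma ring_map_eval_hom:
  assumes "ring_map h"
  shows "ring_map (eval_hom h \<sigma>)"
proof
  interpret h: ring_map h by fact
  show "eval_hom h \<sigma> 1 = 1"
    using eval_hom_single[OF assms, of \<sigma> 0 1] by (simp add: h.map_one)
  show add: "eval_hom h \<sigma> (x + y) = eval_hom h \<sigma> x + eval_hom h \<sigma> y" for x y
    by (rule eval_hom_add[OF assms])
  have 1: "eval_hom h \<sigma> (Poly_Mapping.single m c * y)
      = eval_hom h \<sigma> (Poly_Mapping.single m c) * eval_hom h \<sigma> y" for m c y
    by (induction y rule: mpoly_induct)
       (simp_all add: mult_single eval_hom_single[OF assms] h.map_mult monom_eval_add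
          add distrib_left distrib_right mult_ac)
  show "eval_hom h \<sigma> (x * y) = eval_hom h \<sigma> x * eval_hom h \<sigma> y" for x y
    by (induction x rule: mpoly_induct) (simp_all add: 1 add distrib_right)
qed

lemma const_poly_single: "Poly_Mapping.single m c = const_poly c * Poly_Mapping.single m 1"
  by (simp add: const_poly_def mult_single)

lemma monomial_eq_monom_eval: "(Poly_Mapping.single m 1 :: ('a, 'k::field) mpoly) = monom_eval Var m"
proof -
  have *: "Poly_Mapping.single (Poly_Mapping.single b n) 1 = (Var b :: ('a, 'k) mpoly) ^ n"
    for b :: 'a and n
  proof (induction n)
    case (Suc n)
    have "Poly_Mapping.single b (Suc n) = Poly_Mapping.single b 1 + Poly_Mapping.single b n"
      by (simp flip: single_add)
    then have "(Poly_Mapping.single (Poly_Mapping.single b (Suc n)) 1 :: ('a, 'k) mpoly)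
        = Var b * Poly_Mapping.single (Poly_Mapping.single b n) 1"
      by (simp add: Var_def mult_single)
    then show ?case
      by (simp add: Suc)
  qed simp
  have fin: "(Poly_Mapping.single (\<Sum>b\<in>A. Poly_Mapping.single b (f b)) 1 :: ('a, 'k) mpoly)
      = (\<Prod>b\<in>A. Var b ^ f b)" if "finite A" for A :: "'a set" and f
    using that
  proof (induction A)
    case (insert x F)
    then show ?case
      using mult_single[of "Poly_Mapping.single x (f x)" 1 "\<Sum>b\<in>F. Poly_Mapping.single b (f b)" "1 :: 'k"]
      by (simp add: *[symmetric])
  qed simp
  have "m = (\<Sum>b\<in>Poly_Mapping.keys m. Poly_Mapping.single b (Poly_Mapping.lookup m b))"
    by (rule poly_mapping_sum_single)
  then show ?thesis
    using fin[of "Poly_Mapping.keys m" "Poly_Mapping.lookup m"] by (simp add: monom_eval_def)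
qed

text \<open>
  Polynomial rings are free: a homomorphism is determined by its values on constants and variables.
  All comparisons between evaluations, substitutions and expansions below come from this.
\<close>

lemma ring_map_eq_eval_hom:
  assumes "ring_map (E :: ('a, 'k::field) mpoly \<Rightarrow> 'r::comm_ring_1)"
  shows "E p = eval_hom (\<lambda>c. E (const_poly c)) (\<lambda>b. E (Var b)) p"
proof -
  interpret E: ring_map E by fact
  have h: "ring_map (\<lambda>c. E (const_poly c))"
    by (rule ring_map_comp[OF assms ring_map_const])
  have m: "E (monom_eval Var m) = monom_eval (\<lambda>b. E (Var b)) m" for m
    by (simp add: monom_eval_def E.map_prod E.map_power)
  show ?thesis
  proof (induction p rule: mpoly_induct)
    case (monomial n c)
    have "E (Poly_Mapping.single n c) = E (const_poly c) * E (monom_eval Var n)"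
      by (simp add: const_poly_single[of n c] E.map_mult monomial_eq_monom_eval)
    then show ?case
      by (simp add: eval_hom_single[OF h] m)
  qed (simp add: E.map_add eval_hom_add[OF h])
qed

lemma eval_hom_const: "ring_map h \<Longrightarrow> eval_hom h \<sigma> (const_poly c) = h c"
  by (simp add: const_poly_def eval_hom_single)

lemma eval_hom_Var: "ring_map h \<Longrightarrow> eval_hom h \<sigma> (Var b) = \<sigma> b"
  by (simp add: Var_def eval_hom_single monom_eval_single ring_map.map_one)

lemma ring_map_eqI:
  assumes "ring_map (E :: ('a, 'k::field) mpoly \<Rightarrow> 'r::comm_ring_1)" "ring_map F"
    and "\<And>c. E (const_poly c) = F (const_poly c)" "\<And>b. E (Var b) = F (Var b)"
  shows "E p = F p"
  by (subst (1 2) ring_map_eq_eval_hom) (use assms in auto)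

lemma eval_hom_cong:
  assumes "p \<in> polys X" "\<And>b. b \<in> X \<Longrightarrow> \<sigma> b = \<tau> b"
  shows "eval_hom h \<sigma> p = eval_hom h \<tau> p"
  unfolding eval_hom_def monom_eval_def
  by (intro sum.cong prod.cong arg_cong2[where f = "(*)"] arg_cong2[where f = "(^)"] refl assms(2))
     (use assms(1) in \<open>auto simp: polys_def\<close>)

section \<open>Subrings and expansions in one variable\<close>

lemma polys_mono: "X \<subseteq> Y \<Longrightarrow> polys X \<subseteq> polys Y"
  by (auto simp: polys_def)

lemma polys_UNIV [simp]: "polys UNIV = UNIV"
  by (auto simp: polys_def)

lemma polys_0 [simp]: "0 \<in> polys X"
  by (simp add: polys_def)

lemma polys_const [simp]: "const_poly c \<in> polys X"
  by (auto simp: polys_def const_poly_def)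

lemma const_poly_1 [simp]: "const_poly 1 = 1"
  by (simp add: const_poly_def)

lemma const_poly_0 [simp]: "const_poly 0 = 0"
  by (simp add: const_poly_def)

lemma polys_1 [simp]: "1 \<in> polys X"
  using polys_const[of 1] by simp

lemma polys_Var [simp]: "b \<in> X \<Longrightarrow> Var b \<in> polys X"
  by (auto simp: polys_def Var_def)

lemma polys_add [simp]: "p \<in> polys X \<Longrightarrow> q \<in> polys X \<Longrightarrow> p + q \<in> polys X"
  using Poly_Mapping.keys_add[of p q] by (fastforce simp: polys_def)

lemma polys_uminus [simp]: "p \<in> polys X \<Longrightarrow> - p \<in> polys X"
  by (auto simp: polys_def in_keys_iff)

lemma polys_diff [simp]: "p \<in> polys X \<Longrightarrow> q \<in> polys X \<Longrightarrow> p - q \<in> polys X"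
  using polys_add[of p X "- q"] by simp

lemma polys_mult [simp]:
  assumes "p \<in> polys X" "q \<in> polys X"
  shows "p * q \<in> polys X"
proof -
  have "Poly_Mapping.keys m \<subseteq> X" if m: "m \<in> Poly_Mapping.keys (p * q)" for m
  proof -
    obtain a b where "m = a + b" "a \<in> Poly_Mapping.keys p" "b \<in> Poly_Mapping.keys q"
      using m keys_mult[of p q] by blast
    then show ?thesis
      using assms Poly_Mapping.keys_add[of a b] by (fastforce simp: polys_def)
  qed
  then show ?thesis
    by (auto simp: polys_def)
qed

lemma polys_sum [simp]: "(\<And>i. i \<in> A \<Longrightarrow> f i \<in> polys X) \<Longrightarrow> sum f A \<in> polys X"
  by (induction A rule: infinite_finite_induct) auto

lemma polys_power [simp]: "p \<in> polys X \<Longrightarrow> p ^ n \<in> polys X"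
  by (induction n) auto

lemma polys_prod: "(\<And>i. i \<in> A \<Longrightarrow> f i \<in> polys X) \<Longrightarrow> prod f A \<in> polys X"
  by (induction A rule: infinite_finite_induct) auto

lemma mpoly_eq_sum: "p = (\<Sum>m\<in>Poly_Mapping.keys p. const_poly (Poly_Mapping.lookup p m) * monom_eval Var m)"
  by (subst poly_mapping_sum_single)
     (intro sum.cong refl, metis const_poly_single monomial_eq_monom_eval)

text \<open>
  This reduces statements about polynomials in \<open>X\<close> that are compatible with sums and products to
  constants and variables, without any reference to monomials.
\<close>

lemma polys_induct [consumes 1, case_names const var add mult]:
  assumes "p \<in> polys X"
    and const: "\<And>c. P (const_poly c)" and var: "\<And>b. b \<in> X \<Longrightarrow> P (Var b)"
    and add: "\<And>p q. p \<in> polys X \<Longrightarrow> q \<in> polys X \<Longrightarrow> P p \<Longrightarrow> P q \<Longrightarrow> P (p + q)"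
    and mult: "\<And>p q. p \<in> polys X \<Longrightarrow> q \<in> polys X \<Longrightarrow> P p \<Longrightarrow> P q \<Longrightarrow> P (p * q)"
  shows "P p"
proof -
  define Q where "Q p \<longleftrightarrow> p \<in> polys X \<and> P p" for p
  have Q: "Q (const_poly c)" "b \<in> X \<Longrightarrow> Q (Var b)" "Q p \<Longrightarrow> Q q \<Longrightarrow> Q (p + q)"
    "Q p \<Longrightarrow> Q q \<Longrightarrow> Q (p * q)" for c b p q
    using const var add mult by (auto simp: Q_def)
  have Q01: "Q 0" "Q 1"
    using Q(1)[of 0] Q(1)[of 1] by simp_all
  have pow: "Q (r ^ n)" if "Q r" for r n
    using that by (induction n) (auto intro: Q Q01)
  have prod: "Q (prod f A)" if "\<And>i. i \<in> A \<Longrightarrow> Q (f i)" for A and f :: "'a \<Rightarrow> _"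
    using that by (induction A rule: infinite_finite_induct) (auto intro: Q Q01)
  have sum: "Q (sum f A)" if "\<And>i. i \<in> A \<Longrightarrow> Q (f i)" for A and f :: "('a \<Rightarrow>\<^sub>0 nat) \<Rightarrow> _"
    using that by (induction A rule: infinite_finite_induct) (auto intro: Q Q01)
  have "Q (\<Sum>m\<in>Poly_Mapping.keys p. const_poly (Poly_Mapping.lookup p m) * monom_eval Var m)"
    unfolding monom_eval_def
    by (intro sum Q(4) Q(1) prod pow Q(2)) (use assms(1) in \<open>auto simp: polys_def\<close>)
  then show ?thesis
    by (simp add: Q_def flip: mpoly_eq_sum)
qed

text \<open>
  The isomorphism with the ring of univariate polynomials in \<open>z\<close> over the other variables. The target
  type allows \<open>z\<close> in the coefficients as well; it does not occur there.
\<close>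

definition expand :: "'a \<Rightarrow> ('a, 'k::field) mpoly \<Rightarrow> ('a, 'k) mpoly poly" where
  "expand z = eval_hom (\<lambda>c. [:const_poly c:]) (\<lambda>b. if b = z then [:0, 1:] else [:Var b:])"

lemma ring_map_pCons_const: "ring_map (\<lambda>c :: 'k::field. [:const_poly c :: ('a, 'k) mpoly:])"
proof -
  interpret c: ring_map "const_poly :: 'k \<Rightarrow> ('a, 'k) mpoly"
    by (rule ring_map_const)
  show ?thesis
    by unfold_locales (auto simp: c.map_add c.map_mult one_pCons)
qed

lemma ring_map_expand: "ring_map (expand z)"
  unfolding expand_def by (rule ring_map_eval_hom[OF ring_map_pCons_const])

lemma expand_const: "expand z (const_poly c) = [:const_poly c:]"
  unfolding expand_def by (simp add: eval_hom_const[OF ring_map_pCons_const])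

lemma expand_Var: "expand z (Var b) = (if b = z then [:0, 1:] else [:Var b:])"
  unfolding expand_def by (simp add: eval_hom_Var[OF ring_map_pCons_const])

lemma expand_free:
  assumes "p \<in> polys W" "z \<notin> W"
  shows "expand z p = [:p:]"
proof -
  interpret e: ring_map "expand z" by (rule ring_map_expand)
  show ?thesis
    using assms(1)
    by (induction rule: polys_induct)
       (use assms(2) in \<open>auto simp: expand_const expand_Var e.map_add e.map_mult\<close>)
qed

lemma poly_expand: "poly (expand z p) (Var z) = p"
proof -
  interpret e: ring_map "expand z" by (rule ring_map_expand)
  have "ring_map (\<lambda>p. poly (expand z p) (Var z))"
    by unfold_locales (auto simp: e.map_one e.map_add e.map_mult)
  then show ?thesis
    by (rule ring_map_eqI[OF _ ring_map_id]) (auto simp: expand_const expand_Var)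
qed

lemma sum_coeffs_expand: "(\<Sum>i\<le>degree (expand z p). coeff (expand z p) i * Var z ^ i) = p"
  using poly_expand[of z p] by (simp add: poly_altdef)

lemma coeff_expand_polys:
  assumes "p \<in> polys X"
  shows "coeff (expand z p) i \<in> polys (X - {z})"
  using assms
proof (induction arbitrary: i rule: polys_induct)
  interpret e: ring_map "expand z" by (rule ring_map_expand)
  case (const c)
  show ?case by (simp add: expand_const coeff_pCons split: nat.split)
next
  case (var b)
  then show ?case by (auto simp: expand_Var coeff_pCons split: nat.split)
next
  interpret e: ring_map "expand z" by (rule ring_map_expand)
  case (add p q)
  then show ?case by (simp add: e.map_add)
next
  interpret e: ring_map "expand z" by (rule ring_map_expand)
  case (mult p q)
  then show ?case by (simp add: e.map_mult coeff_mult)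
qed

text \<open>
  Membership of the leading coefficient in a prime ideal replaces its vanishing: \<open>pdeg P q n\<close> says
  that \<open>n\<close> is the degree of the reduction of \<open>q\<close> modulo \<open>P\<close>, and that the reduction is not \<open>0\<close>.
\<close>

definition pdeg :: "'r::comm_ring_1 set \<Rightarrow> 'r poly \<Rightarrow> nat \<Rightarrow> bool" where
  "pdeg P q n \<longleftrightarrow> coeff q n \<notin> P \<and> (\<forall>i>n. coeff q i \<in> P)"

locale prime_polys =
  fixes X :: "'a set" and P :: "('a, 'k::field) mpoly set"
  assumes subset: "P \<subseteq> polys X"
    and zero_mem: "0 \<in> P"
    and add_mem: "p \<in> P \<Longrightarrow> q \<in> P \<Longrightarrow> p + q \<in> P"
    and mult_mem: "r \<in> polys X \<Longrightarrow> p \<in> P \<Longrightarrow> r * p \<in> P"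
    and one_notin: "1 \<notin> P"
    and prime: "p \<in> polys X \<Longrightarrow> q \<in> polys X \<Longrightarrow> p * q \<in> P \<Longrightarrow> p \<in> P \<or> q \<in> P"
begin

lemma uminus_mem: "p \<in> P \<Longrightarrow> - p \<in> P"
  using mult_mem[of "- 1" p] by simp

lemma diff_mem: "p \<in> P \<Longrightarrow> q \<in> P \<Longrightarrow> p - q \<in> P"
  using add_mem[of p "- q"] uminus_mem by simp

lemma sum_mem: "(\<And>i. i \<in> A \<Longrightarrow> f i \<in> P) \<Longrightarrow> sum f A \<in> P"
  by (induction A rule: infinite_finite_induct) (auto simp: zero_mem add_mem)

lemma mult_mem': "p \<in> P \<Longrightarrow> r \<in> polys X \<Longrightarrow> p * r \<in> P"
  using mult_mem[of r p] by (simp add: mult.commute)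

lemma diff_memD: "p - q \<in> P \<Longrightarrow> q \<in> P \<Longrightarrow> p \<in> P"
  using add_mem[of "p - q" q] by simp

lemma const_notin: "c \<noteq> 0 \<Longrightarrow> const_poly c \<notin> P"
proof
  assume "c \<noteq> 0" "const_poly c \<in> P"
  then have "const_poly (inverse c) * const_poly c \<in> P"
    using mult_mem by simp
  then show False
    using \<open>c \<noteq> 0\<close> one_notin by (simp add: const_poly_def mult_single)
qed

lemma pdeg_ex: "coeff q i \<notin> P \<Longrightarrow> \<exists>n\<ge>i. pdeg P q n"
proof -
  assume i: "coeff q i \<notin> P"
  let ?S = "{n. coeff q n \<notin> P}"
  have sub: "?S \<subseteq> {..degree q}"
    using zero_mem coeff_eq_0[of q] by (metis (mono_tags) atMost_iff linorder_not_less mem_Collect_eq subsetI)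
  have fin: "finite ?S"
    using sub finite_subset by blast
  have "pdeg P q (Max ?S)"
    unfolding pdeg_def using fin i Max_in[of ?S] Max_ge[of ?S]
    by (metis (mono_tags, lifting) empty_iff linorder_not_less mem_Collect_eq)
  moreover have "i \<le> Max ?S"
    using fin i by simp
  ultimately show ?thesis
    by blast
qed

lemma pdeg_unique: "pdeg P q n \<Longrightarrow> pdeg P q m \<Longrightarrow> n = m"
  by (metis pdeg_def linorder_neqE_nat)

text \<open>
  All terms of the coefficient of index \<open>m + n\<close> except for the product of the leading ones lie in \<open>P\<close>.
\<close>

lemma pdeg_mult:
  assumes "\<And>i. coeff a i \<in> polys X" "\<And>i. coeff b i \<in> polys X"
    and a: "pdeg P a m" and b: "pdeg P b n"
  shows "pdeg P (a * b) (m + n)"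
proof -
  have *: "coeff a i * coeff b (k - i) \<in> P" if "i \<le> k" "i > m \<or> k - i > n" for i k
    using that a b assms(1,2) mult_mem mult_mem' unfolding pdeg_def by blast
  have "(\<Sum>i\<le>m+n. coeff a i * coeff b (m + n - i))
      = coeff a m * coeff b n + (\<Sum>i\<in>{..m+n}-{m}. coeff a i * coeff b (m + n - i))"
    by (subst sum.remove[of _ m]) auto
  moreover have "(\<Sum>i\<in>{..m+n}-{m}. coeff a i * coeff b (m + n - i)) \<in> P"
    by (rule sum_mem, rule *) auto
  moreover have "coeff a m * coeff b n \<notin> P"
    using a b prime assms(1,2) by (auto simp: pdeg_def)
  ultimately have 1: "coeff (a * b) (m + n) \<notin> P"
    unfolding coeff_mult using diff_mem[of "coeff a m * coeff b n +
      (\<Sum>i\<in>{..m+n}-{m}. coeff a i * coeff b (m + n - i))"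
      "\<Sum>i\<in>{..m+n}-{m}. coeff a i * coeff b (m + n - i)"] by auto
  have 2: "coeff (a * b) k \<in> P" if "k > m + n" for k
    unfolding coeff_mult by (rule sum_mem, rule *) (use that in auto)
  show ?thesis
    using 1 2 by (auto simp: pdeg_def)
qed

lemma pdeg_cong:
  assumes "\<And>i. coeff (a - b) i \<in> P"
  shows "pdeg P a n \<longleftrightarrow> pdeg P b n"
proof -
  have "coeff a i \<in> P \<longleftrightarrow> coeff b i \<in> P" for i
    using assms[of i] diff_memD[of "coeff a i" "coeff b i"] diff_mem[of "coeff a i" "coeff a i - coeff b i"]
    by auto
  then show ?thesis
    by (auto simp: pdeg_def)
qed

lemma coeff_expand_X: "p \<in> polys X \<Longrightarrow> coeff (expand z p) i \<in> polys X"
  using coeff_expand_polys[of p X z i] polys_mono[of "X - {z}" X] by blast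

text \<open>
  For \<open>z \<in> X\<close> this is the ideal generated by the elements of \<open>P\<close> that do not involve \<open>z\<close>. It consists
  of the relations modulo \<open>P\<close> that say nothing about \<open>z\<close>.
\<close>

definition extended :: "'a \<Rightarrow> ('a, 'k) mpoly set" where
  "extended z = {p \<in> polys X. \<forall>i. coeff (expand z p) i \<in> P}"

lemma coeffs_mem_imp_mem:
  assumes "z \<in> X" "p \<in> polys X" "\<And>i. coeff (expand z p) i \<in> P"
  shows "p \<in> P"
proof -
  have "p = (\<Sum>i\<le>degree (expand z p). coeff (expand z p) i * Var z ^ i)"
    by (simp only: sum_coeffs_expand)
  also have "\<dots> \<in> P"
    by (rule sum_mem, rule mult_mem') (use assms in auto)
  finally show ?thesis .
qed

lemma extended_subset: "z \<in> X \<Longrightarrow> extended z \<subseteq> P"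
  using coeffs_mem_imp_mem by (auto simp: extended_def)

lemma free_mem_extended: "p \<in> P \<Longrightarrow> p \<in> polys W \<Longrightarrow> z \<notin> W \<Longrightarrow> p \<in> extended z"
  using subset by (auto simp: extended_def expand_free zero_mem coeff_pCons split: nat.split)

text \<open>
  The quotient by this ideal is a polynomial ring in \<open>z\<close> over a domain; degrees modulo \<open>P\<close> add up in
  products.
\<close>

lemma prime_extended: "prime_polys X (extended z)"
proof
  interpret e: ring_map "expand z" by (rule ring_map_expand)
  show "extended z \<subseteq> polys X" "0 \<in> extended z"
    by (auto simp: extended_def e.map_zero zero_mem)
  show "p + q \<in> extended z" if "p \<in> extended z" "q \<in> extended z" for p q
    using that by (auto simp: extended_def e.map_add add_mem)
  show "r * p \<in> extended z" if "r \<in> polys X" "p \<in> extended z" for r p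
    using that by (auto simp: extended_def e.map_mult coeff_mult
        intro!: sum_mem mult_mem coeff_expand_X)
  show "1 \<notin> extended z"
    using one_notin by (auto simp: extended_def e.map_one intro: exI[of _ 0])
  show "p \<in> extended z \<or> q \<in> extended z"
    if p: "p \<in> polys X" and q: "q \<in> polys X" and pq: "p * q \<in> extended z" for p q
  proof (rule ccontr)
    assume "\<not> ?thesis"
    then obtain i j where "coeff (expand z p) i \<notin> P" "coeff (expand z q) j \<notin> P"
      using p q by (auto simp: extended_def)
    then obtain m n where "pdeg P (expand z p) m" "pdeg P (expand z q) n"
      using pdeg_ex by blast
    then have "pdeg P (expand z (p * q)) (m + n)"
      unfolding e.map_mult by (intro pdeg_mult coeff_expand_X p q)
    then show False
      using pq by (auto simp: extended_def pdeg_def)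
  qed
qed

end

section \<open>Chains of prime ideals\<close>

lemma cring_poly_ring: "cring (poly_ring X :: ('a, 'k::field) mpoly ring)"
proof (rule cringI)
  show "abelian_group (poly_ring X :: ('a, 'k) mpoly ring)"
  proof (rule abelian_groupI)
    fix x :: "('a, 'k) mpoly"
    assume "x \<in> carrier (poly_ring X)"
    then have "- x \<in> carrier (poly_ring X)"
      by (simp add: poly_ring_def)
    then show "\<exists>y\<in>carrier (poly_ring X). y \<oplus>\<^bsub>poly_ring X\<^esub> x = \<zero>\<^bsub>poly_ring X\<^esub>"
      by (intro bexI[of _ "- x"]) (auto simp: poly_ring_def)
  qed (auto simp: poly_ring_def algebra_simps)
  show "Group.comm_monoid (poly_ring X :: ('a, 'k) mpoly ring)"
    by (rule comm_monoidI) (auto simp: poly_ring_def algebra_simps)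
qed (auto simp: poly_ring_def algebra_simps)

lemma primeideal_imp_prime_polys:
  assumes "primeideal P (poly_ring X)"
  shows "prime_polys X P"
proof -
  interpret P: primeideal P "poly_ring X" by fact
  have *: "carrier (poly_ring X) = polys X" "\<zero>\<^bsub>poly_ring X\<^esub> = 0" "\<one>\<^bsub>poly_ring X\<^esub> = 1"
    "a \<oplus>\<^bsub>poly_ring X\<^esub> b = a + b" "a \<otimes>\<^bsub>poly_ring X\<^esub> b = a * b" for a b
    by (auto simp: poly_ring_def)
  show ?thesis
  proof
    show "P \<subseteq> polys X"
      using P.a_subset by (simp add: *)
    show "0 \<in> P"
      using P.additive_subgroup_axioms additive_subgroup.zero_closed by (fastforce simp flip: *)
    show "p + q \<in> P" if "p \<in> P" "q \<in> P" for p q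
      using P.additive_subgroup_axioms additive_subgroup.a_closed that by (fastforce simp flip: *)
    show "r * p \<in> P" if "r \<in> polys X" "p \<in> P" for r p
      using P.I_l_closed[of p r] that by (simp add: *)
    show "1 \<notin> P"
      using P.one_imp_carrier P.I_notcarr by (auto simp: *)
    show "p \<in> P \<or> q \<in> P" if "p \<in> polys X" "q \<in> polys X" "p * q \<in> P" for p q
      using P.I_prime[of p q] that by (simp add: *)
  qed
qed

lemma prime_polys_imp_primeideal:
  assumes "prime_polys X P"
  shows "primeideal P (poly_ring X)"
proof -
  interpret P: prime_polys X P by fact
  interpret R: cring "poly_ring X" by (rule cring_poly_ring)
  have *: "carrier (poly_ring X) = polys X" "\<zero>\<^bsub>poly_ring X\<^esub> = 0" "\<one>\<^bsub>poly_ring X\<^esub> = 1"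
    "a \<oplus>\<^bsub>poly_ring X\<^esub> b = a + b" "a \<otimes>\<^bsub>poly_ring X\<^esub> b = a * b" for a b
    by (auto simp: poly_ring_def)
  have "ideal P (poly_ring X)"
  proof (rule idealI)
    show "ring (poly_ring X)"
      by (rule R.ring_axioms)
    show "subgroup P (add_monoid (poly_ring X))"
    proof (rule R.add.subgroupI)
      show "P \<subseteq> carrier (poly_ring X)"
        using P.subset by (simp add: *)
      show "P \<noteq> {}"
        using P.zero_mem by auto
      fix a b assume a: "a \<in> P" and "b \<in> P"
      then show "a \<oplus>\<^bsub>poly_ring X\<^esub> b \<in> P"
        by (simp add: * P.add_mem)
      have "\<ominus>\<^bsub>poly_ring X\<^esub> a = - a"
        using a P.subset by (intro R.minus_equality) (auto simp: *)
      then show "\<ominus>\<^bsub>poly_ring X\<^esub> a \<in> P"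
        using a P.uminus_mem by simp
    qed
  qed (auto simp: * P.mult_mem P.mult_mem')
  then show ?thesis
  proof (rule primeidealI)
    show "carrier (poly_ring X) \<noteq> P"
      using P.one_notin polys_1 unfolding * by blast
  qed (use P.prime in \<open>auto simp: * R.is_cring\<close>)
qed

lemma polys_empty:
  assumes "p \<in> polys {}"
  shows "p = const_poly (Poly_Mapping.lookup p 0)"
proof -
  have "Poly_Mapping.keys p \<subseteq> {0}"
    using assms by (auto simp: polys_def)
  then show ?thesis
    by (intro poly_mapping_eqI)
       (auto simp: const_poly_def lookup_single when_def in_keys_iff)
qed

text \<open>
  The height of a prime is at least the number of variables outside some algebraically independent
  set. Variables are discarded one at a time: if \<open>z\<close> is transcendental modulo \<open>P\<close> over the others,
  it can be added to every set that is independent for the others; if it is algebraic, the ideal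
  generated by the \<open>z\<close>-free part of \<open>P\<close> is a strictly smaller prime.
\<close>

lemma ex_prime_chain:
  assumes "finite W" "W \<subseteq> X" "prime_polys X P"
  shows "\<exists>B\<subseteq>W. P \<inter> polys B = {0} \<and> (\<exists>C. (\<forall>i\<le>card W - card B. prime_polys X (C i)) \<and>
           (\<forall>i<card W - card B. C i \<subset> C (Suc i)) \<and> C (card W - card B) = P)"
  using assms
proof (induction W arbitrary: P)
  case empty
  interpret P: prime_polys X P by fact
  have "p = 0" if "p \<in> P" "p \<in> polys {}" for p
    using P.const_notin[of "Poly_Mapping.lookup p 0"] polys_empty[OF that(2)] that(1)
    by (metis const_poly_0)
  then have "P \<inter> polys {} = {0}"
    using P.zero_mem by auto
  then show ?case
    using empty by (intro exI[of _ "{}"]) auto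
next
  case (insert z W)
  interpret P: prime_polys X P by fact
  show ?case
  proof (cases "P.extended z = P")
    case True
    obtain B C where B: "B \<subseteq> W" "P \<inter> polys B = {0}"
      and C: "\<forall>i\<le>card W - card B. prime_polys X (C i)"
        "\<forall>i<card W - card B. C i \<subset> C (Suc i)" "C (card W - card B) = P"
      using insert.IH[of P] insert.prems by blast
    have zB: "z \<notin> B" and "finite B"
      using insert B finite_subset by auto
    have card: "card (insert z W) - card (insert z B) = card W - card B"
      using insert zB \<open>finite B\<close> by simp
    have "p = 0" if p: "p \<in> P" "p \<in> polys (insert z B)" for p
    proof -
      have "coeff (expand z p) i \<in> P \<inter> polys B" for i
        using p True coeff_expand_polys[OF p(2), of z i] zB
        by (auto simp: P.extended_def)
      then have "expand z p = 0"
        by (intro poly_eqI) (use B(2) in auto)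
      then show ?thesis
        by (metis poly_0 poly_expand)
    qed
    then have "P \<inter> polys (insert z B) = {0}"
      using P.zero_mem by auto
    then show ?thesis
      using B C card by (intro exI[of _ "insert z B"]) auto
  next
    case False
    have z: "z \<in> X"
      using insert by simp
    have WX: "W \<subseteq> X"
      using insert.prems by simp
    obtain B C where B: "B \<subseteq> W" "P.extended z \<inter> polys B = {0}"
      and C: "\<forall>i\<le>card W - card B. prime_polys X (C i)"
        "\<forall>i<card W - card B. C i \<subset> C (Suc i)" "C (card W - card B) = P.extended z"
      using insert.IH[OF WX P.prime_extended[of z]] by (elim exE conjE) (rule that)
    have zB: "z \<notin> B"
      using insert B by auto
    have le: "card B \<le> card W"
      using B insert by (simp add: card_mono)
    then have card: "card (insert z W) - card B = Suc (card W - card B)"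
      using insert by simp
    have "P \<inter> polys B = {0}"
      using P.free_mem_extended[OF _ _ zB] B(2) P.zero_mem by auto
    moreover have "P.extended z \<subset> P"
      using False P.extended_subset[OF z] by auto
    ultimately show ?thesis
      using B C card insert.prems(2)
      by (intro exI[of _ B] conjI exI[of _ "\<lambda>i. if i \<le> card W - card B then C i else P"])
         (auto simp: less_Suc_eq le_Suc_eq)
  qed
qed

lemma ex_independent_height:
  assumes "finite X" "primeideal P (poly_ring X)"
  shows "\<exists>B\<subseteq>X. P \<inter> polys B = {0} \<and> enat (card X - card B) \<le> prime_height (poly_ring X) P"
proof -
  obtain B C where B: "B \<subseteq> X" "P \<inter> polys B = {0}"
    and C: "\<forall>i\<le>card X - card B. prime_polys X (C i)"
      "\<forall>i<card X - card B. C i \<subset> C (Suc i)" "C (card X - card B) = P"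
    using ex_prime_chain[of X X P] primeideal_imp_prime_polys assms by blast
  have "enat (card X - card B) \<le> prime_height (poly_ring X) P"
    unfolding prime_height_def
    by (rule Sup_upper) (use C prime_polys_imp_primeideal in blast)
  then show ?thesis
    using B by blast
qed

section \<open>Algebraic dependence modulo a prime ideal\<close>

locale prime_mpoly = prime_polys UNIV P for P :: "('a, 'k::field) mpoly set"
begin

text \<open>
  The variable \<open>z\<close> is algebraic over \<open>W\<close> modulo \<open>P\<close>: some relation \<open>F\<close> remains nonzero when its
  coefficients as a polynomial in \<open>z\<close> are reduced modulo \<open>P\<close>. The notion is meant for \<open>z \<notin> W\<close>.
\<close>

definition dep :: "'a set \<Rightarrow> 'a \<Rightarrow> bool" where
  "dep W z \<longleftrightarrow> (\<exists>F\<in>P \<inter> polys (insert z W). F \<notin> extended z)"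

definition cl :: "'a set \<Rightarrow> 'a set" where
  "cl W = W \<union> {z. dep W z}"

lemma mem_extended: "p \<in> extended z \<longleftrightarrow> (\<forall>i. coeff (expand z p) i \<in> P)"
  by (simp add: extended_def)

lemma coeff_expand_insert:
  assumes "z \<notin> W" "p \<in> polys (insert z W)"
  shows "coeff (expand z p) i \<in> polys W"
  using coeff_expand_polys[OF assms(2), of z i] assms(1) by simp

text \<open>
  Pseudo-division by an element \<open>m\<close> of least degree modulo \<open>P\<close>, packaged as an induction: the leading
  term of every other element can be cancelled at the cost of multiplying it by the leading
  coefficient \<open>g\<close> of \<open>m\<close>, and only elements that vanish modulo \<open>P\<close> remain.
\<close>

lemma least_degree_induct:
  assumes z: "z \<notin> W" and A: "A \<subseteq> polys (insert z W)" and h: "h \<in> A"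
    and m: "m \<in> A" "pdeg P (expand z m) n"
    and least: "\<And>a k. a \<in> A \<Longrightarrow> pdeg P (expand z a) k \<Longrightarrow> n \<le> k"
    and closed: "\<And>a c k. a \<in> A \<Longrightarrow> c \<in> polys W \<Longrightarrow>
       coeff (expand z m) n * a - c * Var z ^ k * m \<in> A"
    and base: "\<And>a. a \<in> A \<Longrightarrow> a \<in> extended z \<Longrightarrow> Q a"
    and step: "\<And>a c k. a \<in> A \<Longrightarrow> c \<in> polys W \<Longrightarrow>
       Q (coeff (expand z m) n * a - c * Var z ^ k * m) \<Longrightarrow> Q a"
  shows "Q h"
proof -
  interpret e: ring_map "expand z" by (rule ring_map_expand)
  have "Q a" if "a \<in> A" "\<forall>i\<ge>N. coeff (expand z a) i \<in> P" for a N
    using that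
  proof (induction N arbitrary: a)
    case 0
    then show ?case
      by (intro base) (auto simp: mem_extended)
  next
    case (Suc N)
    let ?g = "coeff (expand z m) n" and ?c = "coeff (expand z a) N"
    show ?case
    proof (cases "?c \<in> P")
      case True
      then have "\<forall>i\<ge>N. coeff (expand z a) i \<in> P"
        using Suc.prems(2) by (metis Suc_leI le_neq_implies_less)
      then show ?thesis
        using Suc.IH Suc.prems(1) by blast
    next
      case False
      then have "pdeg P (expand z a) N"
        using Suc.prems by (auto simp: pdeg_def Suc_le_eq)
      then have n: "n \<le> N"
        using least Suc.prems by blast
      have c: "?c \<in> polys W"
        using coeff_expand_insert[OF z] Suc.prems A by blast
      have g: "?g \<in> polys W"
        using coeff_expand_insert[OF z] m A by blast
      let ?b = "?g * a - ?c * Var z ^ (N - n) * m"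
      have "expand z ?b = smult ?g (expand z a)
          - smult ?c (monom 1 (N - n) * expand z m)"
        by (simp add: e.map_diff e.map_mult e.map_power expand_free[OF g z] expand_free[OF c z]
            expand_Var smult_monom_mult monom_altdef)
      then have coeff: "coeff (expand z ?b) i = ?g * coeff (expand z a) i
          - ?c * (if i < N - n then 0 else coeff (expand z m) (i - (N - n)))" for i
        by (simp add: coeff_monom_mult)
      have "coeff (expand z ?b) i \<in> P" if "i \<ge> N" for i
      proof (cases "i = N")
        case True
        have "coeff (expand z ?b) N = 0"
          unfolding coeff using n by (simp add: mult.commute)
        then show ?thesis
          using True zero_mem by simp
      next
        case False
        then have "coeff (expand z m) (i - (N - n)) \<in> P"
          using that n m(2) by (auto simp: pdeg_def)
        moreover have "coeff (expand z a) i \<in> P"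
          using that False Suc.prems by (simp add: Suc_le_eq)
        ultimately show ?thesis
          unfolding coeff using that n by (auto intro!: diff_mem mult_mem)
      qed
      then have "Q ?b"
        using Suc.IH closed[OF _ c] Suc.prems by blast
      then show ?thesis
        using step[OF _ c] Suc.prems by blast
    qed
  qed
  moreover have "\<forall>i\<ge>Suc (degree (expand z h)). coeff (expand z h) i \<in> P"
    using zero_mem by (auto simp: coeff_eq_0 Suc_le_eq)
  ultimately show ?thesis
    using h by blast
qed

lemma ex_least_degree:
  assumes "h \<in> A" "h \<notin> extended z"
  shows "\<exists>m\<in>A. \<exists>n. pdeg P (expand z m) n \<and> (\<forall>a\<in>A. \<forall>k. pdeg P (expand z a) k \<longrightarrow> n \<le> k)"
proof -
  let ?R = "\<lambda>n. \<exists>a\<in>A. pdeg P (expand z a) n"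
  have "\<exists>n. ?R n"
    using assms pdeg_ex[of "expand z h"] unfolding mem_extended by blast
  then have "?R (LEAST n. ?R n)"
    by (rule LeastI_ex)
  then show ?thesis
    using Least_le[of ?R] by blast
qed

lemma ex_least_relation:
  assumes "dep W z"
  shows "\<exists>G\<in>P \<inter> polys (insert z W). \<exists>n. pdeg P (expand z G) n \<and>
    (\<forall>F\<in>P \<inter> polys (insert z W). \<forall>k. pdeg P (expand z F) k \<longrightarrow> n \<le> k)"
  using assms ex_least_degree[of _ "P \<inter> polys (insert z W)" z] unfolding dep_def by blast

text \<open>
  If \<open>z\<close> is algebraic over \<open>W\<close> modulo \<open>P\<close>, every nonzero residue class has a nonzero multiple that
  does not involve \<open>z\<close>. This is the fact that a domain algebraic over a field is a field: a
  least-degree element \<open>m\<close> of the ideal generated by \<open>h\<close> and \<open>P\<close> divides, up to factors from \<open>W\<close>, both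
  \<open>h\<close> and a least relation \<open>F\<close> of \<open>z\<close>, which is impossible if \<open>m\<close> has positive degree.
\<close>

lemma ex_multiple_free:
  assumes z: "z \<notin> W" and dep: "dep W z" and h: "h \<in> polys (insert z W)" "h \<notin> P"
  shows "\<exists>e q. q \<in> polys W \<and> q \<notin> P \<and> q - e * h \<in> P"
proof -
  interpret e: ring_map "expand z" by (rule ring_map_expand)
  have ext: "extended z \<subseteq> P"
    by (rule extended_subset) simp
  interpret E: prime_polys UNIV "extended z"
    by (rule prime_extended)
  define A where "A = {a \<in> polys (insert z W). \<exists>e. a - e * h \<in> P}"
  have hA: "h \<in> A"
    using h zero_mem by (auto simp: A_def intro: exI[of _ 1])
  have "h \<notin> extended z"
    using h ext by blast
  from ex_least_degree[OF hA this] obtain m n where m: "m \<in> A" "pdeg P (expand z m) n"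
    and least: "\<And>a k. a \<in> A \<Longrightarrow> pdeg P (expand z a) k \<Longrightarrow> n \<le> k"
    by blast
  have closed: "r * a - s * b \<in> A"
    if ab: "a \<in> A" "b \<in> A" and rs: "r \<in> polys (insert z W)" "s \<in> polys (insert z W)" for a b r s
  proof -
    obtain e f where ef: "a - e * h \<in> P" "b - f * h \<in> P"
      using ab by (auto simp: A_def)
    have "r * (a - e * h) - s * (b - f * h) \<in> P"
      by (intro diff_mem mult_mem[OF _ ef(1)] mult_mem[OF _ ef(2)]) auto
    moreover have "r * (a - e * h) - s * (b - f * h) = (r * a - s * b) - (r * e - s * f) * h"
      by (simp add: algebra_simps)
    ultimately show ?thesis
      using ab rs by (auto simp: A_def)
  qed
  have W: "polys W \<subseteq> polys (insert z W)"
    by (rule polys_mono) auto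
  have g: "coeff (expand z m) i \<in> polys W" for i
    using coeff_expand_insert[OF z] m by (auto simp: A_def)
  have div: "\<exists>D q. D \<in> polys W \<and> D \<notin> P \<and> q \<in> polys (insert z W) \<and> D * a - q * m \<in> extended z"
    if "a \<in> A" for a
  proof (rule least_degree_induct[OF z _ that m least])
    show "A \<subseteq> polys (insert z W)"
      by (auto simp: A_def)
    show "coeff (expand z m) n * a - c * Var z ^ k * m \<in> A" if "a \<in> A" "c \<in> polys W" for a c k
      using that m g W by (intro closed) auto
    show "\<exists>D q. D \<in> polys W \<and> D \<notin> P \<and> q \<in> polys (insert z W) \<and> D * a - q * m \<in> extended z"
      if "a \<in> extended z" for a
      using that one_notin by (rule_tac x = 1 in exI, rule_tac x = 0 in exI) auto
    show "\<exists>D q. D \<in> polys W \<and> D \<notin> P \<and> q \<in> polys (insert z W) \<and> D * a - q * m \<in> extended z"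
      if c: "c \<in> polys W" and ex: "\<exists>D q. D \<in> polys W \<and> D \<notin> P \<and> q \<in> polys (insert z W) \<and>
         D * (coeff (expand z m) n * a - c * Var z ^ k * m) - q * m \<in> extended z" for a c k
    proof -
      let ?g = "coeff (expand z m) n"
      obtain D q where D: "D \<in> polys W" "D \<notin> P" "q \<in> polys (insert z W)"
        "D * (?g * a - c * Var z ^ k * m) - q * m \<in> extended z"
        using ex by blast
      have "D * (?g * a - c * Var z ^ k * m) - q * m
          = (D * ?g) * a - (D * c * Var z ^ k + q) * m"
        by (simp add: algebra_simps)
      moreover have "D * c * Var z ^ k + q \<in> polys (insert z W)"
        using D(1,3) c W by (intro polys_add polys_mult polys_power polys_Var) auto
      moreover have "D * ?g \<notin> P"
        using D m prime[of D ?g] by (auto simp: pdeg_def)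
      ultimately show ?thesis
        using D g c W
        by (rule_tac x = "D * ?g" in exI, rule_tac x = "D * c * Var z ^ k + q" in exI) auto
    qed
  qed
  show ?thesis
  \<comment> \<open>If \<open>m\<close> has degree \<open>0\<close> modulo \<open>P\<close>, its constant coefficient is the required multiple.\<close>
  proof (cases "n = 0")
    case True
    let ?q = "coeff (expand z m) 0"
    have "coeff (expand z (m - ?q)) i \<in> P" for i
      using m True zero_mem
      by (auto simp: e.map_diff expand_free[OF g z] pdeg_def coeff_pCons split: nat.split)
    then have "m - ?q \<in> P"
      using ext by (auto simp: mem_extended)
    moreover obtain e where "m - e * h \<in> P"
      using m by (auto simp: A_def)
    ultimately have "(m - e * h) - (m - ?q) \<in> P"
      using diff_mem by blast
    then have "?q - e * h \<in> P"
      by simp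
    then show ?thesis
      using m True g by (auto simp: pdeg_def)
  next
    case False
    \<comment> \<open>Since \<open>m\<close> divides \<open>h \<notin> P\<close> up to a factor outside \<open>P\<close>, it is not in \<open>P\<close>.\<close>
    have "m \<notin> P"
    proof
      assume "m \<in> P"
      obtain D q where D: "D \<notin> P" "D * h - q * m \<in> extended z"
        using div[OF hA] by blast
      have "D * h \<in> P"
        using D ext \<open>m \<in> P\<close> by (intro diff_memD[of "D * h" "q * m"] mult_mem) auto
      then show False
        using prime[of D h] D h by simp
    qed
    obtain F N where F: "F \<in> P \<inter> polys (insert z W)" "pdeg P (expand z F) N"
      and leastF: "\<forall>F\<in>P \<inter> polys (insert z W). \<forall>k. pdeg P (expand z F) k \<longrightarrow> N \<le> k"
      using ex_least_relation[OF dep] by blast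
    have "F \<in> A"
      using F by (auto simp: A_def intro!: exI[of _ 0])
    then obtain D q where D: "D \<in> polys W" "D \<notin> P" "q \<in> polys (insert z W)"
      "D * F - q * m \<in> extended z"
      using div by blast
    \<comment> \<open>The cofactor \<open>q\<close> of \<open>m\<close> in \<open>F\<close> is a relation of smaller degree than \<open>F\<close>.\<close>
    have "q * m \<in> P"
    proof -
      have "D * F - (D * F - q * m) \<in> P"
        using F ext D(4) mult_mem[of D F] by (rule_tac diff_mem) auto
      then show ?thesis by simp
    qed
    then have q: "q \<in> P"
      using prime[of q m] \<open>m \<notin> P\<close> by simp
    have "pdeg P (expand z D) 0"
      using D zero_mem by (auto simp: pdeg_def expand_free[OF D(1) z] coeff_pCons split: nat.split)
    then have "pdeg P (expand z (D * F)) N"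
      using pdeg_mult[of "expand z D" "expand z F" 0 N] F by (simp add: e.map_mult)
    then have qm: "pdeg P (expand z (q * m)) N"
      using D(4) pdeg_cong[of "expand z (D * F)" "expand z (q * m)" N]
      by (simp add: mem_extended e.map_diff)
    have "q \<notin> extended z"
    proof
      assume "q \<in> extended z"
      then have "q * m \<in> extended z"
        by (rule E.mult_mem') simp
      then show False
        using qm by (auto simp: mem_extended pdeg_def)
    qed
    then obtain N' where N': "pdeg P (expand z q) N'"
      using pdeg_ex[of "expand z q"] by (auto simp: mem_extended)
    then have "pdeg P (expand z (q * m)) (N' + n)"
      using pdeg_mult[of "expand z q" "expand z m" N' n] m by (simp add: e.map_mult)
    then have "N = N' + n"
      using qm pdeg_unique by blast
    moreover have "N \<le> N'"
      using leastF N' q D by blast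
    ultimately show ?thesis
      using False by simp
  qed
qed

lemma cl_mono: "W \<subseteq> W' \<Longrightarrow> cl W \<subseteq> cl W'"
proof
  fix z assume "W \<subseteq> W'" "z \<in> cl W"
  moreover from this have "polys (insert z W) \<subseteq> polys (insert z W')"
    by (intro polys_mono) auto
  ultimately show "z \<in> cl W'"
    by (auto simp: cl_def dep_def)
qed

text \<open>
  Let \<open>z\<close> be transcendental over \<open>W\<close>. Then \<open>w\<close> is still algebraic over \<open>W\<close> and \<open>z\<close> modulo the smaller
  prime \<open>extended z\<close>, and eliminating \<open>w\<close> from a relation of \<open>z\<close> over \<open>W\<close> and \<open>w\<close> leaves a relation of
  \<open>z\<close> over \<open>W\<close>.
\<close>

lemma cl_trans:
  assumes z: "z \<in> cl (insert w W)" and w: "w \<in> cl W"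
  shows "z \<in> cl W"
proof (rule ccontr)
  assume not: "z \<notin> cl W"
  then have "z \<noteq> w" "z \<notin> W"
    using w by (auto simp: cl_def)
  moreover have "w \<notin> W"
    using not z by (auto simp: insert_absorb)
  ultimately have depz: "dep (insert w W) z" and depw: "dep W w" and ndep: "\<not> dep W z"
    using z w not by (auto simp: cl_def)
  interpret E: prime_mpoly "extended z"
    unfolding prime_mpoly_def by (rule prime_extended)
  have ext: "extended z \<subseteq> P"
    by (rule extended_subset) simp
  obtain F where F: "F \<in> P" "F \<in> polys (insert z (insert w W))" "F \<notin> extended z"
    using depz by (auto simp: dep_def)
  obtain G where G: "G \<in> P" "G \<in> polys (insert w W)" "G \<notin> extended w"
    using depw by (auto simp: dep_def)
  have "G \<in> extended z"
    using free_mem_extended[OF G(1,2)] \<open>z \<noteq> w\<close> \<open>z \<notin> W\<close> by simp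
  moreover have "G \<notin> E.extended w"
    using G(3) ext unfolding mem_extended[of G w] E.mem_extended by blast
  moreover have "G \<in> polys (insert w (insert z W))"
    using G(2) polys_mono[of "insert w W" "insert w (insert z W)"] by blast
  ultimately have "E.dep (insert z W) w"
    by (auto simp: E.dep_def)
  then obtain e q where q: "q \<in> polys (insert z W)" "q \<notin> extended z" "q - e * F \<in> extended z"
    using E.ex_multiple_free[of w "insert z W" F] F \<open>z \<noteq> w\<close> \<open>w \<notin> W\<close> by (auto simp: insert_commute)
  have "q \<in> P"
    using q(3) ext F(1) by (intro diff_memD[of q "e * F"] mult_mem) auto
  then show False
    using q ndep by (auto simp: dep_def)
qed

text \<open>
  A relation between \<open>z\<close> and \<open>w\<close> over \<open>W\<close> that is trivial for \<open>w\<close> has coefficients that are relations of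
  \<open>z\<close> over \<open>W\<close>.
\<close>

lemma cl_exchange:
  assumes z: "z \<in> cl (insert w W)" "z \<notin> cl W"
  shows "w \<in> cl (insert z W)"
proof (rule ccontr)
  assume not: "w \<notin> cl (insert z W)"
  have "z \<noteq> w" "z \<notin> W"
    using not z by (auto simp: cl_def)
  then have depz: "dep (insert w W) z" and ndepz: "\<not> dep W z" and ndepw: "\<not> dep (insert z W) w"
    using z not by (auto simp: cl_def)
  have "w \<notin> W"
    using not by (auto simp: cl_def)
  interpret E: prime_mpoly "extended z"
    unfolding prime_mpoly_def by (rule prime_extended)
  obtain F where F: "F \<in> P" "F \<in> polys (insert z (insert w W))" "F \<notin> extended z"
    using depz by (auto simp: dep_def)
  have Fw: "F \<in> polys (insert w (insert z W))"
    using F(2) by (simp add: insert_commute)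
  then have "F \<in> extended w"
    using ndepw F by (auto simp: dep_def)
  moreover have "coeff (expand w F) i \<in> polys (insert z W)" for i
    using coeff_expand_insert[OF _ Fw] \<open>z \<noteq> w\<close> \<open>w \<notin> W\<close> by auto
  ultimately have "coeff (expand w F) i \<in> extended z" for i
    using ndepz by (auto simp: dep_def mem_extended)
  then have "(\<Sum>i\<le>degree (expand w F). coeff (expand w F) i * Var w ^ i) \<in> extended z"
    by (intro E.sum_mem E.mult_mem') auto
  then show False
    using F(3) by (simp only: sum_coeffs_expand)
qed

text \<open>
  Steinitz exchange. An element \<open>i\<close> of \<open>I\<close> outside \<open>B\<close> depends on a minimal set \<open>D\<close> between \<open>I \<inter> B\<close> and
  \<open>B\<close>; an element \<open>b\<close> of \<open>D\<close> outside \<open>I\<close> exists by independence and can be exchanged for \<open>i\<close>.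
\<close>

lemma card_independent_le:
  assumes "finite I" "finite B" and indep: "P \<inter> polys I = {0}" and span: "I \<subseteq> cl B"
  shows "card I \<le> card B"
  using assms(2) span
proof (induction "card (I - B)" arbitrary: B)
  case 0
  then have "I \<subseteq> B"
    using assms(1) by simp
  then show ?case
    using 0 by (simp add: card_mono)
next
  case (Suc k)
  have notcl: "i \<notin> cl (I - {i})" if "i \<in> I" for i
  proof -
    interpret e: ring_map "expand i" by (rule ring_map_expand)
    have "insert i (I - {i}) = I"
      using that by auto
    then show ?thesis
      using indep by (auto simp: cl_def dep_def mem_extended e.map_zero zero_mem)
  qed
  obtain i where i: "i \<in> I" "i \<notin> B"
    using Suc.hyps(2) by (metis DiffE card_gt_0_iff ex_in_conv zero_less_Suc)
  let ?S = "{D. I \<inter> B \<subseteq> D \<and> D \<subseteq> B \<and> i \<in> cl D}"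
  have "finite ?S" "B \<in> ?S"
    using Suc.prems i by (auto intro: finite_subset[of _ "Pow B"])
  then obtain D where D: "D \<in> ?S" and min: "\<And>D'. D' \<in> ?S \<Longrightarrow> D' \<subseteq> D \<Longrightarrow> D' = D"
    by (metis (no_types, lifting) finite_has_minimal2)
  have "D \<noteq> I \<inter> B"
    using notcl[OF i(1)] D cl_mono[of "I \<inter> B" "I - {i}"] i by auto
  then obtain b where b: "b \<in> D" "b \<notin> I"
    using D by auto
  have "D - {b} \<notin> ?S"
    using min[of "D - {b}"] b by auto
  then have "i \<notin> cl (D - {b})"
    using D b by auto
  moreover have "i \<in> cl (insert b (D - {b}))"
    using D b by (simp add: insert_absorb)
  ultimately have "b \<in> cl (insert i (D - {b}))"
    using cl_exchange by blast
  let ?B = "insert i (B - {b})"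
  have bcl: "b \<in> cl ?B"
    using \<open>b \<in> cl (insert i (D - {b}))\<close> D cl_mono[of "insert i (D - {b})" ?B] by auto
  have "b \<in> B"
    using b D by auto
  have "I \<subseteq> cl ?B"
  proof
    fix j assume "j \<in> I"
    then have "j \<in> cl (insert b ?B)"
      using Suc.prems cl_mono[of B "insert b ?B"] by auto
    then show "j \<in> cl ?B"
      using bcl cl_trans by blast
  qed
  moreover have "I - B = insert i (I - ?B)" "i \<notin> I - ?B"
    using i b by auto
  then have "k = card (I - ?B)"
    using Suc.hyps(2) assms(1) by simp
  ultimately have "card I \<le> card ?B"
    using Suc.hyps(1)[of ?B] Suc.prems by simp
  also have "card ?B = card B"
    using i \<open>b \<in> B\<close> Suc.prems
    by (metis DiffE card.insert_remove card_Suc_Diff1 card_insert_disjoint finite_Diff)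
  finally show ?case .
qed

end

section \<open>Partial derivatives\<close>

text \<open>
  On coefficients the truncated subtraction in the definition disappears.
\<close>

lemma lookup_partial_deriv:
  "Poly_Mapping.lookup (partial_deriv b p) m =
     of_nat (Suc (Poly_Mapping.lookup m b)) * Poly_Mapping.lookup p (m + Poly_Mapping.single b 1)"
proof -
  let ?e = "Poly_Mapping.single b (1 :: nat)"
  have eq: "Poly_Mapping.lookup (Poly_Mapping.single (n - ?e)
        (of_nat (Poly_Mapping.lookup n b) * Poly_Mapping.lookup p n)) m
      = (if n = m + ?e then of_nat (Suc (Poly_Mapping.lookup m b)) * Poly_Mapping.lookup p n else 0)" for n
  proof (cases "n = m + ?e")
    case True
    then show ?thesis
      by (simp add: lookup_add)
  next
    case False
    have "n - ?e \<noteq> m" if "Poly_Mapping.lookup n b \<noteq> 0"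
    proof
      assume "n - ?e = m"
      then have "m + ?e = n"
        using that by (intro poly_mapping_eqI)
          (auto simp: lookup_add lookup_minus lookup_single when_def)
      then show False
        using False by simp
    qed
    then show ?thesis
      using False by (cases "Poly_Mapping.lookup n b = 0") (auto simp: lookup_single)
  qed
  show ?thesis
    unfolding partial_deriv_def lookup_sum eq
    by (simp add: sum.delta' in_keys_iff)
qed

lemma partial_deriv_add: "partial_deriv b (p + q) = partial_deriv b p + partial_deriv b q"
  by (rule poly_mapping_eqI) (simp add: lookup_partial_deriv lookup_add algebra_simps)

lemma partial_deriv_0: "partial_deriv b 0 = 0"
  by (rule poly_mapping_eqI) (simp add: lookup_partial_deriv)

lemma partial_deriv_sum: "partial_deriv b (sum f A) = (\<Sum>i\<in>A. partial_deriv b (f i))"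
  by (induction A rule: infinite_finite_induct) (auto simp: partial_deriv_0 partial_deriv_add)

lemma partial_deriv_uminus: "partial_deriv b (- p) = - partial_deriv b p"
  by (rule poly_mapping_eqI) (simp add: lookup_partial_deriv)

lemma partial_deriv_diff: "partial_deriv b (p - q) = partial_deriv b p - partial_deriv b q"
  using partial_deriv_add[of b p "- q"] by (simp add: partial_deriv_uminus)

lemma partial_deriv_single:
  "partial_deriv b (Poly_Mapping.single m c) =
     Poly_Mapping.single (m - Poly_Mapping.single b 1) (of_nat (Poly_Mapping.lookup m b) * c)"
  by (cases "c = 0") (auto simp: partial_deriv_def)

lemma partial_deriv_mult:
  "partial_deriv b (p * q) = p * partial_deriv b q + partial_deriv b p * q"
proof -
  let ?e = "Poly_Mapping.single b (1 :: nat)"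
  let ?s = Poly_Mapping.single
  have shift: "m + n - ?e = m + (n - ?e)" if "Poly_Mapping.lookup n b \<noteq> 0" for m n :: "'a \<Rightarrow>\<^sub>0 nat"
    using that by (intro poly_mapping_eqI) (auto simp: lookup_add lookup_minus lookup_single when_def)
  have 1: "?s (m + n - ?e) (of_nat (Poly_Mapping.lookup n b) * x)
      = ?s (m + (n - ?e)) (of_nat (Poly_Mapping.lookup n b) * (x::'b))" for m n x
    by (cases "Poly_Mapping.lookup n b = 0") (auto simp: shift[unfolded One_nat_def])
  have mono: "partial_deriv b (?s m c * ?s n c') = ?s m c * partial_deriv b (?s n c')
      + partial_deriv b (?s m c) * ?s n c'" for m n and c c' :: 'b
    using 1[of m n "c * c'"] 1[of n m "c * c'"]
    by (simp add: partial_deriv_single mult_single lookup_add single_add algebra_simps)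
  have 2: "partial_deriv b (?s m c * q) = ?s m c * partial_deriv b q + partial_deriv b (?s m c) * q"
    for m and c :: 'b
    by (induction q rule: mpoly_induct)
       (simp_all add: mono partial_deriv_add distrib_left add_ac)
  show ?thesis
    by (induction p rule: mpoly_induct)
       (simp_all add: 2 partial_deriv_add distrib_right add_ac)
qed

lemma partial_deriv_Var: "partial_deriv b (Var c) = (if b = c then 1 else 0)"
  by (auto simp: Var_def partial_deriv_single lookup_single)

lemma partial_deriv_const: "partial_deriv b (const_poly c) = 0"
  by (simp add: const_poly_def partial_deriv_single)

lemma partial_deriv_free:
  assumes "p \<in> polys W" "b \<notin> W"
  shows "partial_deriv b p = 0"
proof -
  have "Poly_Mapping.lookup m b = 0" if "m \<in> Poly_Mapping.keys p" for m
  proof -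
    have "b \<notin> Poly_Mapping.keys m"
      using assms that by (auto simp: polys_def)
    then show ?thesis
      by (simp add: in_keys_iff)
  qed
  then show ?thesis
    by (simp add: partial_deriv_def)
qed

lemma partial_deriv_polys: "p \<in> polys X \<Longrightarrow> partial_deriv b p \<in> polys X"
proof (cases "b \<in> X")
  case True
  assume "p \<in> polys X"
  then show ?thesis
    by (induction rule: polys_induct)
       (use True in \<open>auto simp: partial_deriv_add partial_deriv_mult partial_deriv_Var
          const_poly_def partial_deriv_single\<close>)
qed (simp add: partial_deriv_free)

lemma partial_deriv_commute: "partial_deriv a (partial_deriv b p) = partial_deriv b (partial_deriv a p)"
  by (rule poly_mapping_eqI)
     (auto simp: lookup_partial_deriv lookup_add lookup_single when_def ac_simps)

section \<open>Prime ideals with dense rational points\<close>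

text \<open>
  For a prime of this kind the points of \<open>S\<close> on its zero set are dense there, so that finitely many
  generic conditions can be met by a point of \<open>S\<close>.
\<close>

locale dense_prime = prime_mpoly P for P :: "('a, 'k::field) mpoly set" +
  fixes S :: "('a \<Rightarrow> 'k) set"
  assumes dense: "D \<notin> P \<Longrightarrow> finite F \<Longrightarrow> F \<subseteq> P \<Longrightarrow>
    \<exists>\<phi>\<in>S. poly_eval \<phi> D \<noteq> 0 \<and> (\<forall>p\<in>F. poly_eval \<phi> p = 0)"

lemma ring_map_poly_eval: "ring_map (poly_eval \<phi>)"
  unfolding poly_eval_eq_eval_hom by (rule ring_map_eval_hom[OF ring_map_id])

text \<open>
  The complement of a maximal multiplicative set \<open>M\<close> of polynomials that do not vanish identically on
  \<open>S\<close> is a minimal prime over the ideal of \<open>S\<close>. By maximality every \<open>p\<close> outside \<open>M\<close> is annihilated on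
  \<open>S\<close> by some \<open>D\<close> in \<open>M\<close>. This makes the complement an ideal, and it gives the density: \<open>p\<close> vanishes at
  all points of \<open>S\<close> where \<open>D\<close> does not.
\<close>

lemma ex_dense_prime:
  fixes S :: "('a \<Rightarrow> 'k::field) set"
  assumes one: "1 \<in> M0" and mult: "\<And>p q. p \<in> M0 \<Longrightarrow> q \<in> M0 \<Longrightarrow> p * q \<in> M0"
    and nonvanishing: "\<And>p. p \<in> M0 \<Longrightarrow> \<exists>\<phi>\<in>S. poly_eval \<phi> p \<noteq> 0"
  shows "\<exists>P. dense_prime P S \<and> P \<inter> M0 = {}"
proof -
  define \<A> where "\<A> = {M. M0 \<subseteq> M \<and> (\<forall>p\<in>M. \<forall>q\<in>M. p * q \<in> M) \<and> (\<forall>p\<in>M. \<exists>\<phi>\<in>S. poly_eval \<phi> p \<noteq> 0)}"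
  have "\<exists>M\<in>\<A>. \<forall>X\<in>\<A>. M \<subseteq> X \<longrightarrow> X = M"
  proof (rule subset_Zorn_nonempty)
    show "\<A> \<noteq> {}"
      using assms by (auto simp: \<A>_def)
    fix \<C> assume C: "\<C> \<noteq> {}" "subset.chain \<A> \<C>"
    have sub: "M0 \<subseteq> M" and prod: "\<And>p q. p \<in> M \<Longrightarrow> q \<in> M \<Longrightarrow> p * q \<in> M"
      and ne: "\<And>p. p \<in> M \<Longrightarrow> \<exists>\<phi>\<in>S. poly_eval \<phi> p \<noteq> 0" if "M \<in> \<C>" for M
    proof -
      have "M \<in> \<A>"
        using C(2) \<open>M \<in> \<C>\<close> by (auto simp: subset_chain_def)
      then show "M0 \<subseteq> M" "\<And>p q. p \<in> M \<Longrightarrow> q \<in> M \<Longrightarrow> p * q \<in> M"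
        "\<And>p. p \<in> M \<Longrightarrow> \<exists>\<phi>\<in>S. poly_eval \<phi> p \<noteq> 0"
        by (auto simp: \<A>_def)
    qed
    have "p * q \<in> \<Union>\<C>" if pq: "p \<in> \<Union>\<C>" "q \<in> \<Union>\<C>" for p q
    proof -
      obtain M N where MN: "M \<in> \<C>" "N \<in> \<C>" "p \<in> M" "q \<in> N"
        using pq by blast
      have "M \<subseteq> N \<or> N \<subseteq> M"
        using C(2) MN(1,2) by (auto simp: subset_chain_def)
      then show ?thesis
        using MN prod[OF MN(1)] prod[OF MN(2)] by (meson UnionI subsetD)
    qed
    moreover have "M0 \<subseteq> \<Union>\<C>"
      using C(1) sub by blast
    moreover have "\<forall>p\<in>\<Union>\<C>. \<exists>\<phi>\<in>S. poly_eval \<phi> p \<noteq> 0"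
      using ne by blast
    ultimately show "\<Union>\<C> \<in> \<A>"
      by (simp add: \<A>_def)
  qed
  then obtain M where M: "M \<in> \<A>" and max: "\<And>X. X \<in> \<A> \<Longrightarrow> M \<subseteq> X \<Longrightarrow> X = M"
    by blast
  have M1: "1 \<in> M" and Mmult: "\<And>p q. p \<in> M \<Longrightarrow> q \<in> M \<Longrightarrow> p * q \<in> M"
    and Mne: "\<And>p. p \<in> M \<Longrightarrow> \<exists>\<phi>\<in>S. poly_eval \<phi> p \<noteq> 0" and M0: "M0 \<subseteq> M"
    using M one by (auto simp: \<A>_def)
  have ev: "poly_eval \<phi> (p * q) = poly_eval \<phi> p * poly_eval \<phi> q"
    "poly_eval \<phi> (p + q) = poly_eval \<phi> p + poly_eval \<phi> q"
    "poly_eval \<phi> (p ^ n) = poly_eval \<phi> p ^ n" "poly_eval \<phi> 0 = 0"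
    for \<phi> :: "'a \<Rightarrow> 'k" and p q n
    using ring_map_poly_eval[of \<phi>]
    by (simp_all add: ring_map.map_mult ring_map.map_add ring_map.map_power ring_map.map_zero)
  have notin: "\<exists>D\<in>M. \<forall>\<phi>\<in>S. poly_eval \<phi> D * poly_eval \<phi> p = 0" if "p \<notin> M" for p
  proof (rule ccontr)
    assume *: "\<not> ?thesis"
    \<comment> \<open>Otherwise \<open>M\<close> could be enlarged by the powers of \<open>p\<close>.\<close>
    let ?N = "{D * p ^ n | D n. D \<in> M}"
    have "?N \<in> \<A>"
      unfolding \<A>_def
    proof (rule CollectI, intro conjI ballI)
      show "M0 \<subseteq> ?N"
      proof
        fix x assume "x \<in> M0"
        then show "x \<in> ?N"
          using M0 by (intro CollectI exI[of _ x] exI[of _ 0]) auto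
      qed
      show "x * y \<in> ?N" if x: "x \<in> ?N" and y: "y \<in> ?N" for x y
      proof -
        obtain D n E m where "x = D * p ^ n" "y = E * p ^ m" "D \<in> M" "E \<in> M"
          using x y by blast
        then have "x * y = (D * E) * p ^ (n + m)" "D * E \<in> M"
          by (simp_all add: power_add algebra_simps Mmult)
        then show ?thesis
          by blast
      qed
      show "\<exists>\<phi>\<in>S. poly_eval \<phi> x \<noteq> 0" if x: "x \<in> ?N" for x
      proof -
        obtain D n where D: "x = D * p ^ n" "D \<in> M"
          using x by blast
        then obtain \<phi> where "\<phi> \<in> S" "poly_eval \<phi> D * poly_eval \<phi> p \<noteq> 0"
          using * by blast
        then show ?thesis
          using D by (intro bexI[of _ \<phi>]) (auto simp: ev)
      qed
    qed
    moreover have "M \<subseteq> ?N"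
    proof
      fix x assume "x \<in> M"
      then show "x \<in> ?N"
        by (intro CollectI exI[of _ x] exI[of _ 0]) auto
    qed
    ultimately have "?N = M"
      using max by blast
    moreover have "p \<in> ?N"
      using M1 by (intro CollectI exI[of _ 1] exI[of _ 1]) auto
    ultimately show False
      using that by blast
  qed
  have notin_iff: "p \<notin> M \<longleftrightarrow> (\<exists>D\<in>M. \<forall>\<phi>\<in>S. poly_eval \<phi> D * poly_eval \<phi> p = 0)" for p
  proof
    assume "\<exists>D\<in>M. \<forall>\<phi>\<in>S. poly_eval \<phi> D * poly_eval \<phi> p = 0"
    then obtain D where "D \<in> M" "\<forall>\<phi>\<in>S. poly_eval \<phi> D * poly_eval \<phi> p = 0"
      by blast
    then show "p \<notin> M"
      using Mne[of "D * p"] Mmult[of D p] by (auto simp: ev)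
  qed (rule notin)
  have "dense_prime (- M) S"
  proof unfold_locales
    show "0 \<in> - M"
      using Mne[of 0] by (auto simp: ev)
    show "p + q \<in> - M" if pq: "p \<in> - M" "q \<in> - M" for p q
    proof -
      obtain D E where D: "D \<in> M" "\<forall>\<phi>\<in>S. poly_eval \<phi> D * poly_eval \<phi> p = 0"
        and E: "E \<in> M" "\<forall>\<phi>\<in>S. poly_eval \<phi> E * poly_eval \<phi> q = 0"
        using pq notin by (metis ComplD)
      have "\<forall>\<phi>\<in>S. poly_eval \<phi> (D * E) * poly_eval \<phi> (p + q) = 0"
        using D(2) E(2) by (auto simp: ev algebra_simps)
      then show ?thesis
        using notin_iff Mmult[OF D(1) E(1)] by blast
    qed
    show "r * p \<in> - M" if "p \<in> - M" for r p
    proof -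
      obtain D where D: "D \<in> M" "\<forall>\<phi>\<in>S. poly_eval \<phi> D * poly_eval \<phi> p = 0"
        using \<open>p \<in> - M\<close> notin by blast
      then have "\<forall>\<phi>\<in>S. poly_eval \<phi> D * poly_eval \<phi> (r * p) = 0"
        by (auto simp: ev)
      then show ?thesis
        using notin_iff D(1) by blast
    qed
    show "p \<in> - M \<or> q \<in> - M" if "p * q \<in> - M" for p q
      using that Mmult by blast
    show "\<exists>\<phi>\<in>S. poly_eval \<phi> D \<noteq> 0 \<and> (\<forall>p\<in>F. poly_eval \<phi> p = 0)"
      if "D \<notin> - M" "finite F" "F \<subseteq> - M" for D F
    proof -
      have "\<exists>E\<in>M. \<forall>\<phi>\<in>S. poly_eval \<phi> E \<noteq> 0 \<longrightarrow> (\<forall>p\<in>F. poly_eval \<phi> p = 0)"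
        using \<open>finite F\<close> \<open>F \<subseteq> - M\<close>
      proof (induction F)
        case empty
        then show ?case using M1 by auto
      next
        case (insert p F)
        then obtain E where E: "E \<in> M" "\<forall>\<phi>\<in>S. poly_eval \<phi> E \<noteq> 0 \<longrightarrow> (\<forall>p\<in>F. poly_eval \<phi> p = 0)"
          by auto
        obtain E' where "E' \<in> M" "\<forall>\<phi>\<in>S. poly_eval \<phi> E' * poly_eval \<phi> p = 0"
          using insert.prems notin by blast
        then show ?case
          using E by (intro bexI[of _ "E * E'"]) (auto simp: ev Mmult)
      qed
      then obtain E where E: "E \<in> M" "\<forall>\<phi>\<in>S. poly_eval \<phi> E \<noteq> 0 \<longrightarrow> (\<forall>p\<in>F. poly_eval \<phi> p = 0)"
        by blast
      have "D * E \<in> M"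
        using Mmult[of D E] E(1) \<open>D \<notin> - M\<close> by blast
      then obtain \<phi> where "\<phi> \<in> S" "poly_eval \<phi> (D * E) \<noteq> 0"
        using Mne by blast
      then show ?thesis
        using E(2) by (intro bexI[of _ \<phi>]) (auto simp: ev)
    qed
  qed (use M1 in auto)
  then show ?thesis
    using M0 by blast
qed

text \<open>
  A coordinate functional of the field as a vector space over its \<open>q\<close>-th powers, followed by the
  \<open>q\<close>-th root.
\<close>

lemma ex_frobenius_functional:
  assumes "prime CHAR('k::field)" "c \<noteq> (0 :: 'k)"
  shows "\<exists>g :: 'k \<Rightarrow> 'k. g c = 1 \<and> (\<forall>x y. g (x + y) = g x + g y) \<and>
     (\<forall>a x. g (a ^ CHAR('k) * x) = a * g x)"
proof -
  interpret vs1: vector_space "\<lambda>a x :: 'k. a ^ CHAR('k) * x"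
    by unfold_locales
       (auto simp: algebra_simps power_mult_distrib freshmans_dream[OF assms(1)])
  interpret vs2: vector_space "(*) :: 'k \<Rightarrow> 'k \<Rightarrow> 'k"
    by unfold_locales (auto simp: algebra_simps)
  interpret vector_space_pair "\<lambda>a x :: 'k. a ^ CHAR('k) * x" "(*) :: 'k \<Rightarrow> 'k \<Rightarrow> 'k" ..
  have "vs1.independent {c}"
    using assms(2) vs1.dependent_single by simp
  then obtain g where g: "Vector_Spaces.linear (\<lambda>a x :: 'k. a ^ CHAR('k) * x) (*) g" "g c = 1"
    using linear_independent_extend[of "{c}" "\<lambda>_. 1"] by auto
  interpret g: Vector_Spaces.linear "\<lambda>a x :: 'k. a ^ CHAR('k) * x" "(*)" g
    by (rule g(1))
  show ?thesis
    using g(2) g.add g.scale by blast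
qed

lemma mdeg_add: "mdeg (a + b) = mdeg a + mdeg b"
  unfolding mdeg_def by (rule setsum_keys_plus_distrib) auto

lemma mdeg_single: "mdeg (Poly_Mapping.single z k) = k"
  by (simp add: mdeg_def)

text \<open>
  MacLane's criterion. In a relation \<open>F\<close> of least total degree all partial derivatives in \<open>P\<close> must
  vanish, so in characteristic \<open>q > 0\<close> only \<open>q\<close>-th powers of monomials occur in \<open>F\<close>. A functional
  that is inverse to Frobenius on the field turns \<open>F\<close> into a relation of smaller degree, since the
  values at rational points are compatible with it.
\<close>

lemma (in dense_prime) ex_separable_relation:
  assumes F0: "F0 \<in> P" "F0 \<in> polys Y" "F0 \<noteq> 0"
  shows "\<exists>z\<in>Y. \<exists>F\<in>P \<inter> polys Y. partial_deriv z F \<notin> P"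
proof (rule ccontr)
  assume "\<not> ?thesis"
  then have deriv: "\<And>z F. z \<in> Y \<Longrightarrow> F \<in> P \<Longrightarrow> F \<in> polys Y \<Longrightarrow> partial_deriv z F \<in> P"
    by blast
  define R where "R n \<longleftrightarrow> (\<exists>F\<in>P \<inter> polys Y. F \<noteq> 0 \<and> (\<forall>m\<in>Poly_Mapping.keys F. mdeg m \<le> n))" for n
  have "R (Max (mdeg ` Poly_Mapping.keys F0))"
    unfolding R_def using F0 by (intro bexI[of _ F0]) auto
  then obtain n where Rn: "R n" and least: "\<And>k. R k \<Longrightarrow> n \<le> k"
    using LeastI[of R] Least_le[of R] by blast
  obtain F where F: "F \<in> P" "F \<in> polys Y" "F \<noteq> 0" and deg: "\<And>m. m \<in> Poly_Mapping.keys F \<Longrightarrow> mdeg m \<le> n"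
    using Rn by (auto simp: R_def)
  have zero: "of_nat (Poly_Mapping.lookup m z) = (0 :: 'k)" if m: "m \<in> Poly_Mapping.keys F" for m z
  proof (cases "Poly_Mapping.lookup m z = 0")
    case False
    then have "z \<in> Poly_Mapping.keys m"
      by (simp add: in_keys_iff)
    then have z: "z \<in> Y"
      using m F(2) by (auto simp: polys_def)
    have "partial_deriv z F = 0"
    proof (rule ccontr)
      assume nz: "partial_deriv z F \<noteq> 0"
      have k: "mdeg k + 1 \<le> n" if "k \<in> Poly_Mapping.keys (partial_deriv z F)" for k
      proof -
        have "k + Poly_Mapping.single z 1 \<in> Poly_Mapping.keys F"
          using that by (auto simp: in_keys_iff lookup_partial_deriv)
        then show ?thesis
          using deg[of "k + Poly_Mapping.single z 1"] by (simp add: mdeg_add mdeg_single)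
      qed
      obtain k0 where "k0 \<in> Poly_Mapping.keys (partial_deriv z F)"
        using nz by (metis equals0I keys_eq_empty)
      then have "n \<ge> 1"
        using k by fastforce
      moreover have "R (n - 1)"
        unfolding R_def using deriv[OF z F(1,2)] partial_deriv_polys[OF F(2)] nz k
        by (intro bexI[of _ "partial_deriv z F"]) fastforce+
      ultimately show False
        using least[of "n - 1"] by simp
    qed
    moreover have "m - Poly_Mapping.single z 1 + Poly_Mapping.single z 1 = m"
      using False by (intro poly_mapping_eqI) (auto simp: lookup_add lookup_minus lookup_single when_def)
    then have "Poly_Mapping.lookup (partial_deriv z F) (m - Poly_Mapping.single z 1)
        = of_nat (Poly_Mapping.lookup m z) * Poly_Mapping.lookup F m"
      using False by (simp add: lookup_partial_deriv lookup_minus)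
    ultimately show ?thesis
      using m by (simp add: in_keys_iff)
  qed simp
  let ?q = "CHAR('k)"
  \<comment> \<open>The relation is not constant, so the characteristic is positive.\<close>
  have "\<exists>m\<in>Poly_Mapping.keys F. m \<noteq> 0"
  proof (rule ccontr)
    assume "\<not> ?thesis"
    then have "F \<in> polys {}"
      by (auto simp: polys_def)
    then have eq: "F = const_poly (Poly_Mapping.lookup F 0)"
      by (rule polys_empty)
    then have "Poly_Mapping.lookup F 0 \<noteq> 0"
      using F(3) by (metis const_poly_0)
    then show False
      using const_notin eq F(1) by metis
  qed
  then obtain m0 where m0: "m0 \<in> Poly_Mapping.keys F" "m0 \<noteq> 0"
    by blast
  then obtain z0 where z0: "Poly_Mapping.lookup m0 z0 \<noteq> 0"
    by (metis lookup_zero poly_mapping_eqI)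
  have dvd: "?q dvd Poly_Mapping.lookup m z" if "m \<in> Poly_Mapping.keys F" for m z
    using zero[OF that] by (simp add: of_nat_eq_0_iff_char_dvd)
  have "?q > 0"
    using dvd[OF m0(1), of z0] z0 by (metis dvd_0_left gr0I)
  then have q: "prime ?q"
    by (rule prime_CHAR_semidom)
  have c0: "Poly_Mapping.lookup F m0 \<noteq> 0"
    using m0(1) by (simp add: in_keys_iff)
  obtain g :: "'k \<Rightarrow> 'k" where g: "g (Poly_Mapping.lookup F m0) = 1" "\<And>x y. g (x + y) = g x + g y"
    "\<And>a x. g (a ^ ?q * x) = a * g x"
    using ex_frobenius_functional[OF q c0] by blast
  have g0: "g 0 = 0"
    using g(3)[of 0 0] by simp
  have gsum: "g (sum f A) = (\<Sum>i\<in>A. g (f i))" for f and A :: "('a \<Rightarrow>\<^sub>0 nat) set"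
    by (induction A rule: infinite_finite_induct) (auto simp: g0 g(2))
  \<comment> \<open>The \<open>q\<close>-th root of a monomial of \<open>F\<close>.\<close>
  define r where "r m = Poly_Mapping.map (\<lambda>k. k div ?q) m" for m :: "'a \<Rightarrow>\<^sub>0 nat"
  have lookup_r: "Poly_Mapping.lookup (r m) z = Poly_Mapping.lookup m z div ?q" for m z
    by (auto simp: r_def Poly_Mapping.map.rep_eq when_def)
  have root: "Poly_Mapping.lookup (r m) z * ?q = Poly_Mapping.lookup m z"
    if "m \<in> Poly_Mapping.keys F" for m z
    using dvd[OF that, of z] by (simp add: lookup_r)
  have inj: "r m = r m' \<longleftrightarrow> m = m'" if "m \<in> Poly_Mapping.keys F" "m' \<in> Poly_Mapping.keys F" for m m'
    using root[OF that(1)] root[OF that(2)] by (metis poly_mapping_eqI)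
  have keys_r: "Poly_Mapping.keys (r m) = Poly_Mapping.keys m" if "m \<in> Poly_Mapping.keys F" for m
  proof (rule Set.set_eqI)
    fix z
    show "z \<in> Poly_Mapping.keys (r m) \<longleftrightarrow> z \<in> Poly_Mapping.keys m"
      using root[OF that, of z] \<open>?q > 0\<close> by (metis in_keys_iff mult_is_0 neq0_conv)
  qed
  define G where "G = (\<Sum>m\<in>Poly_Mapping.keys F. Poly_Mapping.single (r m) (g (Poly_Mapping.lookup F m)))"
  have "Poly_Mapping.lookup G (r m0) = (\<Sum>m\<in>Poly_Mapping.keys F. if m = m0 then g (Poly_Mapping.lookup F m) else 0)"
    unfolding G_def lookup_sum by (intro sum.cong) (auto simp: lookup_single when_def inj m0(1))
  then have "Poly_Mapping.lookup G (r m0) = 1"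
    using m0(1) g(1) by simp
  then have G0: "G \<noteq> 0"
    by auto
  have keysG: "Poly_Mapping.keys G \<subseteq> r ` Poly_Mapping.keys F"
    unfolding G_def by (rule order_trans[OF keys_sum]) auto
  have GY: "G \<in> polys Y"
    using keysG F(2) keys_r by (fastforce simp: polys_def)
  have mdeg_r: "mdeg (r m) * ?q = mdeg m" if "m \<in> Poly_Mapping.keys F" for m
    unfolding mdeg_def keys_r[OF that] sum_distrib_right root[OF that] ..
  have "?q \<ge> 2"
    using q by (rule prime_ge_2_nat)
  show False
  proof (cases "G \<in> P")
    case True
    have "R (n div ?q)"
      unfolding R_def
    proof (intro bexI conjI ballI)
      fix k assume "k \<in> Poly_Mapping.keys G"
      then obtain m where "m \<in> Poly_Mapping.keys F" "k = r m"
        using keysG by auto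
      then show "mdeg k \<le> n div ?q"
        using mdeg_r[of m] deg[of m] \<open>?q > 0\<close> by (simp add: less_eq_div_iff_mult_less_eq)
    qed (use True GY G0 in auto)
    then have "n \<le> n div ?q"
      by (rule least)
    moreover have "mdeg m0 \<ge> 1"
      using z0 by (metis add_is_0 finite_keys in_keys_iff less_one linorder_not_less mdeg_def sum_eq_0_iff)
    then have "n \<ge> 1"
      using deg[OF m0(1)] by simp
    ultimately show False
      using \<open>?q \<ge> 2\<close> by (metis Suc_1 Suc_le_lessD div_less_dividend less_eq_Suc_le linorder_not_less One_nat_def)
  next
    case False
    then obtain \<phi> where phi: "poly_eval \<phi> G \<noteq> 0" "poly_eval \<phi> F = 0"
      using dense[of G "{F}"] F(1) by auto
    have pow: "monom_eval \<phi> m = monom_eval \<phi> (r m) ^ ?q" if "m \<in> Poly_Mapping.keys F" for m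
      unfolding monom_eval_def keys_r[OF that] prod_power_distrib
      by (simp add: root[OF that] flip: power_mult)
    interpret E: ring_map "poly_eval \<phi>"
      by (rule ring_map_poly_eval)
    have "poly_eval \<phi> G = (\<Sum>m\<in>Poly_Mapping.keys F. g (Poly_Mapping.lookup F m) * monom_eval \<phi> (r m))"
      unfolding G_def E.map_sum by (simp add: poly_eval_eq_eval_hom eval_hom_single[OF ring_map_id])
    also have "\<dots> = (\<Sum>m\<in>Poly_Mapping.keys F. g (Poly_Mapping.lookup F m * monom_eval \<phi> m))"
      using g(3) by (intro sum.cong) (simp_all add: pow mult.commute)
    also have "\<dots> = g (poly_eval \<phi> F)"
      by (simp add: gsum poly_eval_eq_eval_hom eval_hom_def)
    finally show False
      using phi g0 by simp
  qed
qed

section \<open>Polynomials of high order and Newton iteration\<close>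

text \<open>
  The power \<open>N\<close> of the ideal of the polynomials without constant term. Working modulo this power
  replaces formal power series.
\<close>

definition ord_ideal :: "nat \<Rightarrow> ('a, 'k::field) mpoly set" where
  "ord_ideal N = {p. \<forall>m\<in>Poly_Mapping.keys p. N \<le> mdeg m}"

lemma ord_ideal_0 [simp]: "0 \<in> ord_ideal N"
  by (simp add: ord_ideal_def)

lemma ord_ideal_zero [simp]: "p \<in> ord_ideal 0"
  by (simp add: ord_ideal_def)

lemma ord_ideal_mono: "M \<le> N \<Longrightarrow> p \<in> ord_ideal N \<Longrightarrow> p \<in> ord_ideal M"
  by (auto simp: ord_ideal_def)

lemma ord_ideal_add: "p \<in> ord_ideal N \<Longrightarrow> q \<in> ord_ideal N \<Longrightarrow> p + q \<in> ord_ideal N"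
  using Poly_Mapping.keys_add[of p q] by (fastforce simp: ord_ideal_def)

lemma ord_ideal_uminus: "p \<in> ord_ideal N \<Longrightarrow> - p \<in> ord_ideal N"
  by (auto simp: ord_ideal_def in_keys_iff)

lemma ord_ideal_diff: "p \<in> ord_ideal N \<Longrightarrow> q \<in> ord_ideal N \<Longrightarrow> p - q \<in> ord_ideal N"
  using ord_ideal_add[of p N "- q"] ord_ideal_uminus[of q N] by simp

lemma ord_ideal_sum: "(\<And>i. i \<in> A \<Longrightarrow> f i \<in> ord_ideal N) \<Longrightarrow> sum f A \<in> ord_ideal N"
  by (induction A rule: infinite_finite_induct) (auto intro: ord_ideal_add)

lemma ord_ideal_times:
  assumes "p \<in> ord_ideal M" "q \<in> ord_ideal N"
  shows "p * q \<in> ord_ideal (M + N)"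
proof -
  have "M + N \<le> mdeg m" if m: "m \<in> Poly_Mapping.keys (p * q)" for m
  proof -
    obtain a b where "m = a + b" "a \<in> Poly_Mapping.keys p" "b \<in> Poly_Mapping.keys q"
      using m keys_mult[of p q] by blast
    then show ?thesis
      using assms by (auto simp: ord_ideal_def mdeg_add add_mono)
  qed
  then show ?thesis
    by (auto simp: ord_ideal_def)
qed

lemma ord_ideal_mult: "p \<in> ord_ideal N \<Longrightarrow> r * p \<in> ord_ideal N"
  using ord_ideal_times[of r 0 p N] by simp

lemma ord_ideal_mult': "p \<in> ord_ideal N \<Longrightarrow> p * r \<in> ord_ideal N"
  using ord_ideal_mult[of p N r] by (simp add: mult.commute)

lemma ord_ideal_Var: "Var b \<in> ord_ideal 1"
  by (simp add: ord_ideal_def Var_def mdeg_single)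

abbreviation at0 :: "('a, 'k::field) mpoly \<Rightarrow> 'k" where
  "at0 \<equiv> poly_eval (\<lambda>_. 0)"

lemma at0_eq_lookup: "at0 (p :: ('a, 'b::field) mpoly) = Poly_Mapping.lookup p 0"
proof -
  have eq: "(\<Prod>b\<in>Poly_Mapping.keys m. (0 :: 'b) ^ Poly_Mapping.lookup m b) = (if m = 0 then 1 else 0)"
    for m :: "'a \<Rightarrow>\<^sub>0 nat"
  proof (cases "m = 0")
    case False
    then obtain b where "b \<in> Poly_Mapping.keys m"
      by (metis equals0I keys_eq_empty)
    then show ?thesis
      using False by (auto simp: prod_zero_iff in_keys_iff intro!: bexI[of _ b])
  qed simp
  show ?thesis
    unfolding poly_eval_def eq by (simp add: in_keys_iff if_distrib cong: if_cong)
qed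

lemma at0_const: "at0 (const_poly c) = c"
  by (simp add: at0_eq_lookup const_poly_def)

lemma mem_ord_ideal_1_iff: "p \<in> ord_ideal 1 \<longleftrightarrow> at0 p = 0"
proof -
  have "(1 \<le> mdeg m) \<longleftrightarrow> m \<noteq> 0" for m :: "'a \<Rightarrow>\<^sub>0 nat"
    by (auto simp: mdeg_def Suc_le_eq in_keys_iff simp flip: keys_eq_empty)
  then show ?thesis
    by (auto simp: ord_ideal_def at0_eq_lookup in_keys_iff)
qed

lemma at0_add: "at0 (p + q) = at0 p + at0 q"
  by (rule ring_map.map_add[OF ring_map_poly_eval])

lemma at0_mult: "at0 (p * q) = at0 p * at0 q"
  by (rule ring_map.map_mult[OF ring_map_poly_eval])

lemma at0_diff: "at0 (p - q) = at0 p - at0 q"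
  by (rule ring_map.map_diff[OF ring_map_poly_eval])

lemma poly_eval_const: "poly_eval \<phi> (const_poly c) = c"
  by (simp add: poly_eval_eq_eval_hom eval_hom_const[OF ring_map_id])

lemma poly_eval_Var: "poly_eval \<phi> (Var b) = \<phi> b"
  by (simp add: poly_eval_eq_eval_hom eval_hom_Var[OF ring_map_id])

abbreviation subst :: "('a \<Rightarrow> ('b, 'k) mpoly) \<Rightarrow> ('a, 'k::field) mpoly \<Rightarrow> ('b, 'k) mpoly" where
  "subst \<equiv> eval_hom const_poly"

lemmas ring_map_subst = ring_map_eval_hom[OF ring_map_const]

lemma subst_0 [simp]: "subst \<sigma> 0 = 0"
  by (rule ring_map.map_zero[OF ring_map_subst])

lemma subst_1 [simp]: "subst \<sigma> 1 = 1"
  by (rule ring_map.map_one[OF ring_map_subst])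

lemma poly_eval_subst: "poly_eval \<psi> (subst \<sigma> p) = poly_eval (\<lambda>b. poly_eval \<psi> (\<sigma> b)) p"
proof (rule ring_map_eqI)
  show "ring_map (\<lambda>p. poly_eval \<psi> (subst \<sigma> p))"
    by (rule ring_map_comp[OF ring_map_poly_eval ring_map_subst])
qed (simp_all add: ring_map_poly_eval eval_hom_const[OF ring_map_const] eval_hom_Var[OF ring_map_const]
  poly_eval_const poly_eval_Var)

text \<open>
  If \<open>p e - 1 = r\<close>, then \<open>p (e - e r) - 1 = - r\<^sup>2\<close>.
\<close>

lemma ex_inverse_mod_ord_ideal:
  assumes "at0 p \<noteq> 0"
  shows "\<exists>e. p * e - 1 \<in> ord_ideal N"
proof (induction N)
  case (Suc N)
  show ?case
  proof (cases "N = 0")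
    case True
    then have "p * const_poly (inverse (at0 p)) - 1 \<in> ord_ideal (Suc N)"
      using assms mem_ord_ideal_1_iff[of "p * const_poly (inverse (at0 p)) - 1"] at0_const[of 1]
      by (simp add: at0_diff at0_mult at0_const)
    then show ?thesis ..
  next
    case False
    obtain e where e: "p * e - 1 \<in> ord_ideal N"
      using Suc by blast
    have "p * (e - e * (p * e - 1)) - 1 = - ((p * e - 1) * (p * e - 1))"
      by (simp add: algebra_simps)
    also have "\<dots> \<in> ord_ideal (Suc N)"
      using ord_ideal_times[OF e e] False by (intro ord_ideal_uminus) (rule ord_ideal_mono, auto)
    finally show ?thesis
      by blast
  qed
qed simp

lemma ord_ideal_cancel:
  assumes "at0 p \<noteq> 0" "p * a \<in> ord_ideal N"
  shows "a \<in> ord_ideal N"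
proof -
  obtain e where e: "p * e - 1 \<in> ord_ideal N"
    using ex_inverse_mod_ord_ideal[OF assms(1)] by blast
  have "e * (p * a) - a * (p * e - 1) \<in> ord_ideal N"
    by (intro ord_ideal_diff ord_ideal_mult assms(2) e)
  then show ?thesis
    by (simp add: algebra_simps)
qed

lemma subst_taylor:
  assumes "\<sigma>' = \<sigma>(z := \<sigma> z + b)"
  shows "\<exists>r. subst \<sigma>' p
     = subst \<sigma> p + b * subst \<sigma> (partial_deriv z p) + b * b * r"
proof -
  interpret s: ring_map "subst \<sigma>'" by (rule ring_map_subst)
  interpret t: ring_map "subst \<sigma>" by (rule ring_map_subst)
  have "p \<in> polys UNIV"
    by simp
  then show ?thesis
  proof (induction rule: polys_induct)
    case (const c)
    show ?case
      by (rule exI[of _ 0]) (simp add: eval_hom_const[OF ring_map_const] partial_deriv_const)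
  next
    case (var w)
    show ?case
      by (rule exI[of _ 0])
         (simp add: assms eval_hom_Var[OF ring_map_const] partial_deriv_Var)
  next
    case (add p q)
    then obtain r r' where "subst \<sigma>' p
        = subst \<sigma> p + b * subst \<sigma> (partial_deriv z p) + b * b * r"
      "subst \<sigma>' q
        = subst \<sigma> q + b * subst \<sigma> (partial_deriv z q) + b * b * r'"
      by blast
    then show ?case
      by (intro exI[of _ "r + r'"])
         (simp add: s.map_add t.map_add partial_deriv_add algebra_simps)
  next
    case (mult p q)
    let ?P = "subst \<sigma> p" and ?Q = "subst \<sigma> q"
    let ?P' = "subst \<sigma> (partial_deriv z p)" and ?Q' = "subst \<sigma> (partial_deriv z q)"
    from mult obtain r r' where
      "subst \<sigma>' p = ?P + b * ?P' + b * b * r"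
      "subst \<sigma>' q = ?Q + b * ?Q' + b * b * r'"
      by blast
    then show ?case
      by (intro exI[of _ "?P' * ?Q' + (?P + b * ?P') * r' + r * (?Q + b * ?Q' + b * b * r')"])
         (simp add: s.map_mult t.map_mult t.map_add partial_deriv_mult algebra_simps)
  qed
qed

text \<open>
  Newton iteration for \<open>G\<close> as a function of the variable \<open>z\<close>. It is enough to divide by the constant
  term of the derivative: each step gains one order.
\<close>

lemma ex_root_mod_ord_ideal:
  fixes \<sigma> :: "'a \<Rightarrow> ('b, 'k::field) mpoly"
  assumes root: "at0 (subst (\<sigma>(z := a0)) G) = 0"
    and simple: "at0 (subst (\<sigma>(z := a0)) (partial_deriv z G)) \<noteq> 0"
  shows "\<exists>a. a - a0 \<in> ord_ideal 1 \<and> subst (\<sigma>(z := a)) G \<in> ord_ideal N"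
proof (induction N)
  case 0
  show ?case
    by (intro exI[of _ a0]) simp
next
  case (Suc N)
  show ?case
  proof (cases "N = 0")
    case True
    then show ?thesis
      using root mem_ord_ideal_1_iff[of "subst (\<sigma>(z := a0)) G"]
      by (intro exI[of _ a0]) (simp add: fun_upd_def)
  next
    case False
    obtain a where a: "a - a0 \<in> ord_ideal 1" "subst (\<sigma>(z := a)) G \<in> ord_ideal N"
      using Suc by blast
    let ?f = "subst (\<sigma>(z := a)) G"
    let ?d = "subst (\<sigma>(z := a)) (partial_deriv z G)"
    define \<mu> where "\<mu> = at0 ?d"
    have "at0 a = at0 a0"
      using a(1) by (simp add: mem_ord_ideal_1_iff[unfolded One_nat_def] at0_diff)
    then have "(\<lambda>b. at0 ((\<sigma>(z := a)) b)) = (\<lambda>b. at0 ((\<sigma>(z := a0)) b))"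
      by auto
    then have "\<mu> \<noteq> 0"
      using simple unfolding \<mu>_def poly_eval_subst by metis
    define b where "b = - (const_poly (inverse \<mu>) * ?f)"
    have b: "b \<in> ord_ideal N"
      unfolding b_def by (intro ord_ideal_uminus ord_ideal_mult a)
    obtain r where r: "subst (\<sigma>(z := a + b)) G = ?f + b * ?d + b * b * r"
      using subst_taylor[of "\<sigma>(z := a + b)" "\<sigma>(z := a)" z b G] by auto
    have "at0 (1 - const_poly (inverse \<mu>) * ?d) = 0"
      using \<open>\<mu> \<noteq> 0\<close> at0_const[of 1] by (simp add: at0_diff at0_mult at0_const flip: \<mu>_def)
    then have "1 - const_poly (inverse \<mu>) * ?d \<in> ord_ideal 1"
      by (simp only: mem_ord_ideal_1_iff)
    then have "?f * (1 - const_poly (inverse \<mu>) * ?d) \<in> ord_ideal (Suc N)"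
      using ord_ideal_times[OF a(2)] by fastforce
    moreover have "b * b \<in> ord_ideal (Suc N)"
      using ord_ideal_times[OF b b] False by (rule_tac ord_ideal_mono) auto
    ultimately have "?f * (1 - const_poly (inverse \<mu>) * ?d) + b * b * r \<in> ord_ideal (Suc N)"
      using ord_ideal_add ord_ideal_mult' by blast
    also have "?f * (1 - const_poly (inverse \<mu>) * ?d) + b * b * r = subst (\<sigma>(z := a + b)) G"
      unfolding r by (simp add: b_def algebra_simps)
    finally have "subst (\<sigma>(z := a + b)) G \<in> ord_ideal (Suc N)" .
    moreover have "b \<in> ord_ideal 1"
      using False by (intro ord_ideal_mono[OF _ b]) auto
    then have "(a - a0) + b \<in> ord_ideal 1"
      by (intro ord_ideal_add a(1))
    then have "(a + b) - a0 \<in> ord_ideal 1"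
      by (simp add: algebra_simps)
    ultimately show ?thesis
      by blast
  qed
qed

section \<open>Formal arcs through a generic point\<close>

lemma (in prime_mpoly) cl_trans_finite:
  assumes "finite D" "z \<in> cl (A \<union> D)" "D \<subseteq> cl A"
  shows "z \<in> cl A"
  using assms
proof (induction D arbitrary: z)
  case (insert d D)
  have "d \<in> cl (A \<union> D)"
    using insert.prems(2) cl_mono[of A "A \<union> D"] by auto
  then have "z \<in> cl (A \<union> D)"
    using cl_trans[of z d "A \<union> D"] insert.prems(1) by simp
  then show ?case
    using insert by simp
qed simp

text \<open>
  An arc through \<open>\<phi>\<close> in the zero set of the elements of \<open>P\<close> in the variables \<open>Y\<close>, up to order \<open>N\<close>. The
  deviations \<open>\<delta>\<close> from the starting point are prescribed on \<open>A\<close>.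
\<close>

definition (in prime_mpoly) is_arc ::
    "'a set \<Rightarrow> 'a set \<Rightarrow> ('a \<Rightarrow> 'k) \<Rightarrow> ('a \<Rightarrow> ('b, 'k) mpoly) \<Rightarrow> nat \<Rightarrow> ('a \<Rightarrow> ('b, 'k) mpoly) \<Rightarrow> bool" where
  "is_arc Y A \<phi> \<delta> N \<sigma> \<longleftrightarrow> (\<forall>z. \<sigma> z - const_poly (\<phi> z) \<in> ord_ideal 1) \<and>
     (\<forall>z\<in>A. \<sigma> z = const_poly (\<phi> z) + \<delta> z) \<and> (\<forall>h\<in>P \<inter> polys Y. subst \<sigma> h \<in> ord_ideal N)"

text \<open>
  The variables in \<open>J\<close> are algebraic over the others through separable relations. Near a generic point
  \<open>\<phi>\<close> these relations can be solved by Newton iteration for the variables in \<open>J\<close>, with arbitrary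
  values \<open>\<phi> z + \<delta> z\<close> of the others, and the other elements of \<open>P\<close> vanish on the solution because
  pseudo-division by the relations leaves no remainder modulo \<open>P\<close>.
\<close>

lemma (in dense_prime) ex_arc:
  assumes "finite Y"
  shows "\<exists>J\<subseteq>Y. Y \<subseteq> cl (Y - J) \<and> (\<exists>D F. D \<notin> P \<and> finite F \<and> F \<subseteq> P \<and>
    (\<forall>\<phi> (\<delta> :: 'a \<Rightarrow> ('b, 'k) mpoly) N. poly_eval \<phi> D \<noteq> 0 \<longrightarrow> (\<forall>p\<in>F. poly_eval \<phi> p = 0) \<longrightarrow>
       (\<forall>z. \<delta> z \<in> ord_ideal 1) \<longrightarrow>
       (\<exists>\<sigma>. is_arc Y (Y - J) \<phi> \<delta> N \<sigma>)))"
  using assms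
proof (induction "card Y" arbitrary: Y rule: less_induct)
  case less
  show ?case
  proof (cases "P \<inter> polys Y = {0}")
    case True
    have "\<exists>\<sigma>. is_arc Y Y \<phi> \<delta> N \<sigma>"
      if "\<forall>z. \<delta> z \<in> ord_ideal 1" for \<phi> and \<delta> :: "'a \<Rightarrow> ('b, 'k) mpoly" and N
      using that True
      by (intro exI[of _ "\<lambda>z. const_poly (\<phi> z) + \<delta> z"]) (auto simp: is_arc_def)
    then show ?thesis
      by (intro exI[of _ "{}"] conjI exI[of _ 1]) (auto simp: cl_def one_notin intro!: exI[of _ "{}"])
  next
    case False
    then obtain F0 where "F0 \<in> P" "F0 \<in> polys Y" "F0 \<noteq> 0"
      using zero_mem by auto
    from ex_separable_relation[OF this] obtain z F1 where z: "z \<in> Y"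
      and F1: "F1 \<in> P" "F1 \<in> polys Y" "partial_deriv z F1 \<notin> P"
      by blast
    define W where "W = Y - {z}"
    have zW: "z \<notin> W" and Y: "Y = insert z W" and "finite W" "card W < card Y"
      using z less.prems card_Diff1_less[OF less.prems z] by (auto simp: W_def)
    have ext: "extended z \<subseteq> P"
      by (rule extended_subset) simp
    have deriv_ext: "partial_deriv z a \<in> P" if "a \<in> extended z" for a
    proof -
      have "partial_deriv z (coeff (expand z a) i) = 0" for i
        by (rule partial_deriv_free[OF coeff_expand_polys[of a UNIV z i]]) auto
      then have "partial_deriv z (\<Sum>i\<le>degree (expand z a). coeff (expand z a) i * Var z ^ i)
          = (\<Sum>i\<le>degree (expand z a). coeff (expand z a) i * partial_deriv z (Var z ^ i))"
        by (simp add: partial_deriv_sum partial_deriv_mult)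
      also have "\<dots> \<in> P"
        using that by (intro sum_mem mult_mem') (auto simp: mem_extended)
      finally show ?thesis
        by (simp only: sum_coeffs_expand)
    qed
    have dep: "dep W z"
      using F1 deriv_ext by (auto simp: dep_def Y)
    obtain G n where G: "G \<in> P" "G \<in> polys (insert z W)" "pdeg P (expand z G) n"
      and least: "\<And>a k. a \<in> P \<inter> polys (insert z W) \<Longrightarrow> pdeg P (expand z a) k \<Longrightarrow> n \<le> k"
      using ex_least_relation[OF dep] by blast
    define g where "g = coeff (expand z G) n"
    have g: "g \<in> polys W" "g \<notin> P"
      using G coeff_expand_insert[OF zW] by (auto simp: g_def pdeg_def)
    have WY: "polys W \<subseteq> polys (insert z W)"
      by (rule polys_mono) auto
    have comb: "g * a - c * Var z ^ k * G \<in> P \<inter> polys (insert z W)"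
      if a: "a \<in> P \<inter> polys (insert z W)" and c: "c \<in> polys W" for a c k
    proof
      show "g * a - c * Var z ^ k * G \<in> P"
        using a mult_mem[of g a] mult_mem[OF _ G(1), of "c * Var z ^ k"] by (auto intro: diff_mem)
      have "g \<in> polys (insert z W)" "c \<in> polys (insert z W)" "a \<in> polys (insert z W)"
        using a c g(1) WY by auto
      then show "g * a - c * Var z ^ k * G \<in> polys (insert z W)"
        using G(2) by simp
    qed
    have GA: "G \<in> P \<inter> polys (insert z W)" and sub: "P \<inter> polys (insert z W) \<subseteq> polys (insert z W)"
      using G by auto
    \<comment> \<open>Pseudo-division by \<open>G\<close> preserves derivatives in \<open>P\<close>, so that \<open>G\<close> is as separable as \<open>F1\<close>.\<close>
    have sep: "partial_deriv z G \<notin> P"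
    proof
      assume dG: "partial_deriv z G \<in> P"
      have "partial_deriv z F1 \<in> P"
      proof (rule least_degree_induct[where Q = "\<lambda>a. partial_deriv z a \<in> P", OF zW sub _ GA G(3) least])
        show "F1 \<in> P \<inter> polys (insert z W)"
          using F1 Y by simp
        show "coeff (expand z G) n * a - c * Var z ^ k * G \<in> P \<inter> polys (insert z W)"
          if "a \<in> P \<inter> polys (insert z W)" "c \<in> polys W" for a c k
          using comb[OF that] by (simp add: g_def)
        show "partial_deriv z a \<in> P" if "a \<in> extended z" for a
          by (rule deriv_ext[OF that])
        show "partial_deriv z a \<in> P"
          if c: "c \<in> polys W"
            and step: "partial_deriv z (coeff (expand z G) n * a - c * Var z ^ k * G) \<in> P" for a c k
        proof -
          let ?r = "c * (Var z ^ k * partial_deriv z G + partial_deriv z (Var z ^ k) * G)"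
          have "partial_deriv z (g * a - c * Var z ^ k * G) = g * partial_deriv z a - ?r"
            using partial_deriv_free[OF g(1) zW] partial_deriv_free[OF c zW]
            by (simp add: partial_deriv_diff partial_deriv_mult algebra_simps)
          moreover have "?r \<in> P"
            by (intro mult_mem add_mem dG G(1)) auto
          ultimately have "g * partial_deriv z a \<in> P"
            using step diff_memD[of "g * partial_deriv z a" ?r] by (simp add: g_def)
          then show ?thesis
            using prime[of g] g(2) by auto
        qed
      qed
      then show False
        using F1(3) by contradiction
    qed
    obtain J D F where J: "J \<subseteq> W" "W \<subseteq> cl (W - J)" and D: "D \<notin> P" "finite F" "F \<subseteq> P"
      and lift: "\<And>\<phi> (\<delta> :: 'a \<Rightarrow> ('b, 'k) mpoly) N. poly_eval \<phi> D \<noteq> 0 \<Longrightarrow> (\<forall>p\<in>F. poly_eval \<phi> p = 0) \<Longrightarrow>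
         (\<forall>z. \<delta> z \<in> ord_ideal 1) \<Longrightarrow>
         \<exists>\<sigma>. is_arc W (W - J) \<phi> \<delta> N \<sigma>"
      using less.hyps[OF \<open>card W < card Y\<close> \<open>finite W\<close>] by blast
    have YJ: "Y - insert z J = W - J"
      by (auto simp: W_def)
    show ?thesis
    proof (rule exI[of _ "insert z J"], intro conjI)
      show "insert z J \<subseteq> Y"
        using J Y by auto
      have "z \<in> cl (W - J)"
        by (rule cl_trans_finite[OF \<open>finite W\<close> _ J(2)])
           (use dep cl_mono[of W "W - J \<union> W"] in \<open>auto simp: cl_def\<close>)
      then show "Y \<subseteq> cl (Y - insert z J)"
        unfolding YJ using Y J(2) by auto
      show "\<exists>D F. D \<notin> P \<and> finite F \<and> F \<subseteq> P \<and>
        (\<forall>\<phi> (\<delta> :: 'a \<Rightarrow> ('b, 'k) mpoly) N. poly_eval \<phi> D \<noteq> 0 \<longrightarrow> (\<forall>p\<in>F. poly_eval \<phi> p = 0) \<longrightarrow>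
           (\<forall>z. \<delta> z \<in> ord_ideal 1) \<longrightarrow>
           (\<exists>\<sigma>. is_arc Y (Y - insert z J) \<phi> \<delta> N \<sigma>))"
      proof (rule exI[of _ "D * (g * partial_deriv z G)"], rule exI[of _ "insert G F"],
          intro conjI allI impI)
        show "D * (g * partial_deriv z G) \<notin> P"
          using prime[of D "g * partial_deriv z G"] prime[of g "partial_deriv z G"] D g sep by auto
        show "finite (insert G F)" "insert G F \<subseteq> P"
          using D G by auto
        fix \<phi> and \<delta> :: "'a \<Rightarrow> ('b, 'k) mpoly" and N
        assume "poly_eval \<phi> (D * (g * partial_deriv z G)) \<noteq> 0"
          and F: "\<forall>p\<in>insert G F. poly_eval \<phi> p = 0" and \<delta>: "\<forall>z. \<delta> z \<in> ord_ideal 1"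
        then have nz: "poly_eval \<phi> D \<noteq> 0" "poly_eval \<phi> g \<noteq> 0" "poly_eval \<phi> (partial_deriv z G) \<noteq> 0"
          by (auto simp: ring_map.map_mult[OF ring_map_poly_eval])
        obtain \<sigma> where \<sigma>: "\<forall>z. \<sigma> z - const_poly (\<phi> z) \<in> ord_ideal 1"
          "\<forall>z\<in>W - J. \<sigma> z = const_poly (\<phi> z) + \<delta> z"
          "\<forall>h\<in>P \<inter> polys W. subst \<sigma> h \<in> ord_ideal N"
          using lift[OF nz(1) _ \<delta>] F unfolding is_arc_def by blast
        have at0: "at0 (subst \<tau> p) = poly_eval \<phi> p"
          if "\<forall>z. \<tau> z - const_poly (\<phi> z) \<in> ord_ideal 1" for \<tau> :: "'a \<Rightarrow> ('b, 'k) mpoly" and p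
        proof -
          have "at0 (\<tau> b) = \<phi> b" for b
            using that by (simp add: mem_ord_ideal_1_iff at0_diff at0_const del: One_nat_def)
          then show ?thesis
            by (simp add: poly_eval_subst)
        qed
        have start: "\<forall>w. (\<sigma>(z := const_poly (\<phi> z))) w - const_poly (\<phi> w) \<in> ord_ideal 1"
          using \<sigma>(1) by simp
        have r1: "at0 (subst (\<sigma>(z := const_poly (\<phi> z))) G) = 0"
          using at0[OF start] F by (simp add: fun_upd_def)
        have r2: "at0 (subst (\<sigma>(z := const_poly (\<phi> z))) (partial_deriv z G)) \<noteq> 0"
          using at0[OF start] nz by (simp add: fun_upd_def)
        obtain a where a: "a - const_poly (\<phi> z) \<in> ord_ideal 1"
          "subst (\<sigma>(z := a)) G \<in> ord_ideal N"
          using ex_root_mod_ord_ideal[OF r1 r2] by blast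
        let ?\<tau> = "\<sigma>(z := a)"
        interpret t: ring_map "subst ?\<tau>" by (rule ring_map_subst)
        have \<tau>1: "\<forall>w. ?\<tau> w - const_poly (\<phi> w) \<in> ord_ideal 1"
          using \<sigma>(1) a(1) by simp
        have "subst ?\<tau> h \<in> ord_ideal N" if "h \<in> P \<inter> polys (insert z W)" for h
        proof (rule least_degree_induct[where Q = "\<lambda>b. subst ?\<tau> b \<in> ord_ideal N", OF zW sub that GA G(3) least])
          show "coeff (expand z G) n * b - c * Var z ^ k * G \<in> P \<inter> polys (insert z W)"
            if "b \<in> P \<inter> polys (insert z W)" "c \<in> polys W" for b c k
            using comb[OF that] by (simp add: g_def)
          show "subst ?\<tau> b \<in> ord_ideal N"
            if b: "b \<in> P \<inter> polys (insert z W)" "b \<in> extended z" for b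
          proof -
            have c: "coeff (expand z b) i \<in> P \<inter> polys W" for i
              using b coeff_expand_insert[OF zW] by (auto simp: mem_extended)
            have "subst ?\<tau> (coeff (expand z b) i) = subst \<sigma> (coeff (expand z b) i)" for i
              by (rule eval_hom_cong[of _ W]) (use c zW in auto)
            then have "subst ?\<tau> (coeff (expand z b) i) \<in> ord_ideal N" for i
              using \<sigma>(3) c by simp
            then have "subst ?\<tau> (\<Sum>i\<le>degree (expand z b). coeff (expand z b) i * Var z ^ i) \<in> ord_ideal N"
              unfolding t.map_sum t.map_mult by (intro ord_ideal_sum ord_ideal_mult')
            then show ?thesis
              by (simp only: sum_coeffs_expand)
          qed
          show "subst ?\<tau> b \<in> ord_ideal N"
            if step: "subst ?\<tau> (coeff (expand z G) n * b - c * Var z ^ k * G) \<in> ord_ideal N" for b c k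
          proof -
            have "subst ?\<tau> g * subst ?\<tau> b = subst ?\<tau> (g * b - c * Var z ^ k * G)
                + subst ?\<tau> (c * Var z ^ k) * subst ?\<tau> G"
              by (simp add: t.map_mult t.map_diff)
            also have "\<dots> \<in> ord_ideal N"
              using step a(2) unfolding g_def by (intro ord_ideal_add ord_ideal_mult)
            finally show ?thesis
              by (rule ord_ideal_cancel[rotated]) (use at0[OF \<tau>1] nz(2) in \<open>simp add: fun_upd_def\<close>)
          qed
        qed
        moreover have "\<forall>w\<in>Y - insert z J. ?\<tau> w = const_poly (\<phi> w) + \<delta> w"
          using \<sigma>(2) YJ zW by auto
        ultimately show "\<exists>\<sigma>. is_arc Y (Y - insert z J) \<phi> \<delta> N \<sigma>"
          using \<tau>1 unfolding Y is_arc_def by blast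
      qed
    qed
  qed
qed

definition (in prime_mpoly) is_linear_arc :: "'a set \<Rightarrow> ('a \<Rightarrow> ('b, 'k) mpoly) \<Rightarrow> ('c \<Rightarrow> 'a) \<Rightarrow>
    'c set \<Rightarrow> 'c set \<Rightarrow> ('c \<Rightarrow> ('b, 'k) mpoly) \<Rightarrow> nat \<Rightarrow> ('c \<Rightarrow> ('b, 'k) mpoly) \<Rightarrow> bool" where
  "is_linear_arc Y \<sigma> \<eta> B A \<delta> N u \<longleftrightarrow> (\<forall>b. u b \<in> ord_ideal 1) \<and> (\<forall>b\<in>A. u b = \<delta> b) \<and>
     (\<forall>l. (\<forall>b\<in>B. l b \<in> polys Y) \<longrightarrow> (\<Sum>b\<in>B. l b * Var (\<eta> b)) \<in> P \<longrightarrow>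
        (\<Sum>b\<in>B. subst \<sigma> (l b) * u b) \<in> ord_ideal N)"

text \<open>
  The counterpart for the equations in \<open>P\<close> that are linear in the variables \<open>\<eta> b\<close>, with coefficients in
  the variables \<open>Y\<close> of an arc that is already known. This is Gaussian elimination modulo \<open>P\<close>: \<open>z\<close> goes
  to \<open>J\<close> if some equation in the variables up to \<open>z\<close> has a coefficient of \<open>z\<close> outside \<open>P\<close>, and this
  coefficient, which does not vanish at a general point, is the pivot.

  Treating these equations apart from those on \<open>Y\<close> makes it possible to start from \<open>u = 0\<close>, which
  lies in the kernel of the Hessian at every point; \<open>u\<close> then has no constant term.
\<close>

lemma (in prime_mpoly) ex_linear_arc:
  fixes \<eta> :: "'c \<Rightarrow> 'a"
  assumes "finite B" "finite Y" "inj_on \<eta> B" "\<eta> ` B \<inter> Y = {}"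
  shows "\<exists>J\<subseteq>B. \<eta> ` B \<subseteq> cl (Y \<union> \<eta> ` (B - J)) \<and> (\<exists>D\<in>polys Y. D \<notin> P \<and>
    (\<forall>(\<sigma> :: 'a \<Rightarrow> ('b, 'k) mpoly) \<delta> N. (\<forall>h\<in>P \<inter> polys Y. subst \<sigma> h \<in> ord_ideal N) \<longrightarrow>
       at0 (subst \<sigma> D) \<noteq> 0 \<longrightarrow> (\<forall>b. \<delta> b \<in> ord_ideal 1) \<longrightarrow>
       (\<exists>u. is_linear_arc Y \<sigma> \<eta> B (B - J) \<delta> N u)))"
  using assms
proof (induction B)
  case empty
  show ?case
    by (auto intro!: bexI[of _ 1] simp: one_notin is_linear_arc_def)
next
  case (insert z B)
  obtain J D where J: "J \<subseteq> B" "\<eta> ` B \<subseteq> cl (Y \<union> \<eta> ` (B - J))" and D: "D \<in> polys Y" "D \<notin> P"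
    and lift: "\<And>(\<sigma> :: 'a \<Rightarrow> ('b, 'k) mpoly) \<delta> N. (\<forall>h\<in>P \<inter> polys Y. subst \<sigma> h \<in> ord_ideal N) \<Longrightarrow>
       at0 (subst \<sigma> D) \<noteq> 0 \<Longrightarrow> (\<forall>b. \<delta> b \<in> ord_ideal 1) \<Longrightarrow>
       (\<exists>u. is_linear_arc Y \<sigma> \<eta> B (B - J) \<delta> N u)"
    using insert.IH insert.prems by auto
  have zJ: "z \<notin> J"
    using insert.hyps J by auto
  show ?case
  proof (cases "\<exists>l. (\<forall>b\<in>insert z B. l b \<in> polys Y) \<and> (\<Sum>b\<in>insert z B. l b * Var (\<eta> b)) \<in> P \<and> l z \<notin> P")
    case False
    show ?thesis
    proof (rule exI[of _ J], intro conjI)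
      have "cl (Y \<union> \<eta> ` (B - J)) \<subseteq> cl (Y \<union> \<eta> ` (insert z B - J))"
        by (rule cl_mono) auto
      moreover have "\<eta> z \<in> cl (Y \<union> \<eta> ` (insert z B - J))"
        using zJ by (auto simp: cl_def)
      ultimately show "\<eta> ` insert z B \<subseteq> cl (Y \<union> \<eta> ` (insert z B - J))"
        using J by auto
      show "\<exists>D\<in>polys Y. D \<notin> P \<and>
        (\<forall>(\<sigma> :: 'a \<Rightarrow> ('b, 'k) mpoly) \<delta> N. (\<forall>h\<in>P \<inter> polys Y. subst \<sigma> h \<in> ord_ideal N) \<longrightarrow>
           at0 (subst \<sigma> D) \<noteq> 0 \<longrightarrow> (\<forall>b. \<delta> b \<in> ord_ideal 1) \<longrightarrow>
           (\<exists>u. is_linear_arc Y \<sigma> \<eta> (insert z B) (insert z B - J) \<delta> N u))"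
      proof (rule bexI[OF _ D(1)], intro conjI allI impI)
        fix \<sigma> :: "'a \<Rightarrow> ('b, 'k) mpoly" and \<delta> :: "'c \<Rightarrow> ('b, 'k) mpoly" and N
        assume \<sigma>: "\<forall>h\<in>P \<inter> polys Y. subst \<sigma> h \<in> ord_ideal N" "at0 (subst \<sigma> D) \<noteq> 0"
          and \<delta>: "\<forall>b. \<delta> b \<in> ord_ideal 1"
        obtain u where u: "\<forall>b. u b \<in> ord_ideal 1" "\<forall>b\<in>B - J. u b = \<delta> b"
          and ul: "\<forall>l. (\<forall>b\<in>B. l b \<in> polys Y) \<longrightarrow> (\<Sum>b\<in>B. l b * Var (\<eta> b)) \<in> P \<longrightarrow>
               (\<Sum>b\<in>B. subst \<sigma> (l b) * u b) \<in> ord_ideal N"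
          using lift[OF \<sigma> \<delta>] unfolding is_linear_arc_def by blast
        let ?u = "u(z := \<delta> z)"
        have sum: "(\<Sum>b\<in>B. subst \<sigma> (l b) * ?u b) = (\<Sum>b\<in>B. subst \<sigma> (l b) * u b)" for l
          using insert.hyps(2) by (intro sum.cong) auto
        have "(\<Sum>b\<in>insert z B. subst \<sigma> (l b) * ?u b) \<in> ord_ideal N"
          if l: "\<forall>b\<in>insert z B. l b \<in> polys Y" "(\<Sum>b\<in>insert z B. l b * Var (\<eta> b)) \<in> P" for l
        proof -
          have lz: "l z \<in> P"
            using False l by blast
          then have "l z * Var (\<eta> z) \<in> P"
            by (rule mult_mem') simp
          then have "(\<Sum>b\<in>B. l b * Var (\<eta> b)) \<in> P"
            using l(2) insert.hyps diff_memD[of "\<Sum>b\<in>B. l b * Var (\<eta> b)" "- (l z * Var (\<eta> z))"]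
              uminus_mem by (simp add: add.commute)
          then have "(\<Sum>b\<in>B. subst \<sigma> (l b) * u b) \<in> ord_ideal N"
            using ul l(1) by auto
          moreover have "subst \<sigma> (l z) * \<delta> z \<in> ord_ideal N"
            using \<sigma>(1) lz l(1) by (intro ord_ideal_mult') auto
          ultimately show ?thesis
            using insert.hyps sum by (simp add: ord_ideal_add)
        qed
        then show "\<exists>u. is_linear_arc Y \<sigma> \<eta> (insert z B) (insert z B - J) \<delta> N u"
          using u \<delta> by (intro exI[of _ ?u]) (auto simp: is_linear_arc_def)
      qed (use D in auto)
    qed (use J in auto)
  next
    case True
    then obtain p where p: "\<And>b. b \<in> insert z B \<Longrightarrow> p b \<in> polys Y"
      "(\<Sum>b\<in>insert z B. p b * Var (\<eta> b)) \<in> P" "p z \<notin> P"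
      by blast
    have \<eta>z: "\<eta> z \<notin> Y \<union> \<eta> ` B"
      using insert.prems insert.hyps by (auto simp: inj_on_def)
    have "dep (Y \<union> \<eta> ` B) (\<eta> z)"
    proof -
      let ?F = "\<Sum>b\<in>insert z B. p b * Var (\<eta> b)"
      let ?R = "\<Sum>b\<in>B. p b * Var (\<eta> b)"
      interpret e: ring_map "expand (\<eta> z)" by (rule ring_map_expand)
      have pY: "p b \<in> polys (Y \<union> \<eta> ` B)" if "b \<in> insert z B" for b
        using p(1)[OF that] polys_mono[of Y "Y \<union> \<eta> ` B"] by blast
      have R: "?R \<in> polys (Y \<union> \<eta> ` B)"
        using pY by (intro polys_sum polys_mult) auto
      have "expand (\<eta> z) ?F = [:?R:] + [:p z:] * [:0, 1:]"
        using insert.hyps expand_free[OF R \<eta>z] expand_free[OF pY \<eta>z, of z]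
        by (simp add: e.map_add e.map_mult expand_Var)
      then have "coeff (expand (\<eta> z) ?F) 1 = p z"
        by simp
      then have "?F \<notin> extended (\<eta> z)"
        using p(3) unfolding mem_extended by metis
      moreover have "p b \<in> polys (insert (\<eta> z) (Y \<union> \<eta> ` B))" if "b \<in> insert z B" for b
        using p(1)[OF that] polys_mono[of Y "insert (\<eta> z) (Y \<union> \<eta> ` B)"] by blast
      then have "?F \<in> polys (insert (\<eta> z) (Y \<union> \<eta> ` B))"
        by (intro polys_sum polys_mult) auto
      ultimately show ?thesis
        unfolding dep_def using p(2) by blast
    qed
    then have "\<eta> z \<in> cl ((Y \<union> \<eta> ` (B - J)) \<union> \<eta> ` B)"
      using cl_mono[of "Y \<union> \<eta> ` B" "(Y \<union> \<eta> ` (B - J)) \<union> \<eta> ` B"] by (auto simp: cl_def)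
    then have zcl: "\<eta> z \<in> cl (Y \<union> \<eta> ` (B - J))"
      by (rule cl_trans_finite[rotated]) (use J insert.hyps in auto)
    have BJ: "insert z B - insert z J = B - J"
      using insert.hyps by auto
    show ?thesis
    proof (rule exI[of _ "insert z J"], intro conjI)
      show "\<eta> ` insert z B \<subseteq> cl (Y \<union> \<eta> ` (insert z B - insert z J))"
        unfolding BJ using J zcl by auto
      show "\<exists>D\<in>polys Y. D \<notin> P \<and>
        (\<forall>(\<sigma> :: 'a \<Rightarrow> ('b, 'k) mpoly) \<delta> N. (\<forall>h\<in>P \<inter> polys Y. subst \<sigma> h \<in> ord_ideal N) \<longrightarrow>
           at0 (subst \<sigma> D) \<noteq> 0 \<longrightarrow> (\<forall>b. \<delta> b \<in> ord_ideal 1) \<longrightarrow>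
           (\<exists>u. is_linear_arc Y \<sigma> \<eta> (insert z B) (insert z B - insert z J) \<delta> N u))"
      proof (rule bexI[of _ "D * p z"], intro conjI allI impI)
        show "D * p z \<in> polys Y"
          using D p(1) by simp
        show "D * p z \<notin> P"
          using D p(3) prime[of D "p z"] by auto
        fix \<sigma> :: "'a \<Rightarrow> ('b, 'k) mpoly" and \<delta> :: "'c \<Rightarrow> ('b, 'k) mpoly" and N
        interpret s: ring_map "subst \<sigma>" by (rule ring_map_subst)
        assume \<sigma>: "\<forall>h\<in>P \<inter> polys Y. subst \<sigma> h \<in> ord_ideal N" and nz: "at0 (subst \<sigma> (D * p z)) \<noteq> 0"
          and \<delta>: "\<forall>b. \<delta> b \<in> ord_ideal 1"
        have nz: "at0 (subst \<sigma> D) \<noteq> 0" "at0 (subst \<sigma> (p z)) \<noteq> 0"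
          using nz by (auto simp: s.map_mult at0_mult)
        obtain u where u: "\<forall>b. u b \<in> ord_ideal 1" "\<forall>b\<in>B - J. u b = \<delta> b"
          and ul: "\<forall>l. (\<forall>b\<in>B. l b \<in> polys Y) \<longrightarrow> (\<Sum>b\<in>B. l b * Var (\<eta> b)) \<in> P \<longrightarrow>
               (\<Sum>b\<in>B. subst \<sigma> (l b) * u b) \<in> ord_ideal N"
          using lift[OF \<sigma> nz(1) \<delta>] unfolding is_linear_arc_def by blast
        obtain e where e: "subst \<sigma> (p z) * e - 1 \<in> ord_ideal N"
          using ex_inverse_mod_ord_ideal[OF nz(2)] by blast
        define r where "r = (\<Sum>b\<in>B. subst \<sigma> (p b) * u b)"
        define a where "a = - (e * r)"
        let ?u = "u(z := a)"
        have sum: "(\<Sum>b\<in>B. subst \<sigma> (l b) * ?u b) = (\<Sum>b\<in>B. subst \<sigma> (l b) * u b)" for l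
          using insert.hyps(2) by (intro sum.cong) auto
        have "a \<in> ord_ideal 1"
          unfolding a_def r_def using u(1) by (intro ord_ideal_uminus ord_ideal_mult ord_ideal_sum) auto
        moreover have "r + subst \<sigma> (p z) * a = - (r * (subst \<sigma> (p z) * e - 1))"
          by (simp add: a_def algebra_simps)
        then have pr: "r + subst \<sigma> (p z) * a \<in> ord_ideal N"
          using e by (auto intro: ord_ideal_uminus ord_ideal_mult)
        have "(\<Sum>b\<in>insert z B. subst \<sigma> (l b) * ?u b) \<in> ord_ideal N"
          if l: "\<forall>b\<in>insert z B. l b \<in> polys Y" "(\<Sum>b\<in>insert z B. l b * Var (\<eta> b)) \<in> P" for l
        proof (rule ord_ideal_cancel[OF nz(2)])
          let ?l = "\<lambda>b. p z * l b - l z * p b"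
          have "(\<Sum>b\<in>B. ?l b * Var (\<eta> b)) = (\<Sum>b\<in>insert z B. ?l b * Var (\<eta> b))"
            using insert.hyps by (simp add: mult.commute)
          also have "\<dots> = p z * (\<Sum>b\<in>insert z B. l b * Var (\<eta> b)) - l z * (\<Sum>b\<in>insert z B. p b * Var (\<eta> b))"
            by (simp only: sum_distrib_left left_diff_distrib sum_subtractf mult.assoc)
          also have "\<dots> \<in> P"
            using l(2) p(2) by (intro diff_mem mult_mem) auto
          finally have "(\<Sum>b\<in>B. ?l b * Var (\<eta> b)) \<in> P" .
          moreover have "\<forall>b\<in>B. ?l b \<in> polys Y"
            using l(1) p(1) by auto
          ultimately have "(\<Sum>b\<in>B. subst \<sigma> (?l b) * u b) \<in> ord_ideal N"
            using ul[rule_format, of ?l] by blast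
          moreover have "subst \<sigma> (p z) * (\<Sum>b\<in>insert z B. subst \<sigma> (l b) * ?u b)
              = (\<Sum>b\<in>B. subst \<sigma> (?l b) * u b) + subst \<sigma> (l z) * (r + subst \<sigma> (p z) * a)"
            using insert.hyps sum[of l]
            by (simp add: r_def s.map_diff s.map_mult sum_distrib_left sum_subtractf algebra_simps)
          ultimately show "subst \<sigma> (p z) * (\<Sum>b\<in>insert z B. subst \<sigma> (l b) * ?u b) \<in> ord_ideal N"
            using pr by (simp add: ord_ideal_add ord_ideal_mult)
        qed
        ultimately show "\<exists>u. is_linear_arc Y \<sigma> \<eta> (insert z B) (insert z B - insert z J) \<delta> N u"
          using u BJ insert.hyps by (intro exI[of _ ?u]) (auto simp: is_linear_arc_def)
      qed
    qed (use J in auto)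
  qed
qed

section \<open>Homogeneous components and Schmidt rank\<close>

definition hcomp :: "nat \<Rightarrow> ('a, 'k::field) mpoly \<Rightarrow> ('a, 'k) mpoly" where
  "hcomp n = Poly_Mapping.mapp (\<lambda>m c. if mdeg m = n then c else 0)"

lemma lookup_hcomp:
  "Poly_Mapping.lookup (hcomp n p) m = (if mdeg m = n then Poly_Mapping.lookup p m else 0)"
  by (simp add: hcomp_def lookup_mapp when_def in_keys_iff)

lemma hcomp_add: "hcomp n (p + q) = hcomp n p + hcomp n q"
  by (rule poly_mapping_eqI) (simp add: lookup_hcomp lookup_add)

lemma hcomp_diff: "hcomp n (p - q) = hcomp n p - hcomp n q"
  by (rule poly_mapping_eqI) (simp add: lookup_hcomp lookup_minus)

lemma hcomp_0 [simp]: "hcomp n 0 = 0"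
  by (rule poly_mapping_eqI) (simp add: lookup_hcomp)

lemma hcomp_sum: "hcomp n (sum f A) = (\<Sum>i\<in>A. hcomp n (f i))"
  by (induction A rule: infinite_finite_induct) (auto simp: hcomp_add)

lemma hcomp_form: "p \<in> forms X a \<Longrightarrow> hcomp n p = (if n = a then p else 0)"
  by (rule poly_mapping_eqI) (auto simp: lookup_hcomp forms_def in_keys_iff)

lemma hcomp_in_forms: "p \<in> polys X \<Longrightarrow> hcomp n p \<in> forms X n"
  by (auto simp: forms_def polys_def in_keys_iff lookup_hcomp split: if_splits)

lemma ord_ideal_iff: "p \<in> ord_ideal N \<longleftrightarrow> (\<forall>m. mdeg m < N \<longrightarrow> Poly_Mapping.lookup p m = 0)"
  by (auto simp: ord_ideal_def in_keys_iff not_less[symmetric])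

lemma hcomp_ord_ideal: "p \<in> ord_ideal N \<Longrightarrow> n < N \<Longrightarrow> hcomp n p = 0"
  by (rule poly_mapping_eqI) (simp add: lookup_hcomp ord_ideal_iff)

lemma diff_hcomps_ord_ideal: "p - (\<Sum>i<N. hcomp i p) \<in> ord_ideal N"
proof -
  have "Poly_Mapping.lookup (\<Sum>i<N. hcomp i p) m = (if mdeg m < N then Poly_Mapping.lookup p m else 0)" for m
    by (simp add: lookup_sum lookup_hcomp)
  then show ?thesis
    by (simp add: ord_ideal_iff lookup_minus)
qed

lemma forms_mult:
  assumes "p \<in> forms X a" "q \<in> forms X b"
  shows "p * q \<in> forms X (a + b)"
proof -
  have "mdeg m = a + b" if m: "m \<in> Poly_Mapping.keys (p * q)" for m
  proof -
    obtain k l where "m = k + l" "k \<in> Poly_Mapping.keys p" "l \<in> Poly_Mapping.keys q"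
      using m keys_mult[of p q] by blast
    then show ?thesis
      using assms by (auto simp: forms_def mdeg_add)
  qed
  then show ?thesis
    using assms by (auto simp: forms_def)
qed

lemma forms_Var: "b \<in> X \<Longrightarrow> Var b \<in> forms X 1"
  by (simp add: forms_def) (simp add: Var_def mdeg_single)

lemma forms_const: "const_poly c \<in> forms X 0"
  by (simp add: forms_def) (simp add: const_poly_def mdeg_def)

lemma forms_single: "Poly_Mapping.single m c \<in> forms UNIV (mdeg m)"
  by (simp add: forms_def)

lemma forms_sum: "(\<And>i. i \<in> A \<Longrightarrow> f i \<in> forms X n) \<Longrightarrow> sum f A \<in> forms X n"
proof (induction A rule: infinite_finite_induct)
  case (insert i A)
  then have "f i \<in> forms X n" "sum f A \<in> forms X n"
    by auto
  then have "f i + sum f A \<in> forms X n"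
    using Poly_Mapping.keys_add[of "f i" "sum f A"] by (fastforce simp: forms_def)
  then show ?case
    using insert.hyps by simp
qed (auto simp: forms_def)

lemma forms_mono: "X \<subseteq> Y \<Longrightarrow> p \<in> forms X n \<Longrightarrow> p \<in> forms Y n"
  using polys_mono[of X Y] by (auto simp: forms_def)

lemma hcomp_mult_form:
  assumes "g \<in> forms UNIV a"
  shows "hcomp (a + n) (g * h) = g * hcomp n h"
proof (induction h rule: mpoly_induct)
  case (monomial m c)
  show ?case
    using hcomp_form[OF forms_mult[OF assms forms_single[of m c]], of "a + n"]
      hcomp_form[OF forms_single[of m c], of n] by auto
qed (simp add: hcomp_add distrib_left)

lemma forms_restrict:
  assumes "p \<in> forms UNIV n"
  shows "subst (\<lambda>b. if b \<in> B then Var b else 0) p \<in> forms B n"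
proof -
  let ?\<rho> = "\<lambda>b. if b \<in> B then Var b else (0 :: ('a, 'b) mpoly)"
  have eq: "monom_eval ?\<rho> m = (if Poly_Mapping.keys m \<subseteq> B then Poly_Mapping.single m 1 else 0)" for m
  proof (cases "Poly_Mapping.keys m \<subseteq> B")
    case True
    then have "monom_eval ?\<rho> m = monom_eval Var m"
      unfolding monom_eval_def by (intro prod.cong) auto
    then show ?thesis
      using True by (simp add: monomial_eq_monom_eval)
  next
    case False
    then obtain b where "b \<in> Poly_Mapping.keys m" "b \<notin> B"
      by blast
    then have "monom_eval ?\<rho> m = 0"
      unfolding monom_eval_def
      by (intro prod_zero) (auto simp: in_keys_iff zero_power intro!: bexI[of _ b])
    then show ?thesis
      using False by simp
  qed
  show ?thesis
    unfolding eval_hom_def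
  proof (rule forms_sum)
    fix m assume "m \<in> Poly_Mapping.keys p"
    then have "mdeg m = n"
      using assms by (auto simp: forms_def)
    then show "const_poly (Poly_Mapping.lookup p m) * monom_eval ?\<rho> m \<in> forms B n"
      unfolding eq by (auto simp: forms_def polys_def const_poly_def mult_single)
  qed
qed

lemma subst_Var: "subst Var p = p"
  using ring_map_eq_eval_hom[OF ring_map_id, of p] by simp

text \<open>
  Only the components of complementary degrees of the cofactors contribute, and they have positive
  degree because the generators have degree less than that of \<open>f\<close>.
\<close>

lemma schmidt_rank_le_card:
  assumes f: "f \<in> forms B d" and "finite I" and sum: "f = (\<Sum>i\<in>I. g i * h i)"
    and g: "\<And>i. i \<in> I \<Longrightarrow> g i \<in> forms UNIV (a i)" and a: "\<And>i. i \<in> I \<Longrightarrow> 0 < a i \<and> a i < d"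
  shows "schmidt_rank B f \<le> enat (card I)"
proof -
  let ?\<rho> = "subst (\<lambda>b. if b \<in> B then Var b else 0)"
  interpret r: ring_map ?\<rho> by (rule ring_map_subst)
  have "?\<rho> f = subst Var f"
    by (rule eval_hom_cong[of _ B]) (use f in \<open>auto simp: forms_def\<close>)
  then have "f = ?\<rho> f"
    by (simp add: subst_Var)
  also have "\<dots> = (\<Sum>i\<in>I. ?\<rho> (g i) * ?\<rho> (h i))"
    unfolding sum by (simp add: r.map_sum r.map_mult)
  finally have "hcomp d f = (\<Sum>i\<in>I. hcomp d (?\<rho> (g i) * ?\<rho> (h i)))"
    by (simp add: hcomp_sum)
  also have "\<dots> = (\<Sum>i\<in>I. ?\<rho> (g i) * hcomp (d - a i) (?\<rho> (h i)))"
  proof (rule sum.cong[OF refl])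
    fix i assume i: "i \<in> I"
    show "hcomp d (?\<rho> (g i) * ?\<rho> (h i)) = ?\<rho> (g i) * hcomp (d - a i) (?\<rho> (h i))"
      using hcomp_mult_form[OF forms_mono[OF subset_UNIV forms_restrict[OF g[OF i], of B]],
        of "d - a i" "?\<rho> (h i)"] a[OF i] by simp
  qed
  also have "hcomp d f = f"
    using hcomp_form[OF f] by simp
  finally have eq: "f = (\<Sum>i\<in>I. ?\<rho> (g i) * hcomp (d - a i) (?\<rho> (h i)))" .
  have \<rho>B: "?\<rho> p \<in> polys B" for p
  proof -
    have "p \<in> polys UNIV" by simp
    then show ?thesis
      by (induction rule: polys_induct)
         (auto simp: r.map_add r.map_mult eval_hom_const[OF ring_map_const] eval_hom_Var[OF ring_map_const])
  qed
  obtain t where t: "bij_betw t {..<card I} I"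
    using ex_bij_betw_nat_finite[OF \<open>finite I\<close>] by (auto simp: atLeast0LessThan)
  have "f = (\<Sum>j<card I. ?\<rho> (g (t j)) * hcomp (d - a (t j)) (?\<rho> (h (t j))))"
    by (subst eq) (rule sum.reindex_bij_betw[OF t, symmetric])
  moreover have "\<forall>j<card I. (\<exists>b>0. ?\<rho> (g (t j)) \<in> forms B b) \<and>
      (\<exists>b>0. hcomp (d - a (t j)) (?\<rho> (h (t j))) \<in> forms B b)"
  proof (intro allI impI)
    fix j assume "j < card I"
    then have "t j \<in> I"
      using t by (auto simp: bij_betw_def)
    then have "?\<rho> (g (t j)) \<in> forms B (a (t j))" "0 < a (t j)" "0 < d - a (t j)"
      using forms_restrict[OF g] a by auto
    then show "(\<exists>b>0. ?\<rho> (g (t j)) \<in> forms B b) \<and>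
      (\<exists>b>0. hcomp (d - a (t j)) (?\<rho> (h (t j))) \<in> forms B b)"
      using hcomp_in_forms[OF \<rho>B] by blast
  qed
  ultimately show ?thesis
    unfolding schmidt_rank_def
    by (intro Inf_lower CollectI exI[of _ "card I"] conjI refl
        exI[of _ "\<lambda>j. ?\<rho> (g (t j))"] exI[of _ "\<lambda>j. hcomp (d - a (t j)) (?\<rho> (h (t j)))"])
qed

lemma forms_partial_deriv:
  assumes "p \<in> forms X (Suc n)"
  shows "partial_deriv b p \<in> forms X n"
proof -
  have "mdeg m = n" if "m \<in> Poly_Mapping.keys (partial_deriv b p)" for m
  proof -
    have "m + Poly_Mapping.single b 1 \<in> Poly_Mapping.keys p"
      using that by (auto simp: in_keys_iff lookup_partial_deriv)
    then have "mdeg (m + Poly_Mapping.single b 1) = Suc n"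
      using assms by (auto simp: forms_def)
    then show ?thesis
      by (simp add: mdeg_add mdeg_single)
  qed
  then show ?thesis
    using assms partial_deriv_polys[of p X b] by (auto simp: forms_def)
qed

lemma single_sum: "Poly_Mapping.single m (sum f A) = (\<Sum>i\<in>A. Poly_Mapping.single m (f i))"
  by (induction A rule: infinite_finite_induct) (simp_all add: single_add)

text \<open>
  Euler's identity, applied twice below to get \<open>d (d - 1) f\<close> out of the Hessian.
\<close>

lemma euler:
  assumes "finite B" "p \<in> forms B e"
  shows "(\<Sum>b\<in>B. Var b * partial_deriv b p) = const_poly (of_nat e) * p"
proof -
  have single: "(\<Sum>b\<in>B. Var b * partial_deriv b (Poly_Mapping.single m c))
      = const_poly (of_nat e) * Poly_Mapping.single m (c :: 'b)"
    if m: "Poly_Mapping.keys m \<subseteq> B" "mdeg m = e" for m c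
  proof -
    have "Var b * partial_deriv b (Poly_Mapping.single m c)
        = Poly_Mapping.single m (of_nat (Poly_Mapping.lookup m b) * c)" for b
    proof (cases "Poly_Mapping.lookup m b = 0")
      case False
      then have "Poly_Mapping.single b 1 + (m - Poly_Mapping.single b 1) = m"
        by (intro poly_mapping_eqI) (auto simp: lookup_add lookup_minus lookup_single when_def)
      then show ?thesis
        by (simp add: partial_deriv_single Var_def mult_single)
    qed (simp add: partial_deriv_single)
    then have "(\<Sum>b\<in>B. Var b * partial_deriv b (Poly_Mapping.single m c))
        = Poly_Mapping.single m (\<Sum>b\<in>B. of_nat (Poly_Mapping.lookup m b) * c)"
      by (simp add: single_sum)
    also have "(\<Sum>b\<in>B. of_nat (Poly_Mapping.lookup m b) * c) = of_nat (\<Sum>b\<in>B. Poly_Mapping.lookup m b) * c"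
      by (simp add: sum_distrib_right)
    also have "(\<Sum>b\<in>B. Poly_Mapping.lookup m b) = mdeg m"
      unfolding mdeg_def
      by (rule sum.mono_neutral_right) (use assms(1) m in \<open>auto simp: in_keys_iff\<close>)
    finally show ?thesis
      by (simp add: m const_poly_def mult_single del: single_of_nat)
  qed
  have "(\<Sum>b\<in>B. Var b * partial_deriv b (\<Sum>m\<in>Poly_Mapping.keys p. Poly_Mapping.single m (Poly_Mapping.lookup p m)))
      = (\<Sum>m\<in>Poly_Mapping.keys p. \<Sum>b\<in>B. Var b * partial_deriv b (Poly_Mapping.single m (Poly_Mapping.lookup p m)))"
    by (simp add: partial_deriv_sum sum_distrib_left) (rule sum.swap)
  also have "\<dots> = (\<Sum>m\<in>Poly_Mapping.keys p. const_poly (of_nat e) * Poly_Mapping.single m (Poly_Mapping.lookup p m))"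
    using assms(2) by (intro sum.cong single) (auto simp: forms_def polys_def)
  also have "\<dots> = const_poly (of_nat e) * (\<Sum>m\<in>Poly_Mapping.keys p. Poly_Mapping.single m (Poly_Mapping.lookup p m))"
    by (simp add: sum_distrib_left)
  finally show ?thesis
    unfolding poly_mapping_sum_single[symmetric] .
qed

text \<open>
  The part of highest degree of a product of translated variables is the product of the variables.
\<close>

lemma hcomp_subst_translation:
  assumes "p \<in> forms X e"
  shows "hcomp e (subst (\<lambda>b. const_poly (c b) + Var b) p) = p"
proof -
  let ?\<tau> = "\<lambda>b. const_poly (c b) + Var b"
  define T where "T n p q \<longleftrightarrow> (\<forall>m\<in>Poly_Mapping.keys p. mdeg m \<le> n) \<and> hcomp n p = q"
    for n and p q :: "('a, 'b) mpoly"
  have T_mult: "T (a + b) (p * q) (p' * q')" if p: "T a p p'" and q: "T b q q'" for a b p q p' q'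
  proof -
    have "mdeg m \<le> a + b" if m: "m \<in> Poly_Mapping.keys (p * q)" for m
    proof -
      obtain k l where "m = k + l" "k \<in> Poly_Mapping.keys p" "l \<in> Poly_Mapping.keys q"
        using m keys_mult[of p q] by blast
      then show ?thesis
        using p q by (auto simp: T_def mdeg_add add_mono)
    qed
    moreover have "hcomp (a + b) (p * q) = p' * q'"
    proof -
      have low: "mdeg m < a" if "m \<in> Poly_Mapping.keys (p - p')" for m
      proof -
        have "Poly_Mapping.lookup p m \<noteq> 0 \<and> mdeg m \<noteq> a"
          using that p by (auto simp: T_def in_keys_iff lookup_minus lookup_hcomp split: if_splits)
        then show ?thesis
          using p by (auto simp: T_def in_keys_iff le_less)
      qed
      have "hcomp (a + b) ((p - p') * q) = 0"
      proof (rule poly_mapping_eqI)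
        fix m
        show "Poly_Mapping.lookup (hcomp (a + b) ((p - p') * q)) m = Poly_Mapping.lookup 0 m"
        proof (cases "m \<in> Poly_Mapping.keys ((p - p') * q)")
          case True
          then obtain k l where "m = k + l" "k \<in> Poly_Mapping.keys (p - p')" "l \<in> Poly_Mapping.keys q"
            using keys_mult[of "p - p'" q] by blast
          then have "mdeg m < a + b"
            using low[of k] q by (auto simp: T_def mdeg_add add_less_le_mono)
          then show ?thesis
            by (simp add: lookup_hcomp)
        qed (simp add: lookup_hcomp in_keys_iff)
      qed
      moreover have "p' \<in> forms UNIV a"
        using p hcomp_in_forms[of p UNIV a] by (simp add: T_def)
      then have "hcomp (a + b) (p' * q) = p' * q'"
        using hcomp_mult_form[of p' a b q] q by (simp add: T_def)
      moreover have "hcomp (a + b) (p * q) = hcomp (a + b) ((p - p') * q) + hcomp (a + b) (p' * q)"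
        by (simp add: algebra_simps flip: hcomp_add)
      ultimately show ?thesis
        by simp
    qed
    ultimately show ?thesis
      by (simp add: T_def)
  qed
  have T1: "T 0 1 1"
    using hcomp_form[OF forms_const[of 1 UNIV], of 0] by (simp add: T_def mdeg_def)
  have T_Var: "T 1 (?\<tau> b) (Var b)" for b
  proof -
    have "mdeg m \<le> 1" if "m \<in> Poly_Mapping.keys (?\<tau> b)" for m
    proof -
      have "m \<in> Poly_Mapping.keys (const_poly (c b) :: ('a, 'b) mpoly) \<union> Poly_Mapping.keys (Var b :: ('a, 'b) mpoly)"
        using subsetD[OF Poly_Mapping.keys_add that] .
      then show ?thesis
        by (auto simp: const_poly_def Var_def mdeg_single split: if_splits) (simp add: mdeg_def)
    qed
    moreover have "hcomp 1 (?\<tau> b) = Var b"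
      using hcomp_form[OF forms_const[of "c b" "UNIV :: 'a set"], of 1] hcomp_form[OF forms_Var[of b UNIV], of 1]
      by (simp add: hcomp_add)
    ultimately show ?thesis
      by (simp add: T_def)
  qed
  have T_pow: "T n (?\<tau> b ^ n) (Var b ^ n)" for b n
    by (induction n) (use T1 T_mult[OF T_Var] in auto)
  have T_prod: "T (\<Sum>b\<in>A. k b) (\<Prod>b\<in>A. ?\<tau> b ^ k b) (\<Prod>b\<in>A. Var b ^ k b)" if "finite A" for A k
    using that by (induction A) (use T1 T_mult T_pow in auto)
  have T_monom: "T (mdeg m) (monom_eval ?\<tau> m) (monom_eval Var m)" for m
    unfolding mdeg_def monom_eval_def by (rule T_prod) simp
  have "hcomp e (const_poly (Poly_Mapping.lookup p m) * monom_eval ?\<tau> m)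
      = const_poly (Poly_Mapping.lookup p m) * monom_eval Var m" if "m \<in> Poly_Mapping.keys p" for m
  proof -
    have "mdeg m = e"
      using assms that by (auto simp: forms_def)
    then show ?thesis
      using hcomp_mult_form[OF forms_const[of _ UNIV], of e _ "monom_eval ?\<tau> m"] T_monom[of m]
      by (simp add: T_def)
  qed
  then show ?thesis
    unfolding eval_hom_def hcomp_sum by (simp flip: mpoly_eq_sum)
qed

section \<open>The rank bound at a generic point\<close>

text \<open>
  The ideal generated by the \<open>g k\<close> and the polynomials of order at least \<open>N\<close>.
\<close>

definition gen_ideal :: "'i set \<Rightarrow> ('i \<Rightarrow> ('a, 'k::field) mpoly) \<Rightarrow> nat \<Rightarrow> ('a, 'k) mpoly set" where
  "gen_ideal K g N = {p. \<exists>h. p - (\<Sum>k\<in>K. g k * h k) \<in> ord_ideal N}"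

lemma gen_idealI: "p - (\<Sum>k\<in>K. g k * h k) \<in> ord_ideal N \<Longrightarrow> p \<in> gen_ideal K g N"
  by (auto simp: gen_ideal_def)

lemma gen_ideal_ord: "p \<in> ord_ideal N \<Longrightarrow> p \<in> gen_ideal K g N"
  by (rule gen_idealI[where h = "\<lambda>_. 0"]) simp

lemma gen_ideal_gen:
  assumes "finite K" "k \<in> K"
  shows "g k \<in> gen_ideal K g N"
proof (rule gen_idealI[where h = "\<lambda>j. if j = k then 1 else 0"])
  have "(\<Sum>j\<in>K. g j * (if j = k then 1 else 0)) = g k"
    using assms by (simp add: if_distrib cong: if_cong)
  then show "g k - (\<Sum>j\<in>K. g j * (if j = k then 1 else 0)) \<in> ord_ideal N"
    by simp
qed

lemma gen_ideal_add:
  assumes "p \<in> gen_ideal K g N" "q \<in> gen_ideal K g N"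
  shows "p + q \<in> gen_ideal K g N"
proof -
  obtain h h' where "p - (\<Sum>k\<in>K. g k * h k) \<in> ord_ideal N" "q - (\<Sum>k\<in>K. g k * h' k) \<in> ord_ideal N"
    using assms by (auto simp: gen_ideal_def)
  then have "(p - (\<Sum>k\<in>K. g k * h k)) + (q - (\<Sum>k\<in>K. g k * h' k)) \<in> ord_ideal N"
    by (rule ord_ideal_add)
  also have "(p - (\<Sum>k\<in>K. g k * h k)) + (q - (\<Sum>k\<in>K. g k * h' k))
      = p + q - (\<Sum>k\<in>K. g k * (h k + h' k))"
    by (simp add: sum.distrib algebra_simps)
  finally show ?thesis
    by (rule gen_idealI)
qed

lemma gen_ideal_times:
  assumes "p \<in> gen_ideal K g M" "q \<in> ord_ideal N"
  shows "p * q \<in> gen_ideal K g (M + N)"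
proof -
  obtain h where "p - (\<Sum>k\<in>K. g k * h k) \<in> ord_ideal M"
    using assms by (auto simp: gen_ideal_def)
  then have "(p - (\<Sum>k\<in>K. g k * h k)) * q \<in> ord_ideal (M + N)"
    using assms(2) by (rule ord_ideal_times)
  also have "(p - (\<Sum>k\<in>K. g k * h k)) * q = p * q - (\<Sum>k\<in>K. g k * (h k * q))"
    by (simp add: left_diff_distrib sum_distrib_right mult.assoc)
  finally show ?thesis
    by (rule gen_idealI)
qed

lemma gen_ideal_mult: "p \<in> gen_ideal K g N \<Longrightarrow> r * p \<in> gen_ideal K g N"
  using gen_ideal_times[of p K g N r 0] by (simp add: mult.commute)

lemma gen_ideal_mult': "p \<in> gen_ideal K g N \<Longrightarrow> p * r \<in> gen_ideal K g N"
  using gen_ideal_mult[of p K g N r] by (simp add: mult.commute)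

lemma gen_ideal_uminus: "p \<in> gen_ideal K g N \<Longrightarrow> - p \<in> gen_ideal K g N"
  using gen_ideal_mult[of p K g N "- 1"] by simp

lemma gen_ideal_diff: "p \<in> gen_ideal K g N \<Longrightarrow> q \<in> gen_ideal K g N \<Longrightarrow> p - q \<in> gen_ideal K g N"
  using gen_ideal_add[of p K g N "- q"] gen_ideal_uminus[of q K g N] by simp

lemma gen_ideal_sum: "(\<And>i. i \<in> A \<Longrightarrow> f i \<in> gen_ideal K g N) \<Longrightarrow> sum f A \<in> gen_ideal K g N"
  by (induction A rule: infinite_finite_induct) (auto intro: gen_ideal_add gen_ideal_ord)

lemma gen_ideal_subst:
  assumes "p \<in> polys Y" "\<And>z. z \<in> Y \<Longrightarrow> \<sigma> z - \<tau> z \<in> gen_ideal K g N"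
  shows "subst \<sigma> p - subst \<tau> p \<in> gen_ideal K g N"
proof -
  interpret s: ring_map "subst \<sigma>" by (rule ring_map_subst)
  interpret t: ring_map "subst \<tau>" by (rule ring_map_subst)
  show ?thesis
    using assms(1)
  proof (induction rule: polys_induct)
    case (const c)
    show ?case
      by (simp add: eval_hom_const[OF ring_map_const] gen_ideal_ord)
  next
    case (var b)
    then show ?case
      by (simp add: eval_hom_Var[OF ring_map_const] assms(2))
  next
    case (add p q)
    have "subst \<sigma> (p + q) - subst \<tau> (p + q) = (subst \<sigma> p - subst \<tau> p) + (subst \<sigma> q - subst \<tau> q)"
      by (simp add: s.map_add t.map_add)
    then show ?case
      using gen_ideal_add[OF add(3,4)] by simp
  next
    case (mult p q)
    have "subst \<sigma> (p * q) - subst \<tau> (p * q)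
        = subst \<sigma> q * (subst \<sigma> p - subst \<tau> p) + subst \<tau> p * (subst \<sigma> q - subst \<tau> q)"
      by (simp add: s.map_mult t.map_mult algebra_simps)
    then show ?case
      using gen_ideal_add[OF gen_ideal_mult[OF mult(3)] gen_ideal_mult[OF mult(4)]] by simp
  qed
qed

text \<open>
  The entries of the Hessian of \<open>f i0 + (\<Sum>i | i \<noteq> i0. c i * f i)\<close> as polynomials in the \<open>c i\<close> and in \<open>x\<close>;
  the variables are \<open>Inl i\<close> for \<open>c i\<close> and \<open>Inr (Inr b)\<close> for the coordinates of \<open>x\<close>, while
  \<open>Inr (Inl b)\<close> is kept for the coordinates of \<open>v\<close>.
\<close>

definition pencil_hessian ::
    "'s::finite \<Rightarrow> ('s \<Rightarrow> ('v, 'k::field) mpoly) \<Rightarrow> 'v \<Rightarrow> 'v \<Rightarrow> ('s + 'v + 'v, 'k) mpoly" where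
  "pencil_hessian i0 f a b = (\<Sum>i\<in>UNIV. (if i = i0 then 1 else Var (Inl i)) *
     subst (\<lambda>x. Var (Inr (Inr x))) (partial_deriv a (partial_deriv b (f i))))"

text \<open>
  The degenerate pairs \<open>(v, x)\<close> together with a vector \<open>c\<close> that is responsible for the degeneracy, over
  the affine chart \<open>c i0 = 1\<close> of the space of such vectors.
\<close>

definition degenerate_points ::
    "'v set \<Rightarrow> 's::finite \<Rightarrow> ('s \<Rightarrow> ('v, 'k::field) mpoly) \<Rightarrow> ('s + 'v + 'v \<Rightarrow> 'k) set" where
  "degenerate_points B i0 f = {\<phi>. \<forall>a\<in>B.
     (\<Sum>b\<in>B. poly_eval \<phi> (pencil_hessian i0 f a b) * \<phi> (Inr (Inl b))) = 0}"

lemma pencil_hessian_commute: "pencil_hessian i0 f a b = pencil_hessian i0 f b a"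
  unfolding pencil_hessian_def partial_deriv_commute[of a b] ..

lemma subst_subst: "subst \<sigma> (subst \<tau> p) = subst (\<lambda>b. subst \<sigma> (\<tau> b)) p"
proof (rule ring_map_eqI[where E = "\<lambda>p. subst \<sigma> (subst \<tau> p)"])
  show "ring_map (\<lambda>p. subst \<sigma> (subst \<tau> p))"
    by (rule ring_map_comp[OF ring_map_subst ring_map_subst])
qed (simp_all add: ring_map_subst eval_hom_const[OF ring_map_const] eval_hom_Var[OF ring_map_const])

lemma subst_polys:
  assumes "p \<in> polys X" "\<And>b. b \<in> X \<Longrightarrow> \<sigma> b \<in> polys Z"
  shows "subst \<sigma> p \<in> polys Z"
proof -
  interpret s: ring_map "subst \<sigma>" by (rule ring_map_subst)
  show ?thesis
    using assms(1)
    by (induction rule: polys_induct)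
       (auto simp: s.map_add s.map_mult eval_hom_const[OF ring_map_const]
          eval_hom_Var[OF ring_map_const] assms(2))
qed

text \<open>
  The number of coordinates is \<open>card (X B i0)\<close>, and \<open>I\<close> is independent modulo \<open>P\<close>; so the parenthesis on
  the right is at least the codimension of the zero set of \<open>P\<close>. The arc determines the coordinates in
  \<open>J\<close> (of \<open>c\<close> and \<open>x\<close>) and those in \<open>L\<close> (of \<open>u\<close>); the remaining ones are free, and are chosen to be
  constant for \<open>c\<close>, and \<open>x\<^sub>0 + x\<close> and \<open>x\<close> for the other two.
\<close>

lemma schmidt_rank_le_generic:
  fixes f :: "'s::finite \<Rightarrow> ('v, 'k::field) mpoly"
  defines "X B i0 \<equiv> Inl ` (UNIV - {i0}) \<union> Inr ` (Inl ` B \<union> Inr ` B)"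
  assumes dense: "dense_prime P (degenerate_points B i0 f)"
    and B: "finite B" and f: "\<And>i. f i \<in> forms B d" and d: "d \<ge> 3"
    and char: "of_nat ((d - 1) * d) \<noteq> (0 :: 'k)"
    and I: "I \<subseteq> X B i0" "P \<inter> polys I = {0}"
  shows "\<exists>c. c i0 = 1 \<and> schmidt_rank B (\<Sum>i\<in>UNIV. const_poly (c i) * f i)
    \<le> enat ((d - 2) * (card (X B i0) - card I))"
proof -
  interpret dense_prime P "degenerate_points B i0 f" by fact
  define Y :: "('s + 'v + 'v) set" where "Y = Inl ` (UNIV - {i0}) \<union> Inr ` Inr ` B"
  define \<eta> :: "'v \<Rightarrow> 's + 'v + 'v" where "\<eta> b = Inr (Inl b)" for b
  let ?M = "pencil_hessian i0 f"
  have finY: "finite Y"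
    using B by (simp add: Y_def)
  have \<eta>: "inj_on \<eta> B" "\<eta> ` B \<inter> Y = {}"
    by (auto simp: \<eta>_def inj_on_def Y_def)
  have XY: "X B i0 = Y \<union> \<eta> ` B"
    by (auto simp: X_def Y_def \<eta>_def)
  have MY: "?M a b \<in> polys Y" if "a \<in> B" "b \<in> B" for a b
  proof -
    have "partial_deriv a (partial_deriv b (f i)) \<in> polys B" for i
      using f[of i] by (intro partial_deriv_polys) (simp add: forms_def)
    then have "subst (\<lambda>x. Var (Inr (Inr x))) (partial_deriv a (partial_deriv b (f i))) \<in> polys Y" for i
      by (rule subst_polys) (auto simp: Y_def)
    then show ?thesis
      unfolding pencil_hessian_def by (intro polys_sum polys_mult) (auto simp: Y_def)
  qed
  have row: "(\<Sum>b\<in>B. ?M a b * Var (\<eta> b)) \<in> P" if "a \<in> B" for a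
  proof (rule ccontr)
    assume "\<not> ?thesis"
    from dense[OF this, of "{}"] obtain \<phi> where
      phi: "\<phi> \<in> degenerate_points B i0 f" "poly_eval \<phi> (\<Sum>b\<in>B. ?M a b * Var (\<eta> b)) \<noteq> 0"
      by auto
    interpret e: ring_map "poly_eval \<phi>" by (rule ring_map_poly_eval)
    have "poly_eval \<phi> (\<Sum>b\<in>B. ?M a b * Var (\<eta> b)) = 0"
      using phi(1) \<open>a \<in> B\<close>
      by (simp add: degenerate_points_def e.map_sum e.map_mult poly_eval_Var \<eta>_def)
    then show False
      using phi(2) by contradiction
  qed

  obtain J D F where J: "J \<subseteq> Y" "Y \<subseteq> cl (Y - J)" and D: "D \<notin> P" "finite F" "F \<subseteq> P"
    and arc: "\<And>\<phi> (\<delta> :: _ \<Rightarrow> ('v, 'k) mpoly) N. poly_eval \<phi> D \<noteq> 0 \<Longrightarrow> (\<forall>p\<in>F. poly_eval \<phi> p = 0) \<Longrightarrow>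
       (\<forall>z. \<delta> z \<in> ord_ideal 1) \<Longrightarrow>
       (\<exists>\<sigma>. is_arc Y (Y - J) \<phi> \<delta> N \<sigma>)"
    using ex_arc[OF finY, where 'b = 'v] by blast
  obtain L E where L: "L \<subseteq> B" "\<eta> ` B \<subseteq> cl (Y \<union> \<eta> ` (B - L))" and E: "E \<in> polys Y" "E \<notin> P"
    and linear: "\<And>(\<sigma> :: _ \<Rightarrow> ('v, 'k) mpoly) \<delta> N. (\<forall>h\<in>P \<inter> polys Y. subst \<sigma> h \<in> ord_ideal N) \<Longrightarrow>
       at0 (subst \<sigma> E) \<noteq> 0 \<Longrightarrow> (\<forall>b. \<delta> b \<in> ord_ideal 1) \<Longrightarrow>
       (\<exists>u. is_linear_arc Y \<sigma> \<eta> B (B - L) \<delta> N u)"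
    using ex_linear_arc[OF B finY \<eta>, where 'b = 'v] by blast

  have card: "card J + card L \<le> card (X B i0) - card I"
  proof -
    let ?S = "(Y - J) \<union> \<eta> ` (B - L)"
    have finS: "finite ?S"
      using finY B by auto
    have Y: "Y \<subseteq> cl ?S"
      using J(2) cl_mono[of "Y - J" ?S] by auto
    have "\<eta> ` B \<subseteq> cl ?S"
    proof
      fix z assume "z \<in> \<eta> ` B"
      then have "z \<in> cl (?S \<union> Y)"
        using L(2) cl_mono[of "Y \<union> \<eta> ` (B - L)" "?S \<union> Y"] by auto
      then show "z \<in> cl ?S"
        by (rule cl_trans_finite[OF finY _ Y])
    qed
    then have "I \<subseteq> cl ?S"
      using Y I(1) unfolding XY by blast
    moreover have "finite I"
      using I(1) XY finY B finite_subset by fastforce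
    ultimately have "card I \<le> card ?S"
      using card_independent_le finS I(2) by blast
    also have "card ?S \<le> (card Y - card J) + (card B - card L)"
      using card_Un_le[of "Y - J" "\<eta> ` (B - L)"] card_image_le[of "B - L" \<eta>] B finY J(1) L(1)
      by (simp add: card_Diff_subset finite_subset)
    finally have "card I \<le> (card Y - card J) + (card B - card L)" .
    moreover have "card J \<le> card Y" "card L \<le> card B"
      using J(1) L(1) finY B by (auto intro: card_mono)
    moreover have "card (X B i0) = card Y + card B"
      unfolding XY using \<eta> finY B by (subst card_Un_disjoint) (auto simp: card_image)
    ultimately show ?thesis
      by linarith
  qed

  have "D * E \<notin> P"
    using prime[of D E] D E by auto
  from dense[OF this D(2,3)] obtain \<phi> where
    nz: "poly_eval \<phi> D \<noteq> 0" "poly_eval \<phi> E \<noteq> 0" and F: "\<forall>p\<in>F. poly_eval \<phi> p = 0"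
    by (auto simp: ring_map.map_mult[OF ring_map_poly_eval])
  define \<delta> :: "'s + 'v + 'v \<Rightarrow> ('v, 'k) mpoly" where
    "\<delta> z = (case z of Inr (Inr b) \<Rightarrow> Var b | _ \<Rightarrow> 0)" for z
  have \<delta>: "\<forall>z. \<delta> z \<in> ord_ideal 1"
    using ord_ideal_Var by (auto simp: \<delta>_def split: sum.splits)
  obtain \<sigma> where \<sigma>1: "\<forall>z. \<sigma> z - const_poly (\<phi> z) \<in> ord_ideal 1"
    and \<sigma>J: "\<forall>z\<in>Y - J. \<sigma> z = const_poly (\<phi> z) + \<delta> z"
    and \<sigma>P: "\<forall>h\<in>P \<inter> polys Y. subst \<sigma> h \<in> ord_ideal d"
    using arc[OF nz(1) F \<delta>] unfolding is_arc_def by blast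
  interpret s: ring_map "subst \<sigma>" by (rule ring_map_subst)
  have at0_\<sigma>: "at0 (subst \<sigma> p) = poly_eval \<phi> p" for p
  proof -
    have "at0 (\<sigma> b) = \<phi> b" for b
      using \<sigma>1 by (simp add: mem_ord_ideal_1_iff at0_diff at0_const del: One_nat_def)
    then show ?thesis
      by (simp add: poly_eval_subst)
  qed
  have "at0 (subst \<sigma> E) \<noteq> 0"
    using nz(2) at0_\<sigma> by simp
  then obtain u where u1: "\<forall>b. u b \<in> ord_ideal 1" and uL: "\<forall>b\<in>B - L. u b = Var b"
    and ul: "\<forall>l. (\<forall>b\<in>B. l b \<in> polys Y) \<longrightarrow> (\<Sum>b\<in>B. l b * Var (\<eta> b)) \<in> P \<longrightarrow>
               (\<Sum>b\<in>B. subst \<sigma> (l b) * u b) \<in> ord_ideal d"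
    using linear[OF \<sigma>P, of Var] ord_ideal_Var unfolding is_linear_arc_def by blast
  have rows: "(\<Sum>b\<in>B. subst \<sigma> (?M a b) * u b) \<in> ord_ideal d" if "a \<in> B" for a
    using ul[rule_format, of "?M a"] row[OF that] MY[OF that] by blast

  \<comment> \<open>The deviation of the arc from its intended linear form, and the components of degrees
    \<open>1, \<dots>, d - 2\<close> of it that generate the ideal; the tail has order at least \<open>d - 1\<close>.\<close>
  define dev where "dev = case_sum (\<lambda>z. \<sigma> z - const_poly (\<phi> z) - \<delta> z) (\<lambda>b. u b - Var b)"
  have dev1: "dev k \<in> ord_ideal 1" for k
    by (cases k) (simp_all add: dev_def ord_ideal_diff \<sigma>1 \<delta> u1 ord_ideal_Var del: One_nat_def)
  have dev0: "dev k = 0" if "k \<in> (Y <+> B) - (J <+> L)" for k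
    using that
  proof (cases k)
    case (Inl z)
    then have "z \<in> Y - J"
      using that by auto
    then show ?thesis
      using \<sigma>J Inl by (simp add: dev_def)
  next
    case (Inr b)
    then have "b \<in> B - L"
      using that by auto
    then show ?thesis
      using uL Inr by (simp add: dev_def)
  qed
  define K where "K = (J <+> L) \<times> {1..<d - 1}"
  define g where "g = (\<lambda>(k, e). hcomp e (dev k))"
  have finK: "finite K"
    using J(1) L(1) finY B by (auto simp: K_def finite_subset)
  let ?I = "gen_ideal K g"
  have head: "(\<Sum>e<d - 1. hcomp e (dev k)) \<in> ?I N" if k: "k \<in> Y <+> B" for k N
  proof (cases "k \<in> J <+> L")
    case True
    show ?thesis
    proof (rule gen_ideal_sum)
      fix e assume e: "e \<in> {..<d - 1}"
      show "hcomp e (dev k) \<in> ?I N"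
      proof (cases "e = 0")
        case True
        then show ?thesis
          using hcomp_ord_ideal[OF dev1, of e k] by (simp add: gen_ideal_ord)
      next
        case False
        then have "(k, e) \<in> K"
          using \<open>k \<in> J <+> L\<close> e by (auto simp: K_def)
        then show ?thesis
          using gen_ideal_gen[OF finK, of "(k, e)" g N] by (simp add: g_def)
      qed
    qed
  next
    case False
    then show ?thesis
      using dev0[of k] k by (simp add: gen_ideal_ord)
  qed
  define tail where "tail k = dev k - (\<Sum>e<d - 1. hcomp e (dev k))" for k
  have tail: "tail k \<in> ord_ideal (d - 1)" for k
    unfolding tail_def by (rule diff_hcomps_ord_ideal)
  have dev_tail: "dev k - tail k \<in> ?I N" if "k \<in> Y <+> B" for k N
    using head[OF that] by (simp add: tail_def)

  \<comment> \<open>The arc can be replaced by \<open>(c, x\<^sub>0 + x)\<close> in the Hessian, modulo generators and order \<open>d - 1\<close>.\<close>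
  define c where "c i = (if i = i0 then 1 else \<phi> (Inl i))" for i
  define \<tau> where "\<tau> z = const_poly (\<phi> z) + \<delta> z" for z
  interpret t: ring_map "subst \<tau>" by (rule ring_map_subst)
  have "\<sigma> z - \<tau> z \<in> ?I (d - 1)" if "z \<in> Y" for z
  proof -
    have "(dev (Inl z) - tail (Inl z)) + tail (Inl z) \<in> ?I (d - 1)"
      using that by (intro gen_ideal_add dev_tail gen_ideal_ord[OF tail]) auto
    then show ?thesis
      by (simp add: dev_def \<tau>_def algebra_simps)
  qed
  then have M_cong: "subst \<sigma> (?M a b) - subst \<tau> (?M a b) \<in> ?I (d - 1)" if "a \<in> B" "b \<in> B" for a b
    using gen_ideal_subst[OF MY[OF that]] by blast

  define w where "w b = hcomp 1 (u b)" for b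
  have w_ord: "w b \<in> ord_ideal 1" for b
    using hcomp_in_forms[of "u b" UNIV 1] by (auto simp: w_def forms_def ord_ideal_def)
  have uw: "u b - w b \<in> ord_ideal 2" for b
  proof -
    have "(\<Sum>i<2. hcomp i (u b)) = w b"
      using hcomp_ord_ideal[of "u b" 1 0] u1 by (simp add: w_def numeral_2_eq_2)
    then show ?thesis
      using diff_hcomps_ord_ideal[of "u b" 2] by simp
  qed
  have hVar: "hcomp 1 (Var b) = (Var b :: ('v, 'k) mpoly)" for b
    by (subst hcomp_form[OF forms_Var[of b UNIV]]) simp_all
  have w: "w b - Var b \<in> ?I N" if b: "b \<in> B" for b N
  proof (cases "b \<in> L")
    case True
    have "w b - Var b = hcomp 1 (dev (Inr b))"
      using hVar[of b] by (simp add: w_def dev_def hcomp_diff)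
    moreover have "(Inr b, 1) \<in> K"
      using True d by (auto simp: K_def)
    then have "hcomp 1 (dev (Inr b)) \<in> ?I N"
      using gen_ideal_gen[OF finK, of "(Inr b, 1)" g N] by (simp add: g_def)
    ultimately show ?thesis
      by simp
  next
    case False
    then have "w b = Var b"
      using b uL hVar[of b] by (simp add: w_def)
    then show ?thesis
      by (simp add: gen_ideal_ord)
  qed

  \<comment> \<open>Passing from \<open>H(y)(u, w)\<close> to \<open>H(x\<^sub>0 + x)(x, x)\<close>: all differences lie in the ideal up to order
    \<open>d + 1\<close>. For the tail of \<open>u\<close>, which has order \<open>d - 1\<close>, the two missing orders come from \<open>w\<close>, which has
    order \<open>1\<close> and lies in the kernel at the starting point.\<close>
  let ?T = "\<lambda>p. p \<in> ?I (d + 1)"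
  have s1: "?T (\<Sum>a\<in>B. w a * (\<Sum>b\<in>B. subst \<sigma> (?M a b) * u b))"
    using ord_ideal_times[OF rows w_ord] by (intro gen_ideal_sum gen_ideal_ord) (simp add: mult.commute)
  have s2: "?T (\<Sum>a\<in>B. w a * (\<Sum>b\<in>B. (subst \<sigma> (?M a b) - subst \<tau> (?M a b)) * u b))"
    unfolding sum_distrib_left
  proof (intro gen_ideal_sum)
    fix a b assume "a \<in> B" "b \<in> B"
    then have "(subst \<sigma> (?M a b) - subst \<tau> (?M a b)) * (u b * w a) \<in> ?I ((d - 1) + (1 + 1))"
      using u1 by (intro gen_ideal_times M_cong ord_ideal_times w_ord) auto
    then show "?T (w a * ((subst \<sigma> (?M a b) - subst \<tau> (?M a b)) * u b))"
      using d by (simp add: mult_ac)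
  qed
  have s3: "?T (\<Sum>a\<in>B. w a * (\<Sum>b\<in>B. subst \<tau> (?M a b) * (u b - Var b - tail (Inr b))))"
    using dev_tail[of "Inr _"] by (intro gen_ideal_sum gen_ideal_mult) (auto simp: dev_def)
  have s4: "?T (\<Sum>b\<in>B. tail (Inr b) * (\<Sum>a\<in>B. subst \<tau> (?M a b) * w a))"
  proof (intro gen_ideal_sum gen_ideal_ord)
    fix b assume b: "b \<in> B"
    have "at0 (\<tau> z) = \<phi> z" for z
      using \<delta> by (simp add: \<tau>_def at0_add at0_const mem_ord_ideal_1_iff del: One_nat_def)
    then have "at0 (subst \<tau> p) = poly_eval \<phi> p" for p
      by (simp add: poly_eval_subst)
    then have M1: "subst \<sigma> p - subst \<tau> p \<in> ord_ideal 1" for p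
      by (simp add: mem_ord_ideal_1_iff at0_diff at0_\<sigma> del: One_nat_def)
    have "(\<Sum>a\<in>B. subst \<sigma> (?M b a) * u a) \<in> ord_ideal 2"
      using d by (intro ord_ideal_mono[OF _ rows[OF b]]) auto
    moreover have "(subst \<sigma> (?M a b) - subst \<tau> (?M a b)) * u a \<in> ord_ideal 2" for a
      using ord_ideal_times[OF M1, of "u a" 1 "?M a b"] u1 by (simp add: numeral_2_eq_2)
    then have "(\<Sum>a\<in>B. (subst \<sigma> (?M a b) - subst \<tau> (?M a b)) * u a) \<in> ord_ideal 2"
      by (rule ord_ideal_sum)
    moreover have "(\<Sum>a\<in>B. subst \<tau> (?M a b) * (u a - w a)) \<in> ord_ideal 2"
      by (intro ord_ideal_sum ord_ideal_mult uw)
    ultimately have "(\<Sum>a\<in>B. subst \<sigma> (?M b a) * u a) - (\<Sum>a\<in>B. (subst \<sigma> (?M a b) - subst \<tau> (?M a b)) * u a)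
        - (\<Sum>a\<in>B. subst \<tau> (?M a b) * (u a - w a)) \<in> ord_ideal 2"
      by (intro ord_ideal_diff)
    also have "(\<Sum>a\<in>B. subst \<sigma> (?M b a) * u a) - (\<Sum>a\<in>B. (subst \<sigma> (?M a b) - subst \<tau> (?M a b)) * u a)
        - (\<Sum>a\<in>B. subst \<tau> (?M a b) * (u a - w a)) = (\<Sum>a\<in>B. subst \<tau> (?M a b) * w a)"
      by (simp add: pencil_hessian_commute[of _ _ b] algebra_simps sum_subtractf sum.distrib)
    finally have "tail (Inr b) * (\<Sum>a\<in>B. subst \<tau> (?M a b) * w a) \<in> ord_ideal ((d - 1) + 2)"
      by (rule ord_ideal_times[OF tail])
    then show "tail (Inr b) * (\<Sum>a\<in>B. subst \<tau> (?M a b) * w a) \<in> ord_ideal (d + 1)"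
      using d by (simp add: numeral_2_eq_2)
  qed
  have s5: "?T (\<Sum>a\<in>B. (w a - Var a) * (\<Sum>b\<in>B. subst \<tau> (?M a b) * Var b))"
    by (intro gen_ideal_sum gen_ideal_mult' w)
  let ?Q = "\<Sum>a\<in>B. Var a * (\<Sum>b\<in>B. subst \<tau> (?M a b) * Var b)"
  have "?Q = (\<Sum>a\<in>B. w a * (\<Sum>b\<in>B. subst \<sigma> (?M a b) * u b))
      - (\<Sum>a\<in>B. w a * (\<Sum>b\<in>B. (subst \<sigma> (?M a b) - subst \<tau> (?M a b)) * u b))
      - (\<Sum>a\<in>B. w a * (\<Sum>b\<in>B. subst \<tau> (?M a b) * (u b - Var b - tail (Inr b))))
      - (\<Sum>b\<in>B. tail (Inr b) * (\<Sum>a\<in>B. subst \<tau> (?M a b) * w a))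
      - (\<Sum>a\<in>B. (w a - Var a) * (\<Sum>b\<in>B. subst \<tau> (?M a b) * Var b))"
  proof -
    have "(\<Sum>b\<in>B. tail (Inr b) * (\<Sum>a\<in>B. subst \<tau> (?M a b) * w a))
        = (\<Sum>a\<in>B. w a * (\<Sum>b\<in>B. subst \<tau> (?M a b) * tail (Inr b)))"
      unfolding sum_distrib_left by (subst sum.swap) (simp add: mult_ac)
    then show ?thesis
      by (simp add: algebra_simps sum_subtractf sum.distrib)
  qed
  then have "?T ?Q"
    using s1 s2 s3 s4 s5 by (simp only: gen_ideal_diff)
  then obtain h where h: "?Q - (\<Sum>k\<in>K. g k * h k) \<in> ord_ideal (d + 1)"
    by (auto simp: gen_ideal_def)
  define fc where "fc = (\<Sum>i\<in>UNIV. const_poly (c i) * f i)"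
  have fcd: "fc \<in> forms B d"
    unfolding fc_def using forms_mult[OF forms_const f] by (intro forms_sum) simp

  \<comment> \<open>Taking components of degree \<open>d\<close> undoes the translation by \<open>x\<^sub>0\<close>.\<close>
  have top: "hcomp d ?Q = const_poly (of_nat ((d - 1) * d)) * fc"
  proof -
    have hconst: "hcomp n (const_poly a * q) = const_poly a * hcomp n q" for n a and q :: "('v, 'k) mpoly"
      using hcomp_mult_form[OF forms_const[of a UNIV], of n q] by simp
    have swap: "(\<Sum>a\<in>B. \<Sum>b\<in>B. \<Sum>i\<in>UNIV. X a b i) = (\<Sum>i\<in>UNIV. \<Sum>b\<in>B. \<Sum>a\<in>B. X a b i)"
      for X :: "'v \<Rightarrow> 'v \<Rightarrow> 's \<Rightarrow> ('v, 'k) mpoly"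
    proof -
      have "(\<Sum>a\<in>B. \<Sum>b\<in>B. \<Sum>i\<in>UNIV. X a b i) = (\<Sum>b\<in>B. \<Sum>a\<in>B. \<Sum>i\<in>UNIV. X a b i)"
        by (rule sum.swap)
      also have "\<dots> = (\<Sum>b\<in>B. \<Sum>i\<in>UNIV. \<Sum>a\<in>B. X a b i)"
        by (intro sum.cong refl sum.swap)
      also have "\<dots> = (\<Sum>i\<in>UNIV. \<Sum>b\<in>B. \<Sum>a\<in>B. X a b i)"
        by (rule sum.swap)
      finally show ?thesis .
    qed
    have dd: "Suc (d - 1) = d" "Suc (d - 2) = d - 1"
      using d by auto
    have "subst \<tau> (?M a b) = (\<Sum>i\<in>UNIV. const_poly (c i) *
        subst (\<lambda>x. const_poly (\<phi> (Inr (Inr x))) + Var x) (partial_deriv a (partial_deriv b (f i))))" for a b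
      unfolding pencil_hessian_def t.map_sum t.map_mult subst_subst
      by (intro sum.cong refl arg_cong2[where f = "(*)"])
         (auto simp: c_def \<tau>_def \<delta>_def eval_hom_Var[OF ring_map_const])
    then have M: "hcomp (d - 2) (subst \<tau> (?M a b))
        = (\<Sum>i\<in>UNIV. const_poly (c i) * partial_deriv a (partial_deriv b (f i)))" for a b
    proof -
      have form: "partial_deriv a (partial_deriv b (f i)) \<in> forms B (d - 2)" for i
        using f[of i] dd by (intro forms_partial_deriv) simp
      then show ?thesis
        using \<open>subst \<tau> (?M a b) = _\<close> by (simp add: hcomp_sum hconst hcomp_subst_translation[OF form])
    qed
    have "hcomp d (Var a * (subst \<tau> (?M a b) * Var b)) = Var a * Var b * hcomp (d - 2) (subst \<tau> (?M a b))" for a b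
      using hcomp_mult_form[OF forms_mult[OF forms_Var[of a UNIV] forms_Var[of b UNIV]],
        of "d - 2" "subst \<tau> (?M a b)"] dd
      by (simp add: mult_ac numeral_2_eq_2)
    then have "hcomp d ?Q = (\<Sum>a\<in>B. \<Sum>b\<in>B. \<Sum>i\<in>UNIV.
        Var a * Var b * (const_poly (c i) * partial_deriv a (partial_deriv b (f i))))"
      by (simp add: sum_distrib_left hcomp_sum M)
    also have "\<dots> = (\<Sum>i\<in>UNIV. const_poly (c i) *
        (\<Sum>b\<in>B. Var b * (\<Sum>a\<in>B. Var a * partial_deriv a (partial_deriv b (f i)))))"
      unfolding sum_distrib_left swap by (simp add: mult_ac)
    also have "\<dots> = (\<Sum>i\<in>UNIV. const_poly (c i) * (const_poly (of_nat ((d - 1) * d)) * f i))"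
    proof (intro sum.cong refl arg_cong2[where f = "(*)"])
      fix i
      have df: "partial_deriv b (f i) \<in> forms B (d - 1)" for b
        using f[of i] dd by (intro forms_partial_deriv) simp
      have "(\<Sum>b\<in>B. Var b * (\<Sum>a\<in>B. Var a * partial_deriv a (partial_deriv b (f i))))
          = const_poly (of_nat (d - 1)) * (\<Sum>b\<in>B. Var b * partial_deriv b (f i))"
        unfolding euler[OF B df] sum_distrib_left by (simp add: mult_ac)
      also have "\<dots> = const_poly (of_nat (d - 1)) * (const_poly (of_nat d) * f i)"
        using euler[OF B f] by simp
      also have "\<dots> = const_poly (of_nat ((d - 1) * d)) * f i"
        by (simp add: ring_map.map_mult[OF ring_map_const] flip: mult.assoc)
      finally show "(\<Sum>b\<in>B. Var b * (\<Sum>a\<in>B. Var a * partial_deriv a (partial_deriv b (f i))))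
          = const_poly (of_nat ((d - 1) * d)) * f i" .
    qed
    finally show ?thesis
      by (simp add: fc_def sum_distrib_left mult_ac)
  qed
  have g_form: "g k \<in> forms UNIV (snd k)" and deg: "0 < snd k \<and> snd k < d" if "k \<in> K" for k
    using that hcomp_in_forms[of _ UNIV] by (auto simp: g_def K_def)
  have "hcomp d ?Q = (\<Sum>k\<in>K. hcomp d (g k * h k))"
    using hcomp_ord_ideal[OF h, of d] by (simp add: hcomp_diff hcomp_sum)
  also have "\<dots> = (\<Sum>k\<in>K. g k * hcomp (d - snd k) (h k))"
  proof (intro sum.cong refl)
    fix k assume "k \<in> K"
    then show "hcomp d (g k * h k) = g k * hcomp (d - snd k) (h k)"
      using hcomp_mult_form[OF g_form, of k "d - snd k" "h k"] deg[of k] by simp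
  qed
  finally have "const_poly (of_nat ((d - 1) * d)) * fc = (\<Sum>k\<in>K. g k * hcomp (d - snd k) (h k))"
    unfolding top .
  then have "const_poly (inverse (of_nat ((d - 1) * d))) * (const_poly (of_nat ((d - 1) * d)) * fc)
      = (\<Sum>k\<in>K. g k * (const_poly (inverse (of_nat ((d - 1) * d))) * hcomp (d - snd k) (h k)))"
    by (simp add: sum_distrib_left mult_ac)
  moreover have "const_poly (inverse (of_nat ((d - 1) * d))) * (const_poly (of_nat ((d - 1) * d)) * fc) = fc"
    by (simp only: mult.assoc[symmetric] ring_map.map_mult[OF ring_map_const, symmetric]
        left_inverse[OF char] const_poly_1 mult_1)
  ultimately have "fc = (\<Sum>k\<in>K. g k * (const_poly (inverse (of_nat ((d - 1) * d))) * hcomp (d - snd k) (h k)))"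
    by simp
  then have "schmidt_rank B fc \<le> enat (card K)"
    by (rule schmidt_rank_le_card[OF fcd finK _ g_form deg])
  also have "card K = (d - 2) * (card J + card L)"
    using J(1) L(1) finY B d by (simp add: K_def card_cartesian_product card_Plus finite_subset numeral_2_eq_2)
  also have "\<dots> \<le> (d - 2) * (card (X B i0) - card I)"
    using card by simp
  finally show ?thesis
    by (intro exI[of _ c]) (auto simp: c_def fc_def)
qed

section \<open>From the codimension to the rank\<close>

text \<open>
  The points of \<open>S\<close> are lifted to points \<open>(c, v, x)\<close>. A set \<open>I\<close> of coordinates of \<open>(v, x)\<close> that is
  independent modulo \<open>P\<close> is used to choose a dense prime for the lifted points: a nonzero polynomial in
  \<open>I\<close> is not in \<open>P\<close>, hence does not vanish identically on \<open>S\<close>. So \<open>I\<close> stays independent, whereas the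
  number of coordinates has grown by \<open>CARD('s) - 1\<close>.
\<close>

lemma schmidt_rank_le_height:
  fixes f :: "'s::finite \<Rightarrow> ('v, 'k::field) mpoly" and S :: "('v + 'v \<Rightarrow> 'k) set"
  assumes B: "finite B" and f: "\<And>i. f i \<in> forms B d" and d: "d \<ge> 3"
    and char: "of_nat ((d - 1) * d) \<noteq> (0 :: 'k)"
    and P: "primeideal P (poly_ring (B <+> B))" "vanishing_ideal (B <+> B) S \<subseteq> P"
    and S: "\<And>p. p \<in> S \<Longrightarrow> \<exists>c. c i0 = 1 \<and> (\<forall>a\<in>B. (\<Sum>b\<in>B. (\<Sum>i\<in>UNIV. c i *
       poly_eval (\<lambda>x. p (Inr x)) (partial_deriv a (partial_deriv b (f i)))) * p (Inl b)) = 0)"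
  shows "\<exists>c. c i0 = 1 \<and> schmidt_rank B (\<Sum>i\<in>UNIV. const_poly (c i) * f i)
    \<le> enat (d - 2) * (prime_height (poly_ring (B <+> B)) P + enat (CARD('s) - 1))"
proof -
  interpret P: prime_polys "B <+> B" P
    by (rule primeideal_imp_prime_polys[OF P(1)])
  have fin: "finite (B <+> B)"
    using B by simp
  obtain I where I: "I \<subseteq> B <+> B" "P \<inter> polys I = {0}"
    and height: "enat (card (B <+> B) - card I) \<le> prime_height (poly_ring (B <+> B)) P"
    using ex_independent_height[OF fin P(1)] by blast
  let ?\<iota> = "subst (\<lambda>z. Var (Inr z)) :: ('v + 'v, 'k) mpoly \<Rightarrow> ('s + 'v + 'v, 'k) mpoly"
  interpret \<iota>: ring_map ?\<iota> by (rule ring_map_subst)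
  define M0 where "M0 = ?\<iota> ` (polys I - {0})"
  have notP: "p \<notin> P" if "p \<in> polys I - {0}" for p
    using that I(2) by auto
  have IX: "polys I \<subseteq> (polys (B <+> B) :: ('v + 'v, 'k) mpoly set)"
    by (rule polys_mono) (rule I(1))
  have "\<exists>Q. dense_prime Q (degenerate_points B i0 f) \<and> Q \<inter> M0 = {}"
  proof (rule ex_dense_prime)
    show "1 \<in> M0"
      unfolding M0_def by (rule image_eqI[of _ _ 1]) auto
    show "p * q \<in> M0" if "p \<in> M0" "q \<in> M0" for p q
    proof -
      obtain p' q' where p': "p = ?\<iota> p'" "p' \<in> polys I - {0}" and q': "q = ?\<iota> q'" "q' \<in> polys I - {0}"
        using \<open>p \<in> M0\<close> \<open>q \<in> M0\<close> by (auto simp: M0_def)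
      have "p' * q' \<notin> P"
        using P.prime[of p' q'] notP p'(2) q'(2) IX by blast
      then have "p' * q' \<noteq> 0"
        using P.zero_mem by auto
      then show ?thesis
        unfolding M0_def using p' q' by (intro image_eqI[of _ _ "p' * q'"]) (auto simp: \<iota>.map_mult)
    qed
    show "\<exists>\<phi>\<in>degenerate_points B i0 f. poly_eval \<phi> p \<noteq> 0" if "p \<in> M0" for p
    proof -
      obtain p' where p': "p = ?\<iota> p'" "p' \<in> polys I - {0}"
        using \<open>p \<in> M0\<close> by (auto simp: M0_def)
      have "p' \<notin> vanishing_ideal (B <+> B) S"
        using notP[OF p'(2)] P(2) by blast
      then obtain \<phi> where \<phi>: "\<phi> \<in> S" "poly_eval \<phi> p' \<noteq> 0"
        using p'(2) IX by (auto simp: vanishing_ideal_def)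
      obtain c where c: "c i0 = 1" "\<forall>a\<in>B. (\<Sum>b\<in>B. (\<Sum>i\<in>UNIV. c i *
         poly_eval (\<lambda>x. \<phi> (Inr x)) (partial_deriv a (partial_deriv b (f i)))) * \<phi> (Inl b)) = 0"
        using S[OF \<phi>(1)] by blast
      let ?\<psi> = "case_sum c \<phi>"
      interpret e: ring_map "poly_eval ?\<psi>" by (rule ring_map_poly_eval)
      have "poly_eval ?\<psi> (pencil_hessian i0 f a b) = (\<Sum>i\<in>UNIV. c i *
         poly_eval (\<lambda>x. \<phi> (Inr x)) (partial_deriv a (partial_deriv b (f i))))" for a b
        unfolding pencil_hessian_def e.map_sum e.map_mult poly_eval_subst
        using c(1) by (intro sum.cong refl arg_cong2[where f = "(*)"])
          (auto simp: poly_eval_Var e.map_one)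
      then have "?\<psi> \<in> degenerate_points B i0 f"
        using c(2) by (simp add: degenerate_points_def)
      moreover have "poly_eval ?\<psi> p \<noteq> 0"
        using \<phi>(2) by (simp add: p'(1) poly_eval_subst poly_eval_Var)
      ultimately show ?thesis
        by blast
    qed
  qed
  then obtain Q where Q: "dense_prime Q (degenerate_points B i0 f)" "Q \<inter> M0 = {}"
    by blast
  interpret Q: dense_prime Q "degenerate_points B i0 f" by (rule Q(1))
  let ?X = "Inl ` (UNIV - {i0}) \<union> Inr ` (Inl ` B \<union> Inr ` B) :: ('s + 'v + 'v) set"
  have IQ: "Q \<inter> polys (Inr ` I) = {0}"
  proof -
    have "h = 0" if h: "h \<in> Q" "h \<in> polys (Inr ` I)" for h
    proof (rule ccontr)
      assume "h \<noteq> 0"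
      let ?h = "subst (case_sum (\<lambda>_. 0) Var) h :: ('v + 'v, 'k) mpoly"
      have h1: "?h \<in> polys I"
        by (rule subst_polys[OF h(2)]) auto
      have h2: "?\<iota> ?h = h"
      proof -
        have "?\<iota> ?h = subst Var h"
          unfolding subst_subst
          by (rule eval_hom_cong[OF h(2)]) (auto simp: eval_hom_Var[OF ring_map_const])
        then show ?thesis
          by (simp add: subst_Var)
      qed
      have "?h \<noteq> 0"
        using h2 \<open>h \<noteq> 0\<close> by auto
      then have "h \<in> M0"
        unfolding M0_def using h1 by (intro image_eqI[of _ _ ?h]) (auto simp: h2)
      then show False
        using Q(2) h(1) by blast
    qed
    then show ?thesis
      using Q.zero_mem by auto
  qed
  have "Inr ` I \<subseteq> ?X"
    using I(1) by auto
  from schmidt_rank_le_generic[OF Q(1) B f d char this IQ] obtain c where c: "c i0 = 1"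
    "schmidt_rank B (\<Sum>i\<in>UNIV. const_poly (c i) * f i) \<le> enat ((d - 2) * (card ?X - card (Inr ` I :: ('s + 'v + 'v) set)))"
    by blast
  have "card ?X = (CARD('s) - 1) + card (B <+> B)"
  proof -
    have "?X = (UNIV - {i0}) <+> (B <+> B)"
      by auto
    then show ?thesis
      using B by (simp add: card_Plus card_Diff_singleton)
  qed
  moreover have "card (Inr ` I :: ('s + 'v + 'v) set) = card I"
    by (simp add: card_image)
  moreover have "card I \<le> card (B <+> B)"
    using I(1) fin by (rule card_mono[rotated])
  ultimately have "card ?X - card (Inr ` I :: ('s + 'v + 'v) set) = (card (B <+> B) - card I) + (CARD('s) - 1)"
    by simp
  then have "enat ((d - 2) * (card ?X - card (Inr ` I :: ('s + 'v + 'v) set)))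
      = enat (d - 2) * (enat (card (B <+> B) - card I) + enat (CARD('s) - 1))"
    by simp
  also have "\<dots> \<le> enat (d - 2) * (prime_height (poly_ring (B <+> B)) P + enat (CARD('s) - 1))"
    using height by (intro mult_left_mono add_right_mono) auto
  finally show ?thesis
    using c by (meson order_trans)
qed

text \<open>
  A linear functional that vanishes on the span of \<open>W\<close> but not everywhere, in coordinates.
\<close>

lemma ex_annihilator:
  fixes W :: "('k::field ^ 's::finite) set"
  assumes "vec.dim W < CARD('s)"
  shows "\<exists>c. (\<exists>i. c i \<noteq> 0) \<and> (\<forall>w\<in>W. (\<Sum>i\<in>UNIV. c i * w $ i) = 0)"
proof -
  interpret vs: vector_space "(*) :: 'k \<Rightarrow> 'k \<Rightarrow> 'k"
    by unfold_locales (auto simp: algebra_simps)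
  interpret pair: vector_space_pair "(*s) :: 'k \<Rightarrow> 'k ^ 's \<Rightarrow> _" "(*) :: 'k \<Rightarrow> 'k \<Rightarrow> 'k" ..
  obtain A where A: "A \<subseteq> W" "vec.independent A" "W \<subseteq> vec.span A" "card A = vec.dim W"
    using vec.basis_exists by blast
  have "vec.span A \<noteq> UNIV"
  proof
    assume "vec.span A = UNIV"
    then have "vec.dim (UNIV :: ('k ^ 's) set) \<le> card A"
      using vec.dim_le_card[of UNIV A] vec.finiteI_independent[OF A(2)] by auto
    then show False
      using A(4) assms by (simp add: vec.dim_UNIV card_cart_basis)
  qed
  then obtain x where x: "x \<notin> vec.span A"
    by blast
  then have "vec.independent (insert x A)"
    using A(2) by (rule vec.independent_insertI)
  then obtain g where g: "Vector_Spaces.linear (*s) (*) g"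
    "\<forall>y\<in>insert x A. g y = (if y = x then 1 else 0)"
    using pair.linear_independent_extend[of "insert x A" "\<lambda>y. if y = x then 1 else 0"] by blast
  interpret g: Vector_Spaces.linear "(*s)" "(*)" g by (rule g(1))
  have xA: "x \<notin> A"
    using x vec.span_base by blast
  have zero: "g w = 0" if "w \<in> W" for w
  proof -
    have "w \<in> vec.span A"
      using A(3) that by blast
    then show ?thesis
    proof (induction rule: vec.span_induct_alt)
      case base
      show ?case by (rule g.zero)
    next
      case (step c a b)
      then show ?case
        using g(2) xA by (auto simp: g.add g.scale)
    qed
  qed
  have expand: "g w = (\<Sum>i\<in>UNIV. g (axis i 1) * w $ i)" for w
  proof -
    have "w = (\<Sum>i\<in>UNIV. w $ i *s axis i 1)"
      by (simp add: basis_expansion)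
    then have "g w = (\<Sum>i\<in>UNIV. w $ i * g (axis i 1))"
      by (metis (mono_tags, lifting) g.scale g.sum sum.cong)
    then show ?thesis
      by (simp add: mult.commute)
  qed
  have "g x = 1"
    using g(2) by simp
  have "\<exists>i. g (axis i 1) \<noteq> 0"
  proof (rule ccontr)
    assume "\<not> ?thesis"
    then have "g x = 0"
      unfolding expand[of x] by simp
    then show False
      using \<open>g x = 1\<close> by simp
  qed
  moreover have "(\<Sum>i\<in>UNIV. g (axis i 1) * w $ i) = 0" if "w \<in> W" for w
    using zero[OF that] unfolding expand[of w] .
  ultimately show ?thesis
    by (intro exI[of _ "\<lambda>i. g (axis i 1)"]) simp
qed

lemma (in prime_polys) prod_mem:
  assumes "finite A" "\<And>i. i \<in> A \<Longrightarrow> f i \<in> polys X" "prod f A \<in> P"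
  shows "\<exists>i\<in>A. f i \<in> P"
  using assms
proof (induction A)
  case empty
  then show ?case
    using one_notin by simp
next
  case (insert i A)
  then show ?case
    using prime[of "f i" "prod f A"] polys_prod[of A f X] by auto
qed

lemma Inf_enat_mem: "A \<noteq> {} \<Longrightarrow> Inf A \<in> (A :: enat set)"
  unfolding Inf_enat_def by (auto intro: LeastI)

theorem theorem1p3:
  fixes smul :: "'k::field \<Rightarrow> 'v::ab_group_add \<Rightarrow> 'v"
    and B :: "'v set"
    and d :: nat
  assumes V: "finite_dimensional_vector_space smul B"
    and d: "d \<ge> 3"
    and char: "\<not> CHAR('k) dvd (d - 1) * d"
  shows "(\<forall>f :: ('v, 'k) mpoly. f \<in> forms B d \<longrightarrow>
            schmidt_rank B f \<le> 2 ^ (d - 3) * g'_sym smul B f) \<and>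
         ((\<forall>p :: 'k poly. degree p > 0 \<longrightarrow> (\<exists>x. poly p x = 0)) \<longrightarrow>
            (\<forall>fs :: 's::finite \<Rightarrow> ('v, 'k) mpoly. (\<forall>i. fs i \<in> forms B d) \<longrightarrow>
               schmidt_rank_collection B fs \<le>
                 2 ^ (d - 3) * (g_sym_collection smul B fs
                                + enat (CARD('s) - 1))))"
proof -
  interpret V: finite_dimensional_vector_space smul B by (rule V)
  have finB: "finite B"
    by (rule V.finite_Basis)
  have char': "of_nat ((d - 1) * d) \<noteq> (0 :: 'k)"
    using char by (simp only: of_nat_eq_0_iff_char_dvd not_False_eq_True)
  have pow2: "enat (2 ^ n) = 2 ^ n" for n
  proof (induction n)
    case (Suc n)
    have "enat (2 ^ Suc n) = enat 2 * enat (2 ^ n)"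
      by simp
    then show ?case
      unfolding Suc by (simp add: numeral_eq_enat)
  qed (simp add: one_enat_def)
  have infinity: "(2 :: enat) ^ n * \<infinity> = \<infinity>" for n
    by (simp add: imult_is_infinity zero_enat_def flip: pow2)
  have power: "enat (d - 2) * x \<le> 2 ^ (d - 3) * x" for x
  proof -
    have "d - 2 \<le> 2 ^ (d - 3)"
      using d less_exp[of "d - 3"] by linarith
    then have "enat (d - 2) \<le> enat (2 ^ (d - 3))"
      by simp
    also note pow2
    finally show ?thesis
      by (rule mult_right_mono) simp
  qed
  let ?rep = "module.representation smul B"
  have rep_basis: "?rep a b = (if b = a then 1 else 0)" if "a \<in> B" for a b
    using V.representation_basis[OF V.independent_Basis that] by simp
  have hess1: "hessian smul B f x a v = (\<Sum>b\<in>B. poly_eval (?rep x) (partial_deriv a (partial_deriv b f)) * ?rep v b)"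
    if "a \<in> B" for f x v a
  proof -
    have "hessian smul B f x a v = (\<Sum>b\<in>B. if b = a then
        \<Sum>c\<in>B. poly_eval (?rep x) (partial_deriv b (partial_deriv c f)) * ?rep v c else 0)"
      unfolding hessian_def rep_basis[OF that] by (intro sum.cong) auto
    then show ?thesis
      using that finB by simp
  qed
  have hess2: "hessian smul B f x v a = (\<Sum>b\<in>B. poly_eval (?rep x) (partial_deriv a (partial_deriv b f)) * ?rep v b)"
    if "a \<in> B" for f x v a
  proof -
    have "hessian smul B f x v a = (\<Sum>b\<in>B. \<Sum>c\<in>B. if c = a then
        poly_eval (?rep x) (partial_deriv b (partial_deriv c f)) * ?rep v b else 0)"
      unfolding hessian_def rep_basis[OF that] by (intro sum.cong) auto
    also have "\<dots> = (\<Sum>b\<in>B. poly_eval (?rep x) (partial_deriv b (partial_deriv a f)) * ?rep v b)"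
      using that finB by simp
    finally show ?thesis
      by (simp only: partial_deriv_commute[of a])
  qed
  show ?thesis
  proof (intro conjI allI impI)
    fix f :: "('v, 'k) mpoly"
    assume f: "f \<in> forms B d"
    let ?Z = "zariski_closure (B <+> B) (pair_coords smul B ` Z_sym smul B f)"
    show "schmidt_rank B f \<le> 2 ^ (d - 3) * g'_sym smul B f"
    proof (cases "?Z = {}")
      case True
      then have "g'_sym smul B f = \<infinity>"
        by (simp add: g'_sym_def codim_closure_def codim_def top_enat_def)
      then show ?thesis
        by (simp add: infinity)
    next
      case False
      then obtain P where P: "P \<in> ?Z" and height: "g'_sym smul B f = prime_height (poly_ring (B <+> B)) P"
        using Inf_enat_mem[of "prime_height (poly_ring (B <+> B)) ` ?Z"]
        by (auto simp: g'_sym_def codim_closure_def codim_def)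
      \<comment> \<open>A single form is a collection indexed by the unit type, without free coefficients.\<close>
      have "\<exists>c. c () = 1 \<and> schmidt_rank B (\<Sum>i\<in>UNIV. const_poly (c i) * f)
        \<le> enat (d - 2) * (prime_height (poly_ring (B <+> B)) P + enat (CARD(unit) - 1))"
      proof (rule schmidt_rank_le_height[OF finB f d char'])
        show "primeideal P (poly_ring (B <+> B))"
          "vanishing_ideal (B <+> B) (pair_coords smul B ` Z_sym smul B f) \<subseteq> P"
          using P by (auto simp: zariski_closure_def)
        fix p assume "p \<in> pair_coords smul B ` Z_sym smul B f"
        then obtain v x where p: "p = pair_coords smul B (v, x)" and "\<forall>u. hessian smul B f x v u = 0"
          by (auto simp: Z_sym_def)
        then show "\<exists>c. c () = 1 \<and> (\<forall>a\<in>B. (\<Sum>b\<in>B. (\<Sum>i\<in>UNIV. c i *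
            poly_eval (\<lambda>x. p (Inr x)) (partial_deriv a (partial_deriv b f))) * p (Inl b)) = 0)"
          using hess2[of _ f x v] by (intro exI[of _ "\<lambda>_. 1"]) (simp add: pair_coords_def UNIV_unit)
      qed
      then have "schmidt_rank B f \<le> enat (d - 2) * prime_height (poly_ring (B <+> B)) P"
        by (auto simp: UNIV_unit zero_enat_def[symmetric])
      then show ?thesis
        unfolding height using power order_trans by blast
    qed
  next
    fix fs :: "'s \<Rightarrow> ('v, 'k) mpoly"
    assume fs: "\<forall>i. fs i \<in> forms B d"
    let ?S = "pair_coords smul B ` Z_sym_collection smul B fs"
    let ?Z = "zariski_closure (B <+> B) ?S"
    show "schmidt_rank_collection B fs \<le> 2 ^ (d - 3) * (g_sym_collection smul B fs + enat (CARD('s) - 1))"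
    proof (cases "?Z = {}")
      case True
      then have "g_sym_collection smul B fs = \<infinity>"
        by (simp add: g_sym_collection_def codim_closure_def codim_def top_enat_def)
      then show ?thesis
        by (simp add: infinity)
    next
      case False
      then obtain P where P: "P \<in> ?Z" and height: "g_sym_collection smul B fs = prime_height (poly_ring (B <+> B)) P"
        using Inf_enat_mem[of "prime_height (poly_ring (B <+> B)) ` ?Z"]
        by (auto simp: g_sym_collection_def codim_closure_def codim_def)
      have prime: "primeideal P (poly_ring (B <+> B))" and van: "vanishing_ideal (B <+> B) ?S \<subseteq> P"
        using P by (auto simp: zariski_closure_def)
      interpret P: prime_polys "B <+> B" P
        by (rule primeideal_imp_prime_polys[OF prime])
      define kernel where "kernel p c \<longleftrightarrow> (\<forall>a\<in>B. (\<Sum>b\<in>B. (\<Sum>i\<in>UNIV. c i *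
            poly_eval (\<lambda>x. p (Inr x)) (partial_deriv a (partial_deriv b (fs i)))) * p (Inl b)) = 0)"
        for p :: "'v + 'v \<Rightarrow> 'k" and c
      \<comment> \<open>A prime over the ideal of a finite union is over the ideal of one of the parts, so one index
        \<open>i0\<close> can be fixed at which the coefficient vectors are normalised.\<close>
      define T where "T i0 = {p \<in> ?S. \<exists>c. c i0 = 1 \<and> kernel p c}" for i0
      have cover: "\<exists>i0. p \<in> T i0" if p: "p \<in> ?S" for p
      proof -
        obtain v x where vx: "p = pair_coords smul B (v, x)" and
          "vec.dim (range (\<lambda>v'. \<chi> i. hessian smul B (fs i) x v' v)) < CARD('s)"
          using p by (auto simp: Z_sym_collection_def)
        from ex_annihilator[OF this(2)] obtain c i0 where c: "c i0 \<noteq> 0"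
          "\<And>v'. (\<Sum>i\<in>UNIV. c i * hessian smul B (fs i) x v' v) = 0"
          by auto
        have "kernel p (\<lambda>i. c i / c i0)"
          unfolding kernel_def
        proof
          fix a assume a: "a \<in> B"
          have "(\<Sum>b\<in>B. (\<Sum>i\<in>UNIV. c i / c i0 *
            poly_eval (\<lambda>x. p (Inr x)) (partial_deriv a (partial_deriv b (fs i)))) * p (Inl b))
            = (\<Sum>i\<in>UNIV. c i * hessian smul B (fs i) x a v) / c i0"
            unfolding hess1[OF a] sum_distrib_left sum_distrib_right sum_divide_distrib
            by (subst sum.swap) (simp add: vx pair_coords_def field_simps)
          then show "(\<Sum>b\<in>B. (\<Sum>i\<in>UNIV. c i / c i0 *
            poly_eval (\<lambda>x. p (Inr x)) (partial_deriv a (partial_deriv b (fs i)))) * p (Inl b)) = 0"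
            using c(2) by simp
        qed
        then have "p \<in> T i0"
          using p c(1) by (auto simp: T_def intro!: exI[of _ "\<lambda>i. c i / c i0"])
        then show ?thesis ..
      qed
      have "\<exists>i0. vanishing_ideal (B <+> B) (T i0) \<subseteq> P"
      proof (rule ccontr)
        assume "\<not> ?thesis"
        then have "\<forall>i0. \<exists>q. q \<in> vanishing_ideal (B <+> B) (T i0) \<and> q \<notin> P"
          by blast
        then obtain q where q: "\<And>i0. q i0 \<in> vanishing_ideal (B <+> B) (T i0)" "\<And>i0. q i0 \<notin> P"
          by metis
        have qX: "q i \<in> polys (B <+> B)" for i
          using q(1) by (auto simp: vanishing_ideal_def)
        have "poly_eval p (\<Prod>i\<in>UNIV. q i) = 0" if p: "p \<in> ?S" for p
        proof -
          obtain i0 where "p \<in> T i0"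
            using cover p by blast
          then have "poly_eval p (q i0) = 0"
            using q(1) by (auto simp: vanishing_ideal_def)
          then show ?thesis
            by (auto simp: ring_map.map_prod[OF ring_map_poly_eval])
        qed
        then have "(\<Prod>i\<in>UNIV. q i) \<in> vanishing_ideal (B <+> B) ?S"
          using qX by (auto simp: vanishing_ideal_def intro!: polys_prod)
        then have "(\<Prod>i\<in>UNIV. q i) \<in> P"
          using van by blast
        then show False
          using P.prod_mem[of UNIV q] qX q(2) by auto
      qed
      then obtain i0 where i0: "vanishing_ideal (B <+> B) (T i0) \<subseteq> P"
        by blast
      have "\<exists>c. c i0 = 1 \<and> schmidt_rank B (\<Sum>i\<in>UNIV. const_poly (c i) * fs i)
        \<le> enat (d - 2) * (prime_height (poly_ring (B <+> B)) P + enat (CARD('s) - 1))"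
        by (rule schmidt_rank_le_height[OF finB _ d char' prime i0])
           (use fs in \<open>auto simp: T_def kernel_def\<close>)
      then obtain c where c: "c i0 = 1" "schmidt_rank B (\<Sum>i\<in>UNIV. const_poly (c i) * fs i)
        \<le> enat (d - 2) * (prime_height (poly_ring (B <+> B)) P + enat (CARD('s) - 1))"
        by blast
      have "(\<chi> i. c i) \<noteq> 0"
        using c(1) by (auto simp: vec_eq_iff intro!: exI[of _ i0])
      then have "schmidt_rank_collection B fs \<le> schmidt_rank B (\<Sum>i\<in>UNIV. const_poly ((\<chi> i. c i) $ i) * fs i)"
        unfolding schmidt_rank_collection_def by (intro INF_lower) simp
      also have "\<dots> \<le> enat (d - 2) * (prime_height (poly_ring (B <+> B)) P + enat (CARD('s) - 1))"
        using c(2) by simp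
      also have "\<dots> \<le> 2 ^ (d - 3) * (prime_height (poly_ring (B <+> B)) P + enat (CARD('s) - 1))"
        by (rule power)
      finally show ?thesis
        unfolding height .
    qed
  qed
qed

end
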